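(* Let $n\ge 1$. The evaluation map $S_n^{nc}\to\mathbb C$ at the vertex $1^+$ (and thus at any vertex) induces an isomorphism $K_*(S_n^{nc})\to K_*(\mathbb C)$.
   Context: $S_n^{nc}$ denotes the universal $C^*$-algebra with $2n+2$ positive generators $h_{0+},h_{1+},\dots,h_{n+},h_{0-},\dots,h_{n-}$ satisfying the relations $\sum_i h_{i+}+\sum_i h_{i-}=1$ and $h_{i+}h_{i-}=0$ for all $i=0,\dots,n$. (Equivalently, it is the universal $C^*$-algebra with self-adjoint generators $x_0,\dots,x_n$ satisfying $\sum_i x_i^2=1$, with $h_{i\pm}=(x_i)_\pm^2$. It is the noncommutative flag complex algebra of the simplicial complex $\Sigma_{S^n}$ with vertices $0^+,\dots,n^+,0^-,\dots,n^-$ whose simplexes are the non-empty vertex sets containing no pair $\{i^+,i^-\}$.) The evaluation map at a vertex $v$ is the unital homomorphism $S_n^{nc}\to\mathbb C$ mapping the generator $h_v$ to $1$ and all other generators to $0$. *)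

theory Defs
  imports "HOL-Analysis.Analysis" "HOL-Algebra.Module" "HOL-Algebra.Subrings"
begin

section \<open>Unital C*-algebras\<close>

text \<open>C*-algebras are carrier-based, extending the module records of HOL-Algebra, because both
  universal properties and algebras depending on a number \<open>n\<close> are needed.\<close>

record 'a cstar = "(complex, 'a) module" +
  star :: "'a \<Rightarrow> 'a"
  nrm :: "'a \<Rightarrow> real"

definition complex_ring :: "complex ring" where
  "complex_ring = \<lparr>carrier = UNIV, mult = (*), one = 1, zero = 0, add = (+)\<rparr>"

text \<open>The guard makes this a total metric in the sense of \<^locale>\<open>Metric_space\<close>, whose
  nonnegativity and symmetry axioms are not relativised to the carrier.\<close>

definition cdist :: "'a cstar \<Rightarrow> 'a \<Rightarrow> 'a \<Rightarrow> real" where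
  "cdist A x y = (if x \<in> carrier A \<and> y \<in> carrier A then nrm A (x \<ominus>\<^bsub>A\<^esub> y) else 0)"

abbreviation ctopology :: "'a cstar \<Rightarrow> 'a topology" where
  "ctopology A \<equiv> Metric_space.mtopology (carrier A) (cdist A)"

text \<open>The zero algebra is allowed.\<close>

locale unital_cstar_algebra = ring A + scal: module complex_ring A
  for A :: "'a cstar" (structure) +
  assumes smult_mult_left:
      "\<lbrakk>x \<in> carrier A; y \<in> carrier A\<rbrakk> \<Longrightarrow> (c \<odot> x) \<otimes> y = c \<odot> (x \<otimes> y)"
    and smult_mult_right:
      "\<lbrakk>x \<in> carrier A; y \<in> carrier A\<rbrakk> \<Longrightarrow> x \<otimes> (c \<odot> y) = c \<odot> (x \<otimes> y)"
    and star_closed: "x \<in> carrier A \<Longrightarrow> star A x \<in> carrier A"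
    and star_star: "x \<in> carrier A \<Longrightarrow> star A (star A x) = x"
    and star_add:
      "\<lbrakk>x \<in> carrier A; y \<in> carrier A\<rbrakk> \<Longrightarrow> star A (x \<oplus> y) = star A x \<oplus> star A y"
    and star_smult: "x \<in> carrier A \<Longrightarrow> star A (c \<odot> x) = cnj c \<odot> star A x"
    and star_mult:
      "\<lbrakk>x \<in> carrier A; y \<in> carrier A\<rbrakk> \<Longrightarrow> star A (x \<otimes> y) = star A y \<otimes> star A x"
    and nrm_nonneg: "x \<in> carrier A \<Longrightarrow> 0 \<le> nrm A x"
    and nrm_eq_0: "x \<in> carrier A \<Longrightarrow> nrm A x = 0 \<longleftrightarrow> x = \<zero>"
    and nrm_triangle:
      "\<lbrakk>x \<in> carrier A; y \<in> carrier A\<rbrakk> \<Longrightarrow> nrm A (x \<oplus> y) \<le> nrm A x + nrm A y"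
    and nrm_smult: "x \<in> carrier A \<Longrightarrow> nrm A (c \<odot> x) = cmod c * nrm A x"
    and nrm_mult:
      "\<lbrakk>x \<in> carrier A; y \<in> carrier A\<rbrakk> \<Longrightarrow> nrm A (x \<otimes> y) \<le> nrm A x * nrm A y"
    and cstar_identity: "x \<in> carrier A \<Longrightarrow> nrm A (star A x \<otimes> x) = (nrm A x)\<^sup>2"
    and complete: "Metric_space.mcomplete (carrier A) (cdist A)"

text \<open>Since \<^const>\<open>ring_hom\<close> preserves the unit, these are the unital *-homomorphisms.\<close>

definition cstar_hom :: "'a cstar \<Rightarrow> 'b cstar \<Rightarrow> ('a \<Rightarrow> 'b) set" where
  "cstar_hom A B = {\<phi> \<in> ring_hom A B.
     (\<forall>c. \<forall>x\<in>carrier A. \<phi> (c \<odot>\<^bsub>A\<^esub> x) = c \<odot>\<^bsub>B\<^esub> \<phi> x) \<and>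
     (\<forall>x\<in>carrier A. \<phi> (star A x) = star B (\<phi> x))}"

definition cpositive :: "'a cstar \<Rightarrow> 'a \<Rightarrow> bool" where
  "cpositive A x \<longleftrightarrow> (\<exists>y\<in>carrier A. x = star A y \<otimes>\<^bsub>A\<^esub> y)"

definition unital_cstar_subalgebra :: "'a set \<Rightarrow> 'a cstar \<Rightarrow> bool" where
  "unital_cstar_subalgebra S A \<longleftrightarrow> subring S A \<and>
     (\<forall>c. \<forall>x\<in>S. c \<odot>\<^bsub>A\<^esub> x \<in> S) \<and> (\<forall>x\<in>S. star A x \<in> S) \<and> closedin (ctopology A) S"

definition cstar_generated_by :: "'a cstar \<Rightarrow> 'a set \<Rightarrow> bool" where
  "cstar_generated_by A G \<longleftrightarrow>
     (\<forall>S. unital_cstar_subalgebra S A \<and> G \<subseteq> S \<longrightarrow> S = carrier A)"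

definition complex_cstar :: "complex cstar" where
  "complex_cstar = \<lparr>carrier = UNIV, mult = (*), one = 1, zero = 0, add = (+),
     smult = (*), star = cnj, nrm = cmod\<rparr>"


section \<open>The universal C*-algebra of the noncommutative sphere\<close>

datatype sign = Plus | Minus

type_synonym vertex = "nat \<times> sign"

definition sphere_vertices :: "nat \<Rightarrow> vertex set" where
  "sphere_vertices n = {..n} \<times> UNIV"

definition sphere_relations :: "nat \<Rightarrow> 'a cstar \<Rightarrow> (vertex \<Rightarrow> 'a) \<Rightarrow> bool" where
  "sphere_relations n A h \<longleftrightarrow>
     (\<forall>v\<in>sphere_vertices n. cpositive A (h v)) \<and>
     (\<Oplus>\<^bsub>A\<^esub>i\<in>{..n}. h (i, Plus)) \<oplus>\<^bsub>A\<^esub> (\<Oplus>\<^bsub>A\<^esub>i\<in>{..n}. h (i, Minus)) = \<one>\<^bsub>A\<^esub> \<and>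
     (\<forall>i\<le>n. h (i, Plus) \<otimes>\<^bsub>A\<^esub> h (i, Minus) = \<zero>\<^bsub>A\<^esub>)"

text \<open>
  \<open>(A, h)\<close> is the universal C*-algebra on these generators and relations: it is generated by
  the \<open>h v\<close>, and every family in a C*-algebra satisfying the relations is the image of \<open>h\<close>
  under a homomorphism (unique, by generation).  One cannot quantify over types, so the target
  algebras have their carrier inside the fixed type \<^typ>\<open>nat \<Rightarrow> complex\<close>.  Nothing is lost: such a
  homomorphism may be taken to land in the C*-subalgebra generated by finitely many elements,
  which is separable, hence has at most the cardinality of the continuum, hence is isomorphic
  to an algebra with carrier in \<^typ>\<open>nat \<Rightarrow> complex\<close>.
\<close>

definition universal_sphere_algebra :: "nat \<Rightarrow> 'a cstar \<Rightarrow> (vertex \<Rightarrow> 'a) \<Rightarrow> bool" where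
  "universal_sphere_algebra n A h \<longleftrightarrow>
     unital_cstar_algebra A \<and> sphere_relations n A h \<and>
     cstar_generated_by A (h ` sphere_vertices n) \<and>
     (\<forall>(B :: (nat \<Rightarrow> complex) cstar) k.
        unital_cstar_algebra B \<and> sphere_relations n B k \<longrightarrow>
        (\<exists>\<phi>\<in>cstar_hom A B. \<forall>v\<in>sphere_vertices n. \<phi> (h v) = k v))"

definition is_evaluation ::
  "nat \<Rightarrow> 'a cstar \<Rightarrow> (vertex \<Rightarrow> 'a) \<Rightarrow> vertex \<Rightarrow> ('a \<Rightarrow> complex) \<Rightarrow> bool" where
  "is_evaluation n A h v ev \<longleftrightarrow> ev \<in> cstar_hom A complex_cstar \<and>
     (\<forall>w\<in>sphere_vertices n. ev (h w) = (if w = v then 1 else 0))"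


section \<open>Matrices over a C*-algebra\<close>

text \<open>A \<open>k \<times> l\<close> matrix is a function on all index pairs that vanishes outside the
  \<open>k \<times> l\<close> block, so that each matrix has a unique representative.\<close>

type_synonym 'a mtx = "nat \<Rightarrow> nat \<Rightarrow> 'a"

definition mats :: "'a cstar \<Rightarrow> nat \<Rightarrow> nat \<Rightarrow> 'a mtx set" where
  "mats A k l = {a. (\<forall>i j. a i j \<in> carrier A) \<and> (\<forall>i j. k \<le> i \<or> l \<le> j \<longrightarrow> a i j = \<zero>\<^bsub>A\<^esub>)}"

text \<open>The number \<open>m\<close> is the common inner dimension.\<close>

definition mtx_mult :: "'a cstar \<Rightarrow> nat \<Rightarrow> 'a mtx \<Rightarrow> 'a mtx \<Rightarrow> 'a mtx" where
  "mtx_mult A m a b = (\<lambda>i j. \<Oplus>\<^bsub>A\<^esub>l\<in>{..<m}. a i l \<otimes>\<^bsub>A\<^esub> b l j)"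

definition mtx_one :: "'a cstar \<Rightarrow> nat \<Rightarrow> 'a mtx" where
  "mtx_one A k = (\<lambda>i j. if i = j \<and> i < k then \<one>\<^bsub>A\<^esub> else \<zero>\<^bsub>A\<^esub>)"

definition mtx_star :: "'a cstar \<Rightarrow> 'a mtx \<Rightarrow> 'a mtx" where
  "mtx_star A a = (\<lambda>i j. star A (a j i))"

definition mtx_map :: "('a \<Rightarrow> 'b) \<Rightarrow> 'a mtx \<Rightarrow> 'b mtx" where
  "mtx_map \<phi> a = (\<lambda>i j. \<phi> (a i j))"

text \<open>Square matrices of arbitrary size are pairs consisting of the size and the matrix, and
  \<open>block_sum\<close> is the block diagonal sum of square matrices.\<close>

type_synonym 'a sqmtx = "nat \<times> 'a mtx"

definition block_sum :: "'a cstar \<Rightarrow> 'a sqmtx \<Rightarrow> 'a sqmtx \<Rightarrow> 'a sqmtx" where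
  "block_sum A p q = (fst p + fst q,
     \<lambda>i j. if i < fst p \<and> j < fst p then snd p i j
           else if fst p \<le> i \<and> fst p \<le> j then snd q (i - fst p) (j - fst p)
           else \<zero>\<^bsub>A\<^esub>)"

definition sqmtx_map :: "('a \<Rightarrow> 'b) \<Rightarrow> 'a sqmtx \<Rightarrow> 'b sqmtx" where
  "sqmtx_map \<phi> p = (fst p, mtx_map \<phi> (snd p))"


section \<open>The K-groups of a unital C*-algebra\<close>

text \<open>\<open>K\<^sub>0\<close> is the Grothendieck group of the monoid of projections in matrix algebras up to
  Murray--von Neumann equivalence.  Matrices of size \<open>0\<close> are allowed; the resulting projection is
  equivalent to the projection \<open>0\<close> of size \<open>1\<close>.\<close>

definition projections :: "'a cstar \<Rightarrow> 'a sqmtx set" where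
  "projections A = {(k, p). p \<in> mats A k k \<and> mtx_star A p = p \<and> mtx_mult A k p p = p}"

definition mvn_equiv :: "'a cstar \<Rightarrow> 'a sqmtx \<Rightarrow> 'a sqmtx \<Rightarrow> bool" where
  "mvn_equiv A p q \<longleftrightarrow> (\<exists>v\<in>mats A (fst q) (fst p).
     mtx_mult A (fst q) (mtx_star A v) v = snd p \<and>
     mtx_mult A (fst p) v (mtx_star A v) = snd q)"

text \<open>The pair \<open>(p, q)\<close> represents the formal difference \<open>[p] - [q]\<close>.\<close>

definition K0_rel :: "'a cstar \<Rightarrow> (('a sqmtx \<times> 'a sqmtx) \<times> ('a sqmtx \<times> 'a sqmtx)) set" where
  "K0_rel A = {((p, q), (p', q')).
     p \<in> projections A \<and> q \<in> projections A \<and> p' \<in> projections A \<and> q' \<in> projections A \<and>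
     (\<exists>r\<in>projections A. mvn_equiv A (block_sum A (block_sum A p q') r)
                                     (block_sum A (block_sum A p' q) r))}"

definition K0 :: "'a cstar \<Rightarrow> ('a sqmtx \<times> 'a sqmtx) set monoid" where
  "K0 A = \<lparr>carrier = (projections A \<times> projections A) // K0_rel A,
     mult = (\<lambda>X Y. \<Union>(p, q)\<in>X. \<Union>(p', q')\<in>Y. K0_rel A `` {(block_sum A p p', block_sum A q q')}),
     one = K0_rel A `` {((0, mtx_one A 0), (0, mtx_one A 0))}\<rparr>"

definition K0_map :: "'b cstar \<Rightarrow> ('a \<Rightarrow> 'b) \<Rightarrow>
    ('a sqmtx \<times> 'a sqmtx) set \<Rightarrow> ('b sqmtx \<times> 'b sqmtx) set" where
  "K0_map B \<phi> X = (\<Union>(p, q)\<in>X. K0_rel B `` {(sqmtx_map \<phi> p, sqmtx_map \<phi> q)})"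

text \<open>\<open>K\<^sub>1\<close> consists of the unitaries in matrix algebras up to stable homotopy.\<close>

definition unitaries :: "'a cstar \<Rightarrow> 'a sqmtx set" where
  "unitaries A = {(k, u). u \<in> mats A k k \<and>
     mtx_mult A k (mtx_star A u) u = mtx_one A k \<and>
     mtx_mult A k u (mtx_star A u) = mtx_one A k}"

text \<open>The norm topology of the C*-algebra of \<open>k \<times> k\<close> matrices is the topology of entrywise norm
  convergence, so norm continuous paths are the entrywise continuous ones.\<close>

definition unitary_homotopic :: "'a cstar \<Rightarrow> 'a sqmtx \<Rightarrow> 'a sqmtx \<Rightarrow> bool" where
  "unitary_homotopic A u v \<longleftrightarrow> fst u = fst v \<and>
     (\<exists>w :: real \<Rightarrow> 'a mtx.
        (\<forall>t\<in>{0..1}. (fst u, w t) \<in> unitaries A) \<and>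
        (\<forall>i j. continuous_map (top_of_set {0..1}) (ctopology A) (\<lambda>t. w t i j)) \<and>
        w 0 = snd u \<and> w 1 = snd v)"

definition K1_rel :: "'a cstar \<Rightarrow> ('a sqmtx \<times> 'a sqmtx) set" where
  "K1_rel A = {(u, v). u \<in> unitaries A \<and> v \<in> unitaries A \<and>
     (\<exists>r s. unitary_homotopic A (block_sum A u (r, mtx_one A r)) (block_sum A v (s, mtx_one A s)))}"

definition K1 :: "'a cstar \<Rightarrow> 'a sqmtx set monoid" where
  "K1 A = \<lparr>carrier = unitaries A // K1_rel A,
     mult = (\<lambda>X Y. \<Union>u\<in>X. \<Union>v\<in>Y. K1_rel A `` {block_sum A u v}),
     one = K1_rel A `` {(0, mtx_one A 0)}\<rparr>"

definition K1_map :: "'b cstar \<Rightarrow> ('a \<Rightarrow> 'b) \<Rightarrow> 'a sqmtx set \<Rightarrow> 'b sqmtx set" where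
  "K1_map B \<phi> X = (\<Union>u\<in>X. K1_rel B `` {sqmtx_map \<phi> u})"


section \<open>Consistency checks\<close>

lemma (in unital_cstar_algebra) Metric_space_cdist: "Metric_space (carrier A) (cdist A)"
proof
  have neg: "nrm A (\<ominus> x) = nrm A x" if x: "x \<in> carrier A" for x
  proof -
    have c: "(- 1) \<odot> x \<in> carrier A" 
      using scal.smult_closed[of "-1" x] x by (simp add: complex_ring_def)
    have "(- 1) \<odot> x \<oplus> x = (- 1 + 1) \<odot> x"
      using scal.smult_l_distr[of "-1" 1 x] scal.smult_one[of x] x
      by (simp add: complex_ring_def)
    also have "\<dots> = \<zero>"
      using scal.smult_l_null[of x] x by (simp add: complex_ring_def)
    finally have "\<ominus> x = (- 1) \<odot> x"
      using c x by (metis minus_equality)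
    then show ?thesis using nrm_smult[of x "-1"] x by simp
  qed
  show "0 \<le> cdist A x y" for x y by (auto simp: cdist_def intro: nrm_nonneg)
  show "cdist A x y = cdist A y x" for x y
  proof (cases "x \<in> carrier A \<and> y \<in> carrier A")
    case True
    then have "y \<ominus> x = \<ominus> (x \<ominus> y)" by (simp add: minus_eq minus_add a_comm)
    then show ?thesis using True neg[of "x \<ominus> y"] by (simp add: cdist_def)
  qed (auto simp: cdist_def)
  show "cdist A x y = 0 \<longleftrightarrow> x = y" if "x \<in> carrier A" "y \<in> carrier A" for x y
    using that by (simp add: cdist_def nrm_eq_0)
  show "cdist A x z \<le> cdist A x y + cdist A y z"
    if "x \<in> carrier A" "y \<in> carrier A" "z \<in> carrier A" for x y z
  proof -
    have "x \<ominus> z = (x \<ominus> y) \<oplus> (y \<ominus> z)"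
      using that by (simp add: minus_eq a_assoc r_neg1)
    then show ?thesis using that nrm_triangle[of "x \<ominus> y" "y \<ominus> z"] by (simp add: cdist_def)
  qed
qed

lemma unital_cstar_algebra_complex: "unital_cstar_algebra complex_cstar"
proof -
  have cring: "cring complex_ring"
    by (rule cringI[OF abelian_groupI comm_monoidI])
       (auto simp: complex_ring_def algebra_simps intro: exI[of _ "- x" for x] add.left_inverse)
  have ring: "ring complex_cstar"
    by (rule ringI[OF abelian_groupI monoidI])
       (auto simp: complex_cstar_def algebra_simps intro: exI[of _ "- x" for x] add.left_inverse)
  have ab: "abelian_group complex_cstar"
    using ring by (rule ring.axioms)
  interpret R: ring complex_cstar by (rule ring)
  have minus: "a \<ominus>\<^bsub>complex_cstar\<^esub> b = a - b" for a b
  proof -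
    have "\<ominus>\<^bsub>complex_cstar\<^esub> b = - b"
      by (rule R.minus_equality) (auto simp: complex_cstar_def)
    then show ?thesis by (simp add: a_minus_def complex_cstar_def)
  qed
  have cd: "cdist complex_cstar = dist"
    by (intro ext) (simp add: cdist_def minus dist_norm, simp add: complex_cstar_def)
  have comp: "Metric_space.mcomplete (carrier complex_cstar) (cdist complex_cstar)"
    unfolding cd using mcomplete_iff_complete[where ?'a = complex]
    by (simp add: complex_cstar_def complete_UNIV)
  show ?thesis
    by (intro unital_cstar_algebra.intro moduleI unital_cstar_algebra_axioms.intro ring cring ab comp)
       (auto simp: complex_cstar_def complex_ring_def algebra_simps norm_mult norm_triangle_ineq
          power2_eq_square)
qed

end

theory Submission
  imports Defs
begin

text \<open>
  Write \<open>v'\<close> for the vertex opposite to \<open>v\<close>. Evaluation at \<open>v\<close> followed by the inclusion of the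
  scalars is an endomorphism \<open>\<pi>\<close> of \<open>A\<close>, and evaluation is a left inverse of that inclusion; so the
  statement amounts to \<open>\<pi>\<close> acting as the identity on both K-groups.

  Three observations give this. First, a family \<open>k\<close> satisfying the relations with \<open>k v' = 0\<close> can be
  moved along straight lines to the family that is \<open>1\<close> at \<open>v\<close> and \<open>0\<close> elsewhere: the only products
  that must vanish and could be spoiled are those at the pair \<open>{v, v'}\<close>, and one factor stays \<open>0\<close>
  (\<open>contraction_relations\<close>). Secondly, apart from the product of the values at \<open>v\<close> and \<open>v'\<close>
  being \<open>0\<close>, the relations see an antipodal pair only through the sum \<open>c = h v + h v'\<close>: two families
  with the same sum can exchange their values at \<open>{v, v'}\<close> (\<open>replace_relations\<close>). Thirdly, inside \<open>2 \<times> 2\<close> matrices this exchange is a homotopy: conjugate only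
  the values at \<open>v\<close> and \<open>v'\<close> of the diagonal family by a rotation; their sum is the scalar matrix with
  entry \<open>c\<close>, which commutes with rotations, so the relations persist (\<open>exchange_homotopy\<close>).

  Now choose a vertex \<open>w\<close> outside \<open>{v, v'}\<close>, which is possible as \<open>n \<ge> 1\<close>, and let \<open>g\<close> be \<open>c\<close> at \<open>v\<close>,
  \<open>1 - c\<close> at \<open>w\<close> and \<open>0\<close> elsewhere. Exchanging the values of \<open>h\<close> and \<open>g\<close> at \<open>{v, v'}\<close> produces two
  families, of which one vanishes at \<open>v'\<close> and the other at \<open>w'\<close>. By the first observation \<open>g\<close> and these
  two families all induce \<open>\<pi>\<close> on K-theory, whence \<open>id + \<pi> = \<pi> + \<pi>\<close> there, and \<open>\<pi>\<close> can be cancelled.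

  The rest makes this argument available. Elements of a C*-algebra are handled through one
  elementary device: the square root of \<open>1 - x\<close> as the limit of an explicit iteration. It
  yields the theory of positive elements up to positivity of \<open>a* a\<close> (\<open>pos_star_mult\<close>), that
  homomorphisms are contractive (\<open>contractive\<close>), and, by way of the Cauchy--Schwarz inequality
  (\<open>finsum_cauchy_schwarz\<close>), that matrices over \<open>A\<close> acting on columns form a C*-algebra
  (\<open>unital_cstar_algebra_matalg\<close>). Close projections are equivalent (\<open>close_projections\<close>) and
  \<open>u \<oplus> u*\<close> is connected to \<open>1\<close> (\<open>whitehead\<close>); these make both K-functors homotopy invariant and
  cancellative. Finally \<open>A\<close> is separable, so \<open>A\<close> and its \<open>2 \<times> 2\<close> matrices can be copied into
  \<^typ>\<open>nat \<Rightarrow> complex\<close>, where the universal property applies (\<open>hom_exists\<close>).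
\<close>

section \<open>Elementary C*-algebra calculus\<close>

lemma atin_within_euclidean: "atin_within euclidean t S = at t within S"
  for t :: "'t::topological_space"
  by (simp add: filter_eq_iff eventually_atin_within eventually_at_topological) blast

context unital_cstar_algebra
begin

lemma sc_closed [simp, intro]: "x \<in> carrier A \<Longrightarrow> c \<odot> x \<in> carrier A"
  using scal.smult_closed[of c x] by (simp add: complex_ring_def)

text \<open>
  The normaliser for noncommutative rings, extended by the right unit law and by closure under the
  scalar action and the involution.
\<close>

lemmas cstar_simprules [algebra cstar "zero A" "add A" "a_inv A" "a_minus A" "one A" "mult A"] =
  ring_simprules r_one sc_closed star_closed

lemma sc_add_l: "x \<in> carrier A \<Longrightarrow> (c + d) \<odot> x = c \<odot> x \<oplus> d \<odot> x"
  using scal.smult_l_distr[of c d x] by (simp add: complex_ring_def)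

lemma sc_add_r: "x \<in> carrier A \<Longrightarrow> y \<in> carrier A \<Longrightarrow> c \<odot> (x \<oplus> y) = c \<odot> x \<oplus> c \<odot> y"
  using scal.smult_r_distr[of c x y] by (simp add: complex_ring_def)

lemma sc_assoc: "x \<in> carrier A \<Longrightarrow> c \<odot> (d \<odot> x) = (c * d) \<odot> x"
  using scal.smult_assoc1[of c d x] by (simp add: complex_ring_def)

lemma sc_one [simp]: "x \<in> carrier A \<Longrightarrow> 1 \<odot> x = x"
  using scal.smult_one[of x] by (simp add: complex_ring_def)

lemma sc_zero_l [simp]: "x \<in> carrier A \<Longrightarrow> 0 \<odot> x = \<zero>"
  using scal.smult_l_null[of x] by (simp add: complex_ring_def)

lemma sc_zero_r [simp]: "c \<odot> \<zero> = \<zero>"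
  using scal.smult_r_null[of c] by (simp add: complex_ring_def)

lemma sc_minus_l: "x \<in> carrier A \<Longrightarrow> (- c) \<odot> x = \<ominus> (c \<odot> x)"
  using sc_add_l[of x "-c" c] by (metis add.inv_equality add.left_inverse sc_closed sc_zero_l)

lemma sc_minus_r: "x \<in> carrier A \<Longrightarrow> c \<odot> (\<ominus> x) = \<ominus> (c \<odot> x)"
  using sc_add_r[of "\<ominus> x" x c] by (metis a_inv_closed l_neg minus_equality sc_closed sc_zero_r)

lemma sc_diff_r: "x \<in> carrier A \<Longrightarrow> y \<in> carrier A \<Longrightarrow> c \<odot> (x \<ominus> y) = c \<odot> x \<ominus> c \<odot> y"
  by (simp add: a_minus_def sc_add_r sc_minus_r)

lemma sc_diff_l: "x \<in> carrier A \<Longrightarrow> (c - d) \<odot> x = c \<odot> x \<ominus> d \<odot> x"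
  using sc_add_l[of x c "-d"] by (simp add: a_minus_def sc_minus_l)

lemmas sc_mult = smult_mult_left smult_mult_right

declare star_closed [simp, intro] star_star [simp]

lemma star_zero [simp]: "star A \<zero> = \<zero>"
  using star_smult[of \<zero> 0] by simp

lemma star_one [simp]: "star A \<one> = \<one>"
  using star_mult[of "star A \<one>" \<one>] star_mult[of \<one> "star A \<one>"]
  by (metis l_one one_closed r_one star_closed star_star)

lemma star_minus: "x \<in> carrier A \<Longrightarrow> star A (\<ominus> x) = \<ominus> star A x"
  using star_smult[of x "-1"] by (simp add: sc_minus_l)

lemma star_diff: "x \<in> carrier A \<Longrightarrow> y \<in> carrier A \<Longrightarrow> star A (x \<ominus> y) = star A x \<ominus> star A y"
  by (simp add: a_minus_def star_add star_minus)

lemma nrm_zero [simp]: "nrm A \<zero> = 0"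
  by (simp add: nrm_eq_0)

lemma nrm_minus [simp]: "x \<in> carrier A \<Longrightarrow> nrm A (\<ominus> x) = nrm A x"
  using nrm_smult[of x "-1"] by (simp add: sc_minus_l)

lemma nrm_diff: "x \<in> carrier A \<Longrightarrow> y \<in> carrier A \<Longrightarrow> nrm A (x \<ominus> y) \<le> nrm A x + nrm A y"
  using nrm_triangle[of x "\<ominus> y"] by (simp add: a_minus_def)

lemma nrm_diff_commute: "x \<in> carrier A \<Longrightarrow> y \<in> carrier A \<Longrightarrow> nrm A (x \<ominus> y) = nrm A (y \<ominus> x)"
  using nrm_minus[of "x \<ominus> y"] by (simp add: a_minus_def minus_add a_comm)

lemma nrm_star [simp]: assumes "x \<in> carrier A" shows "nrm A (star A x) = nrm A x"
proof -
  have le: "nrm A y \<le> nrm A (star A y)" if y: "y \<in> carrier A" for y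
  proof (cases "nrm A y = 0")
    case False
    have "(nrm A y)\<^sup>2 \<le> nrm A (star A y) * nrm A y"
      using cstar_identity[OF y] nrm_mult[of "star A y" y] y by auto
    then show ?thesis
      using False nrm_nonneg[OF y] by (simp add: power2_eq_square)
  qed (use nrm_nonneg y in auto)
  show ?thesis using le[OF assms] le[of "star A x"] assms by auto
qed

lemma nrm_one: "nrm A \<one> \<le> 1"
proof -
  have "nrm A \<one> = (nrm A \<one>)\<^sup>2" using cstar_identity[of \<one>] by simp
  then have "nrm A \<one> = 0 \<or> nrm A \<one> = 1" by (simp add: power2_eq_square)
  then show ?thesis by auto
qed

lemma nrm_sc_one: "nrm A (c \<odot> \<one>) \<le> cmod c"
  using nrm_smult[of \<one> c] nrm_one mult_left_le[of "nrm A \<one>" "cmod c"] by simp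

lemma nrm_sq_sa: "x \<in> carrier A \<Longrightarrow> star A x = x \<Longrightarrow> nrm A (x \<otimes> x) = (nrm A x)\<^sup>2"
  using cstar_identity[of x] by simp

lemma mult_closed_norm: "x \<in> carrier A \<Longrightarrow> y \<in> carrier A \<Longrightarrow> nrm A x \<le> a \<Longrightarrow> nrm A y \<le> b \<Longrightarrow> nrm A (x \<otimes> y)
    \<le> a * b"
  using nrm_mult[of x y] nrm_nonneg[of x] nrm_nonneg[of y] by (meson mult_mono' order_trans)

subsection \<open>Limits\<close>

text \<open>
  Convergence along an arbitrary filter serves sequences and paths alike; membership in the carrier
  is only required eventually, because a path on the unit interval is unconstrained outside it.
\<close>

definition tends :: "'i filter \<Rightarrow> ('i \<Rightarrow> 'a) \<Rightarrow> 'a \<Rightarrow> bool" where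
  "tends F y L \<longleftrightarrow> (\<forall>\<^sub>F t in F. y t \<in> carrier A) \<and> L \<in> carrier A \<and> ((\<lambda>t. nrm A (y t \<ominus> L)) \<longlongrightarrow> 0) F"

lemma tends_closed: "tends F y L \<Longrightarrow> L \<in> carrier A"
  by (simp add: tends_def)

lemma tendsI:
  assumes "\<forall>\<^sub>F t in F. y t \<in> carrier A" "L \<in> carrier A"
    "\<forall>\<^sub>F t in F. nrm A (y t \<ominus> L) \<le> e t" "(e \<longlongrightarrow> 0) F"
  shows "tends F y L"
  unfolding tends_def
proof (intro conjI assms)
  show "((\<lambda>t. nrm A (y t \<ominus> L)) \<longlongrightarrow> 0) F"
    by (rule tendsto_sandwich[OF _ assms(3) tendsto_const assms(4)])
       (use assms(1,2) in \<open>auto elim!: eventually_mono intro!: nrm_nonneg\<close>)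
qed

lemma tends_const: "x \<in> carrier A \<Longrightarrow> tends F (\<lambda>_. x) x"
  by (simp add: tends_def a_minus_def r_neg)

lemma tends_cong: "\<forall>\<^sub>F t in F. y t = z t \<Longrightarrow> tends F y L \<Longrightarrow> tends F z L"
  unfolding tends_def
proof (elim conjE, intro conjI)
  assume e: "\<forall>\<^sub>F t in F. y t = z t" and y: "\<forall>\<^sub>F t in F. y t \<in> carrier A"
    and l: "((\<lambda>t. nrm A (y t \<ominus> L)) \<longlongrightarrow> 0) F"
  show "\<forall>\<^sub>F t in F. z t \<in> carrier A" using e y by (auto elim: eventually_elim2)
  have "\<forall>\<^sub>F t in F. nrm A (y t \<ominus> L) = nrm A (z t \<ominus> L)" using e by (rule eventually_mono) simp
  from tendsto_cong[OF this] show "((\<lambda>t. nrm A (z t \<ominus> L)) \<longlongrightarrow> 0) F" using l by simp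
qed

lemma tends_add:
  assumes "tends F y L" "tends F z M" shows "tends F (\<lambda>t. y t \<oplus> z t) (L \<oplus> M)"
proof (rule tendsI)
  note c = assms[unfolded tends_def]
  show "\<forall>\<^sub>F t in F. y t \<oplus> z t \<in> carrier A" using c by (auto elim: eventually_elim2)
  show "L \<oplus> M \<in> carrier A" using c by simp
  have "nrm A ((y' \<oplus> z') \<ominus> (L \<oplus> M)) \<le> nrm A (y' \<ominus> L) + nrm A (z' \<ominus> M)"
    if "y' \<in> carrier A" "z' \<in> carrier A" for y' z'
  proof -
    have "(y' \<oplus> z') \<ominus> (L \<oplus> M) = (y' \<ominus> L) \<oplus> (z' \<ominus> M)" using that c by algebra
    then show ?thesis using that c nrm_triangle[of "y' \<ominus> L" "z' \<ominus> M"] by simp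
  qed
  then show "\<forall>\<^sub>F t in F. nrm A ((y t \<oplus> z t) \<ominus> (L \<oplus> M)) \<le> nrm A (y t \<ominus> L) + nrm A (z t \<ominus> M)"
    using c by (auto elim: eventually_elim2)
  show "((\<lambda>t. nrm A (y t \<ominus> L) + nrm A (z t \<ominus> M)) \<longlongrightarrow> 0) F"
    using c by (auto intro: tendsto_eq_intros)
qed

lemma tends_mult:
  assumes "tends F y L" "tends F z M" shows "tends F (\<lambda>t. y t \<otimes> z t) (L \<otimes> M)"
proof (rule tendsI)
  note c = assms[unfolded tends_def]
  show "\<forall>\<^sub>F t in F. y t \<otimes> z t \<in> carrier A" using c by (auto elim: eventually_elim2)
  show "L \<otimes> M \<in> carrier A" using c by simp
  let ?e = "\<lambda>y z. nrm A (y \<ominus> L) * (nrm A (z \<ominus> M) + nrm A M) + nrm A L * nrm A (z \<ominus> M)"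
  have "nrm A ((y' \<otimes> z') \<ominus> (L \<otimes> M)) \<le> ?e y' z'"
    if "y' \<in> carrier A" "z' \<in> carrier A" for y' z'
  proof -
    have "(y' \<otimes> z') \<ominus> (L \<otimes> M) = (y' \<ominus> L) \<otimes> ((z' \<ominus> M) \<oplus> M) \<oplus> L \<otimes> (z' \<ominus> M)" using that c by algebra
    moreover have "nrm A ((z' \<ominus> M) \<oplus> M) \<le> nrm A (z' \<ominus> M) + nrm A M"
      using that c nrm_triangle by auto
    ultimately show ?thesis using that c
      by (smt (verit) m_closed a_closed minus_closed nrm_triangle nrm_mult mult_closed_norm)
  qed
  then show "\<forall>\<^sub>F t in F. nrm A ((y t \<otimes> z t) \<ominus> (L \<otimes> M)) \<le> ?e (y t) (z t)"
    using c by (auto elim: eventually_elim2)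
  show "((\<lambda>t. ?e (y t) (z t)) \<longlongrightarrow> 0) F"
    using c by (auto intro!: tendsto_eq_intros)
qed

lemma tends_smult:
  assumes "(c \<longlongrightarrow> d) F" "tends F y L" shows "tends F (\<lambda>t. c t \<odot> y t) (d \<odot> L)"
proof (rule tendsI)
  note c = assms[unfolded tends_def]
  show "\<forall>\<^sub>F t in F. c t \<odot> y t \<in> carrier A" using c by (auto elim: eventually_mono)
  show "d \<odot> L \<in> carrier A" using c by simp
  let ?e = "\<lambda>c y. cmod c * nrm A (y \<ominus> L) + cmod (c - d) * nrm A L"
  have "nrm A ((c' \<odot> y') \<ominus> (d \<odot> L)) \<le> ?e c' y'" if "y' \<in> carrier A" for c' y'
  proof -
    have "(c' \<odot> y') \<ominus> (d \<odot> L) = c' \<odot> (y' \<ominus> L) \<oplus> (c' - d) \<odot> L"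
    proof -
      have "c' \<odot> y' \<in> carrier A" "c' \<odot> L \<in> carrier A" "d \<odot> L \<in> carrier A" using that c by auto
      moreover have "c' \<odot> (y' \<ominus> L) \<oplus> (c' - d) \<odot> L = (c' \<odot> y' \<ominus> c' \<odot> L) \<oplus> (c' \<odot> L \<ominus> d \<odot> L)"
        using that c by (simp add: sc_diff_r sc_diff_l)
      ultimately show ?thesis by algebra
    qed
    then show ?thesis using that c nrm_triangle[of "c' \<odot> (y' \<ominus> L)" "(c' - d) \<odot> L"]
      by (simp add: nrm_smult)
  qed
  then show "\<forall>\<^sub>F t in F. nrm A ((c t \<odot> y t) \<ominus> (d \<odot> L)) \<le> ?e (c t) (y t)"
    using c by (auto elim: eventually_mono)
  have "((\<lambda>t. cmod (c t) * nrm A (y t \<ominus> L) + cmod (c t - d) * nrm A L) \<longlongrightarrow> cmod d * 0 + cmod (d - d) *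
      nrm A L) F"
    using c by (intro tendsto_intros) auto
  then show "((\<lambda>t. ?e (c t) (y t)) \<longlongrightarrow> 0) F" by simp
qed

lemma tends_star:
  assumes "tends F y L" shows "tends F (\<lambda>t. star A (y t)) (star A L)"
proof (rule tendsI)
  note c = assms[unfolded tends_def]
  show "\<forall>\<^sub>F t in F. star A (y t) \<in> carrier A" using c by (auto elim: eventually_mono)
  show "star A L \<in> carrier A" using c by simp
  have "nrm A (star A y' \<ominus> star A L) \<le> nrm A (y' \<ominus> L)" if "y' \<in> carrier A" for y'
    using that c nrm_star[of "y' \<ominus> L"] by (simp add: star_diff)
  then show "\<forall>\<^sub>F t in F. nrm A (star A (y t) \<ominus> star A L) \<le> nrm A (y t \<ominus> L)"
    using c by (auto elim: eventually_mono)
qed (use assms in \<open>simp add: tends_def\<close>)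

lemma tends_minus:
  assumes "tends F y L" shows "tends F (\<lambda>t. \<ominus> y t) (\<ominus> L)"
proof (rule tends_cong)
  show "tends F (\<lambda>t. (-1) \<odot> y t) (\<ominus> L)"
    using tends_smult[OF tendsto_const assms, of "-1"] assms by (simp add: sc_minus_l tends_def)
  show "\<forall>\<^sub>F t in F. (-1) \<odot> y t = \<ominus> y t"
    using assms by (auto simp: tends_def sc_minus_l elim: eventually_mono)
qed

lemma tends_diff:
  assumes "tends F y L" "tends F z M" shows "tends F (\<lambda>t. y t \<ominus> z t) (L \<ominus> M)"
  unfolding a_minus_def by (intro tends_add tends_minus assms)

lemma tends_nrm_le:
  assumes "tends F y L" "\<forall>\<^sub>F t in F. nrm A (y t) \<le> r" "F \<noteq> bot"
  shows "nrm A L \<le> r"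
proof -
  note c = assms(1)[unfolded tends_def]
  have "((\<lambda>t. nrm A (y t \<ominus> L) + r) \<longlongrightarrow> 0 + r) F" using c by (intro tendsto_intros) auto
  moreover have "nrm A L \<le> nrm A (y' \<ominus> L) + r" if "y' \<in> carrier A" "nrm A y' \<le> r" for y'
  proof -
    have "L = y' \<ominus> (y' \<ominus> L)" using that c by algebra
    then have "nrm A L \<le> nrm A y' + nrm A (y' \<ominus> L)" using nrm_diff[of y' "y' \<ominus> L"] that c by simp
    then show ?thesis using that by simp
  qed
  then have "\<forall>\<^sub>F t in F. nrm A L \<le> nrm A (y t \<ominus> L) + r"
    using c assms(2) by (auto elim: eventually_elim2)
  ultimately have "nrm A L \<le> 0 + r"
    by (rule tendsto_lowerbound[OF _ _ assms(3)])
  then show ?thesis by simp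
qed

lemma tends_unique:
  assumes "tends F y L" "tends F y M" "F \<noteq> bot" shows "L = M"
proof -
  have "tends F (\<lambda>t. y t \<ominus> y t) (L \<ominus> M)" by (intro tends_diff assms)
  moreover have "\<forall>\<^sub>F t in F. nrm A (y t \<ominus> y t) \<le> 0"
    using assms(1) by (auto simp: tends_def a_minus_def r_neg elim: eventually_mono)
  ultimately have "nrm A (L \<ominus> M) \<le> 0" by (rule tends_nrm_le) (rule assms)
  then have "L \<ominus> M = \<zero>"
    using nrm_nonneg[of "L \<ominus> M"] nrm_eq_0[of "L \<ominus> M"] tends_closed[OF assms(1)] tends_closed[OF
      assms(2)] by simp
  then show ?thesis using tends_closed[OF assms(1)] tends_closed[OF assms(2)] by simp
qed

interpretation MS: Metric_space "carrier A" "cdist A" by (rule Metric_space_cdist)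

lemma tends_limitin:
  "tends F y L \<longleftrightarrow> limitin (ctopology A) y L F"
proof -
  have "((\<lambda>t. cdist A (y t) L) \<longlongrightarrow> 0) F \<longleftrightarrow> ((\<lambda>t. nrm A (y t \<ominus> L)) \<longlongrightarrow> 0) F"
    if "\<forall>\<^sub>F t in F. y t \<in> carrier A" "L \<in> carrier A"
  proof -
    have ev: "\<forall>\<^sub>F t in F. cdist A (y t) L = nrm A (y t \<ominus> L)"
      using that by (auto simp: cdist_def elim: eventually_mono)
    then show ?thesis by (rule tendsto_cong)
  qed
  then show ?thesis
    unfolding tends_def MS.limitin_metric_dist_null by auto
qed

lemma closedinI:
  assumes "S \<subseteq> carrier A" "\<And>y L. (\<And>n. y n \<in> S) \<Longrightarrow> tends sequentially y L \<Longrightarrow> L \<in> S"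
  shows "closedin (ctopology A) S"
  unfolding MS.metric_closedin_iff_sequentially_closed
  using assms by (fastforce simp: tends_limitin)

lemma Cauchy_tends:
  assumes y: "\<And>n. y n \<in> carrier A"
    and C: "\<And>e. e > 0 \<Longrightarrow> \<exists>N. \<forall>m\<ge>N. \<forall>n\<ge>N. nrm A (y m \<ominus> y n) < e"
  shows "\<exists>L. tends sequentially y L"
proof -
  have "MS.MCauchy y"
    unfolding MS.MCauchy_def using y C by (auto simp: cdist_def)
  then show ?thesis
    using complete unfolding MS.mcomplete_def tends_limitin by blast
qed

text \<open>
  A scalar sequence dominates the increments. This is how the iterations below converge: each is
  compared with the same iteration for real numbers.
\<close>

lemma telescoping_tends:
  fixes s :: "nat \<Rightarrow> real"
  assumes y: "\<And>n. y n \<in> carrier A"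
    and le: "\<And>n. nrm A (y (Suc n) \<ominus> y n) \<le> s (Suc n) - s n"
    and s: "convergent s"
  shows "\<exists>L. tends sequentially y L"
proof (rule Cauchy_tends[OF y])
  have mono: "nrm A (y (n + k) \<ominus> y n) \<le> s (n + k) - s n" for n k
  proof (induction k)
    case 0 then show ?case using y[of n] by (simp add: a_minus_def r_neg)
  next
    case (Suc k)
    have "y (n + Suc k) \<ominus> y n = (y (Suc (n + k)) \<ominus> y (n + k)) \<oplus> (y (n + k) \<ominus> y n)"
      using y[of n] y[of "n+k"] y[of "Suc (n+k)"] by simp algebra
    then have "nrm A (y (n + Suc k) \<ominus> y n)
        \<le> nrm A (y (Suc (n + k)) \<ominus> y (n + k)) + nrm A (y (n + k) \<ominus> y n)"
      using y nrm_triangle by auto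
    then show ?case using Suc le[of "n + k"] by simp
  qed
  have ab: "nrm A (y m \<ominus> y n) \<le> \<bar>s m - s n\<bar>" for m n
  proof (cases "n \<le> m")
    case True then show ?thesis using mono[of n "m - n"] by simp
  next
    case False then show ?thesis using mono[of m "n - m"] nrm_diff_commute[OF y y, of m n] by simp
  qed
  fix e :: real assume "e > 0"
  have "Cauchy s" using s by (rule convergent_Cauchy)
  then obtain N where "\<forall>m\<ge>N. \<forall>n\<ge>N. dist (s m) (s n) < e" using \<open>e > 0\<close> unfolding Cauchy_def by blast
  then show "\<exists>N. \<forall>m\<ge>N. \<forall>n\<ge>N. nrm A (y m \<ominus> y n) < e"
    using ab by (metis dist_real_def le_less_trans)
qed

lemma continuous_map_tends:
  "continuous_map (top_of_set S) (ctopology A) w \<longleftrightarrow>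
     (\<forall>t\<in>S. w t \<in> carrier A \<and> tends (at t within S) w (w t))"
proof -
  have fin: "limitin (ctopology A) w (w t) (atin (top_of_set S) t) \<longleftrightarrow> tends (at t within S) w (w t)"
    if "t \<in> S" for t
    using that by (simp add: tends_limitin atin_subtopology_within atin_within_euclidean)
  show ?thesis
    unfolding continuous_map_atin using fin MS.topspace_mtopology
    by (auto simp: tends_closed)
qed

subsection \<open>Square roots and inverses by iteration\<close>

text \<open>
  Membership in the bicommutant of \<open>x\<close>. Functions of \<open>x\<close> obtained as limits of polynomials in \<open>x\<close>
  have this property, which replaces working in the commutative subalgebra generated by \<open>x\<close>.
\<close>

definition bicommutes :: "'a \<Rightarrow> 'a \<Rightarrow> bool" where
  "bicommutes x y \<longleftrightarrow> (\<forall>z\<in>carrier A. z \<otimes> x = x \<otimes> z \<longrightarrow> z \<otimes> y = y \<otimes> z)"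

lemma bicommutes_commute: "bicommutes x y \<Longrightarrow> x \<in> carrier A \<Longrightarrow> x \<otimes> y = y \<otimes> x"
  by (simp add: bicommutes_def)

lemma bicommutesD: "bicommutes x y \<Longrightarrow> z \<in> carrier A \<Longrightarrow> z \<otimes> x = x \<otimes> z \<Longrightarrow> z \<otimes> y = y \<otimes> z"
  by (simp add: bicommutes_def)

lemma bicommutes_tends:
  assumes "\<And>n. bicommutes x (y n)" "tends F y L" "F \<noteq> bot" "x \<in> carrier A"
  shows "bicommutes x L"
  unfolding bicommutes_def
proof (intro ballI impI)
  fix z assume z: "z \<in> carrier A" "z \<otimes> x = x \<otimes> z"
  have "tends F (\<lambda>n. z \<otimes> y n) (z \<otimes> L)" "tends F (\<lambda>n. y n \<otimes> z) (L \<otimes> z)"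
    using z assms by (auto intro: tends_mult tends_const)
  moreover have "z \<otimes> y n = y n \<otimes> z" for n using assms(1) z bicommutesD by blast
  ultimately show "z \<otimes> L = L \<otimes> z" using tends_unique assms(3) by auto
qed

lemma half_double: "x \<in> carrier A \<Longrightarrow> (1/2) \<odot> x \<oplus> (1/2) \<odot> x = x"
  by (simp flip: sc_add_l)

text \<open>
  The root is the limit of the iteration \<open>y \<mapsto> (x + y\<^sup>2) / 2\<close> from \<open>0\<close>, whose fixed points satisfy
  \<open>(1 - y)\<^sup>2 = 1 - x\<close>. The iterates are polynomials in \<open>x\<close> with nonnegative coefficients, so their
  increments are bounded by those of the real iteration at \<open>1\<close>, which increases to \<open>1\<close>. In particular
  \<open>\<parallel>x\<parallel> = 1\<close> is allowed, which a naive geometric estimate would not give.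
\<close>

lemma sqrt_one_minus:
  assumes x: "x \<in> carrier A" "star A x = x" "nrm A x \<le> 1"
  shows "\<exists>y\<in>carrier A. star A y = y \<and> nrm A y \<le> 1 \<and> (\<one> \<ominus> y) \<otimes> (\<one> \<ominus> y) = \<one> \<ominus> x \<and> bicommutes x y"
proof -
  define Y where "Y = rec_nat \<zero> (\<lambda>_ y. (1/2) \<odot> (x \<oplus> y \<otimes> y))"
  define s where "s = rec_nat (0::real) (\<lambda>_ y. (1 + y\<^sup>2) / 2)"
  have Y0: "Y 0 = \<zero>" and YS: "Y (Suc n) = (1/2) \<odot> (x \<oplus> Y n \<otimes> Y n)" for n
    by (simp_all add: Y_def)
  have s0: "s 0 = 0" and sS: "s (Suc n) = (1 + (s n)\<^sup>2) / 2" for n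
    by (simp_all add: s_def)
  have Yc [simp]: "Y n \<in> carrier A" for n by (induction n) (auto simp: Y0 YS x)
  have Ys: "star A (Y n) = Y n" for n
    by (induction n) (auto simp: Y0 YS x star_smult star_add star_mult)
  have s01: "0 \<le> s n \<and> s n \<le> 1" for n
  proof (induction n)
    case (Suc n)
    then have "(s n)\<^sup>2 \<le> 1" by (simp add: power_le_one)
    then show ?case by (simp add: sS)
  qed (simp add: s0)
  have inc: "s n \<le> s (Suc n)" for n
    using zero_le_power2[of "1 - s n"] by (simp add: sS power2_eq_square algebra_simps)
  have "convergent s"
    using s01 inc by (intro Bseq_mono_convergent[of s] BseqI'[of s 1] )
      (auto simp: lift_Suc_mono_le)
  have Yn: "nrm A (Y n) \<le> s n" for n
  proof (induction n)
    case (Suc n)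
    have "nrm A (x \<oplus> Y n \<otimes> Y n) \<le> 1 + s n * s n"
      using nrm_triangle[of x "Y n \<otimes> Y n"] x mult_closed_norm[OF Yc Yc Suc Suc] by simp
    then show ?case using x by (simp add: YS sS nrm_smult power2_eq_square)
  qed (simp add: Y0 s0)
  have Ybi: "bicommutes x (Y n)" for n
  proof (induction n)
    case (Suc n)
    show ?case unfolding bicommutes_def
    proof (intro ballI impI)
      fix z assume z: "z \<in> carrier A" "z \<otimes> x = x \<otimes> z"
      then have c: "z \<otimes> Y n = Y n \<otimes> z" using bicommutesD Suc by blast
      then have "z \<otimes> (Y n \<otimes> Y n) = (Y n \<otimes> Y n) \<otimes> z" using z by (metis m_assoc Yc)
      then show "z \<otimes> Y (Suc n) = Y (Suc n) \<otimes> z" using z x by (simp add: YS sc_mult l_distr r_distr)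
    qed
  qed (simp add: Y0 bicommutes_def)
  have comm: "Y m \<otimes> Y n = Y n \<otimes> Y m" for m n
    using bicommutesD[OF Ybi[of n] Yc[of m]] bicommutes_commute[OF Ybi[of m] x(1)] by simp
  have diff: "nrm A (Y (Suc n) \<ominus> Y n) \<le> s (Suc n) - s n" for n
  proof (induction n)
    case 0
    then show ?case using x by (simp add: YS Y0 sS s0 nrm_smult a_minus_def)
  next
    case (Suc n)
    let ?a = "Y (Suc n)" let ?b = "Y n"
    have "(?a \<ominus> ?b) \<otimes> (?a \<oplus> ?b) = (x \<oplus> ?a \<otimes> ?a) \<ominus> (x \<oplus> ?b \<otimes> ?b) \<oplus> (?a \<otimes> ?b \<ominus> ?b \<otimes> ?a)"
      using x(1) Yc[of n] Yc[of "Suc n"] by algebra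
    then have "(?a \<ominus> ?b) \<otimes> (?a \<oplus> ?b) = (x \<oplus> ?a \<otimes> ?a) \<ominus> (x \<oplus> ?b \<otimes> ?b)"
      using comm[of "Suc n" n] x(1) by (simp add: a_minus_def r_neg)
    moreover have "Y (Suc (Suc n)) \<ominus> Y (Suc n) = (1/2) \<odot> (x \<oplus> ?a \<otimes> ?a) \<ominus> (1/2) \<odot> (x \<oplus> ?b \<otimes> ?b)"
      by (rule arg_cong2[OF YS[of "Suc n"] YS[of n], of "a_minus A"])
    ultimately have "Y (Suc (Suc n)) \<ominus> Y (Suc n) = (1/2) \<odot> ((?a \<ominus> ?b) \<otimes> (?a \<oplus> ?b))"
      using x(1) by (simp add: sc_diff_r)
    moreover have "nrm A (?a \<oplus> ?b) \<le> s (Suc n) + s n"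
      using nrm_triangle[OF Yc Yc, of "Suc n" n] Yn[of "Suc n"] Yn[of n] by simp
    ultimately have "nrm A (Y (Suc (Suc n)) \<ominus> Y (Suc n))
        \<le> (s (Suc n) - s n) * (s (Suc n) + s n) / 2"
      using mult_closed_norm[OF _ _ Suc, of "?a \<oplus> ?b"] by (simp add: nrm_smult)
    also have "\<dots> = s (Suc (Suc n)) - s (Suc n)"
      by (simp add: sS[of "Suc n"] sS[of n] power2_eq_square field_simps)
    finally show ?case .
  qed
  obtain y where y: "tends sequentially Y y"
    using telescoping_tends[of Y s, OF Yc diff \<open>convergent s\<close>] by auto
  have yc: "y \<in> carrier A" using y tends_closed by blast
  have "tends sequentially (\<lambda>n. Y (Suc n)) y"
    using y unfolding tends_def by (auto intro: LIMSEQ_Suc[where f = "\<lambda>n. nrm A (Y n \<ominus> y)"])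
  moreover have "tends sequentially (\<lambda>n. Y (Suc n)) ((1/2) \<odot> (x \<oplus> y \<otimes> y))"
    unfolding YS by (intro tends_smult tends_add tends_mult tends_const y x tendsto_const)
  ultimately have fixp: "y = (1/2) \<odot> (x \<oplus> y \<otimes> y)" by (rule tends_unique) simp
  have "y \<oplus> y = x \<oplus> y \<otimes> y"
    using half_double[of "x \<oplus> y \<otimes> y"] fixp x yc by simp
  then have "x = (y \<oplus> y) \<ominus> y \<otimes> y" using x yc by (simp add: a_minus_def a_assoc r_neg)
  then have sq: "(\<one> \<ominus> y) \<otimes> (\<one> \<ominus> y) = \<one> \<ominus> x" using yc by simp algebra
  have "star A y = y" using tends_unique[OF tends_star[OF y], of y] y Ys by simp
  moreover have "nrm A y \<le> 1"
    by (rule tends_nrm_le[OF y]) (use order_trans[OF Yn] s01 in \<open>auto intro!: always_eventually\<close>)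
  moreover have "bicommutes x y" using bicommutes_tends[OF Ybi y] x by simp
  ultimately show ?thesis using sq yc by blast
qed

text \<open>
  The geometric series, as the fixed point of \<open>y \<mapsto> 1 + x y\<close>.
\<close>

lemma neumann_inverse:
  assumes x: "x \<in> carrier A" "nrm A x < 1"
  shows "\<exists>b\<in>carrier A. (\<one> \<ominus> x) \<otimes> b = \<one> \<and> b \<otimes> (\<one> \<ominus> x) = \<one> \<and> bicommutes x b"
proof -
  define Y where "Y = rec_nat \<zero> (\<lambda>_ y. \<one> \<oplus> x \<otimes> y)"
  define s where "s n = (\<Sum>k<n. (nrm A x) ^ k)" for n
  have Y0: "Y 0 = \<zero>" and YS: "Y (Suc n) = \<one> \<oplus> x \<otimes> Y n" for n
    by (simp_all add: Y_def)
  have Yc [simp]: "Y n \<in> carrier A" for n by (induction n) (auto simp: Y0 YS x)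
  have Ybi: "bicommutes x (Y n)" for n
  proof (induction n)
    case (Suc n)
    show ?case unfolding bicommutes_def
    proof (intro ballI impI)
      fix z assume z: "z \<in> carrier A" "z \<otimes> x = x \<otimes> z"
      then have c: "z \<otimes> Y n = Y n \<otimes> z" using bicommutesD Suc by blast
      then have "z \<otimes> (x \<otimes> Y n) = (x \<otimes> Y n) \<otimes> z" using z x by (metis m_assoc Yc)
      then show "z \<otimes> Y (Suc n) = Y (Suc n) \<otimes> z" using z x by (simp add: YS l_distr r_distr)
    qed
  qed (simp add: Y0 bicommutes_def)
  have "summable (\<lambda>k. (nrm A x) ^ k)" using x nrm_nonneg by (intro summable_geometric) auto
  then have conv: "convergent s" unfolding s_def summable_iff_convergent
    by (simp add: lessThan_atLeast0)
  have diff: "nrm A (Y (Suc n) \<ominus> Y n) \<le> s (Suc n) - s n" for n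
  proof -
    have "nrm A (Y (Suc n) \<ominus> Y n) \<le> (nrm A x) ^ n"
    proof (induction n)
      case 0 then show ?case using nrm_one x by (simp add: YS Y0 a_minus_def)
    next
      case (Suc n)
      have "Y (Suc (Suc n)) \<ominus> Y (Suc n) = x \<otimes> (Y (Suc n) \<ominus> Y n)"
      proof -
        have e: "Y (Suc (Suc n)) \<ominus> Y (Suc n) = (\<one> \<oplus> x \<otimes> Y (Suc n)) \<ominus> (\<one> \<oplus> x \<otimes> Y n)"
          by (rule arg_cong2[OF YS[of "Suc n"] YS[of n], of "a_minus A"])
        show ?thesis unfolding e using x(1) Yc[of n] Yc[of "Suc n"] by algebra
      qed
      then show ?case using mult_closed_norm[OF x(1) _ order_refl Suc] by simp
    qed
    then show ?thesis by (simp add: s_def)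
  qed
  obtain y where y: "tends sequentially Y y"
    using telescoping_tends[of Y s, OF Yc diff conv] by auto
  have yc: "y \<in> carrier A" using y tends_closed by blast
  have "tends sequentially (\<lambda>n. Y (Suc n)) y"
    using y unfolding tends_def by (auto intro: LIMSEQ_Suc[where f = "\<lambda>n. nrm A (Y n \<ominus> y)"])
  moreover have "tends sequentially (\<lambda>n. Y (Suc n)) (\<one> \<oplus> x \<otimes> y)"
    unfolding YS by (intro tends_add tends_mult tends_const y x one_closed)
  ultimately have fixp: "y = \<one> \<oplus> x \<otimes> y" by (rule tends_unique) simp
  have bi: "bicommutes x y" using bicommutes_tends[OF Ybi y] x by simp
  have "(\<one> \<ominus> x) \<otimes> y = y \<ominus> x \<otimes> y" using x yc by algebra
  also have "\<dots> = \<one>" using fixp x yc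
    by (metis add.m_closed add.inv_solve_right' m_closed minus_eq one_closed)
  finally have 1: "(\<one> \<ominus> x) \<otimes> y = \<one>" .
  have "y \<otimes> (\<one> \<ominus> x) = y \<ominus> y \<otimes> x" using x yc by algebra
  also have "\<dots> = y \<ominus> x \<otimes> y" using bicommutes_commute[OF bi] x by simp
  also have "\<dots> = (\<one> \<ominus> x) \<otimes> y" using x yc by algebra
  finally show ?thesis using 1 yc bi by auto
qed

subsection \<open>Positive elements\<close>

abbreviation rsc :: "real \<Rightarrow> 'a" where "rsc r \<equiv> complex_of_real r \<odot> \<one>"

lemma star_rsc [simp]: "star A (rsc r) = rsc r"
  by (simp add: star_smult)

lemma rsc_add: "rsc (r + s) = rsc r \<oplus> rsc s"
  by (simp add: sc_add_l)

text \<open>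
  The element \<open>u = a + i b\<close> satisfies \<open>u* u = r\<close>, so \<open>\<parallel>u\<parallel>\<^sup>2 \<le> r\<close>, and \<open>a\<close> is the real part of \<open>u\<close>. This
  takes the place of the spectral theorem wherever a norm has to be bounded from an order relation.
\<close>

lemma commuting_squares_bound:
  assumes a: "a \<in> carrier A" "star A a = a" and b: "b \<in> carrier A" "star A b = b"
    and ab: "a \<otimes> b = b \<otimes> a" and sum: "a \<otimes> a \<oplus> b \<otimes> b = rsc r" and r: "0 \<le> r"
  shows "(nrm A a)\<^sup>2 \<le> r"
proof -
  define c where "c = \<i> \<odot> b"
  have c: "c \<in> carrier A" "star A c = \<ominus> c" "a \<otimes> c = c \<otimes> a"
    using a b ab by (auto simp: c_def star_smult sc_minus_l sc_mult)
  have cc: "c \<otimes> c = \<ominus> (b \<otimes> b)"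
    using b by (simp add: c_def sc_mult sc_assoc sc_minus_l)
  define u where "u = a \<oplus> c"
  have u: "u \<in> carrier A" using a c by (simp add: u_def)
  have su: "star A u = a \<ominus> c" using a c by (simp add: u_def star_add a_minus_def)
  have "star A u \<otimes> u = a \<otimes> a \<oplus> (a \<otimes> c \<ominus> c \<otimes> a) \<ominus> c \<otimes> c"
    unfolding su unfolding u_def using a(1) c(1) by algebra
  also have "\<dots> = rsc r" using a b c cc sum by (simp add: a_minus_def r_neg)
  finally have "(nrm A u)\<^sup>2 \<le> r"
    using cstar_identity[OF u] nrm_sc_one[of "complex_of_real r"] r by simp
  moreover have "u \<oplus> star A u = a \<oplus> a" unfolding su unfolding u_def using a(1) c(1) by algebra
  then have "nrm A (2 \<odot> a) \<le> 2 * nrm A u"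
    using nrm_triangle[of u "star A u"] u sc_add_l[OF a(1), of 1 1] a by simp
  then have "nrm A a \<le> nrm A u" using a by (simp add: nrm_smult)
  ultimately show ?thesis using nrm_nonneg[OF a(1)] by (meson order_trans power_mono)
qed

text \<open>
  This describes a nonnegative spectrum without spectra: \<open>x\<close> lies in the ball with centre \<open>r\<close> and
  radius \<open>r\<close>. In this form the positive elements visibly form a convex cone.
\<close>

definition pos :: "'a \<Rightarrow> bool" where
  "pos x \<longleftrightarrow> x \<in> carrier A \<and> star A x = x \<and> (\<exists>r\<ge>0. nrm A (rsc r \<ominus> x) \<le> r)"

lemma posD: "pos x \<Longrightarrow> x \<in> carrier A" "pos x \<Longrightarrow> star A x = x"
  by (auto simp: pos_def)

text \<open>
  With \<open>x = y\<^sup>2 / r\<close>, write \<open>1 - x = z\<^sup>2\<close>. Then \<open>y / \<surd>r\<close> and \<open>z\<close> are commuting with squares of sum \<open>1\<close>,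
  so \<open>\<parallel>z\<parallel> \<le> 1\<close>.
\<close>

lemma pos_square_bound:
  assumes y: "y \<in> carrier A" "star A y = y" "(nrm A y)\<^sup>2 \<le> r"
  shows "nrm A (rsc r \<ominus> y \<otimes> y) \<le> r"
proof (cases "r = 0")
  case True
  then have "y = \<zero>" using y nrm_eq_0 by auto
  then show ?thesis using True by (simp add: a_minus_def)
next
  case False
  then have r: "r > 0" using y(3) by (metis order_le_less order_less_le_trans zero_le_power2)
  define x where "x = complex_of_real (1/r) \<odot> (y \<otimes> y)"
  have x: "x \<in> carrier A" "star A x = x" using y by (auto simp: x_def star_smult star_mult)
  have "nrm A x \<le> 1" using y r nrm_sq_sa[OF y(1,2)] by (simp add: x_def nrm_smult norm_divide)
  then obtain w where w: "w \<in> carrier A" "star A w = w" "(\<one> \<ominus> w) \<otimes> (\<one> \<ominus> w) = \<one> \<ominus> x" "bicommutes x w"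
    using sqrt_one_minus x by blast
  define z where "z = \<one> \<ominus> w"
  have z: "z \<in> carrier A" "star A z = z" using w by (auto simp: z_def star_diff)
  have "y \<otimes> x = x \<otimes> y" using y by (simp add: x_def sc_mult m_assoc)
  then have yw: "y \<otimes> w = w \<otimes> y" using bicommutesD[OF w(4) y(1)] by simp
  then have "z \<otimes> y = y \<otimes> z" using y w
    by (simp add: z_def a_minus_def l_distr r_distr l_minus r_minus)
  define t where "t = complex_of_real (1/sqrt r) \<odot> y"
  have t: "t \<in> carrier A" "star A t = t" using y by (auto simp: t_def star_smult)
  have "1 / sqrt r * (1 / sqrt r) = 1 / r" using r by (simp add: field_simps)
  then have "complex_of_real (1 / sqrt r) * complex_of_real (1 / sqrt r) = complex_of_real (1 / r)"
    by (metis of_real_mult)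
  then have tt: "t \<otimes> t = x" using y
    by (simp add: t_def x_def sc_mult sc_assoc del: of_real_mult of_real_divide)
  have "z \<otimes> t = t \<otimes> z" using \<open>z \<otimes> y = y \<otimes> z\<close> y z by (simp add: t_def sc_mult)
  moreover have "z \<otimes> z \<oplus> t \<otimes> t = rsc 1" using w(3) x unfolding tt z_def by simp algebra
  ultimately have "(nrm A z)\<^sup>2 \<le> 1" using commuting_squares_bound z t by auto
  then have "nrm A (\<one> \<ominus> x) \<le> 1" using nrm_sq_sa[OF z] w(3) by (simp add: z_def)
  moreover have "rsc r \<ominus> y \<otimes> y = complex_of_real r \<odot> (\<one> \<ominus> x)"
    using y r by (simp add: x_def sc_diff_r sc_assoc)
  ultimately show ?thesis using r x by (simp add: nrm_smult)
qed

lemma pos_square: "y \<in> carrier A \<Longrightarrow> star A y = y \<Longrightarrow> pos (y \<otimes> y)"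
  using pos_square_bound[of y "(nrm A y)\<^sup>2"] unfolding pos_def
  by (intro conjI exI[of _ "(nrm A y)\<^sup>2"]) (simp_all add: star_mult del: of_real_power)

lemma pos_sqrt:
  assumes "pos x"
  shows "\<exists>w. pos w \<and> w \<otimes> w = x \<and> bicommutes x w"
proof -
  obtain r where x: "x \<in> carrier A" "star A x = x" and r: "r \<ge> 0" "nrm A (rsc r \<ominus> x) \<le> r"
    using assms by (auto simp: pos_def)
  show ?thesis
  proof (cases "r = 0")
    case True
    then have "nrm A (\<ominus> x) = 0" using r x nrm_nonneg[of x] by (simp add: a_minus_def)
    then have "x = \<zero>" using x nrm_eq_0 by simp
    then show ?thesis using pos_square[of \<zero>] by (auto simp: bicommutes_def)
  next
    case False
    then have r0: "r > 0" using r by simp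
    define X where "X = \<one> \<ominus> complex_of_real (1/r) \<odot> x"
    have X: "X \<in> carrier A" "star A X = X" using x by (auto simp: X_def star_diff star_smult)
    have "complex_of_real (1/r) \<odot> (rsc r \<ominus> x) = X" using x r0
      by (simp add: X_def sc_diff_r sc_assoc)
    then have "nrm A X = (1/r) * nrm A (rsc r \<ominus> x)"
      using nrm_smult[of "rsc r \<ominus> x" "complex_of_real (1/r)"] x r0 by (simp add: norm_divide)
    then have "r * nrm A X \<le> r * 1" using r r0 by simp
    then have "nrm A X \<le> 1" using r0 mult_left_le_imp_le by blast
    then obtain y where y: "y \<in> carrier A" "star A y = y" "nrm A y \<le> 1"
      "(\<one> \<ominus> y) \<otimes> (\<one> \<ominus> y) = \<one> \<ominus> X" "bicommutes X y"
      using sqrt_one_minus X by blast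
    define w where "w = complex_of_real (sqrt r) \<odot> (\<one> \<ominus> y)"
    have w: "w \<in> carrier A" "star A w = w" using y by (auto simp: w_def star_diff star_smult)
    have "\<one> \<ominus> X = complex_of_real (1/r) \<odot> x"
      using x sc_closed[OF x(1), of "complex_of_real (1/r)"] unfolding X_def by algebra
    then have ww: "w \<otimes> w = x" using y r0 x
      by (simp add: w_def sc_mult sc_assoc flip: of_real_mult of_real_divide power2_eq_square)
    have "rsc (sqrt r) \<ominus> w = complex_of_real (sqrt r) \<odot> y"
      using y sc_closed[OF y(1), of "complex_of_real (sqrt r)"] unfolding w_def sc_diff_r[OF
        one_closed y(1)] by algebra
    then have "nrm A (rsc (sqrt r) \<ominus> w) \<le> sqrt r" using y r0 by (simp add: nrm_smult mult_left_le)
    then have pw: "pos w" using w r0 unfolding pos_def by (intro conjI exI[of _ "sqrt r"]) auto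
    have "bicommutes x w" unfolding bicommutes_def
    proof (intro ballI impI)
      fix z assume z: "z \<in> carrier A" "z \<otimes> x = x \<otimes> z"
      then have "z \<otimes> X = X \<otimes> z" using x
        by (simp add: X_def a_minus_def l_distr r_distr l_minus r_minus sc_mult)
      then have "z \<otimes> y = y \<otimes> z" using bicommutesD y z by blast
      then show "z \<otimes> w = w \<otimes> z" using z y
        by (simp add: w_def a_minus_def l_distr r_distr l_minus r_minus sc_mult)
    qed
    then show ?thesis using pw ww by blast
  qed
qed

lemma pos_add: assumes "pos x" "pos y" shows "pos (x \<oplus> y)"
proof -
  obtain r s where x: "x \<in> carrier A" "star A x = x" "r \<ge> 0" "nrm A (rsc r \<ominus> x) \<le> r"
    and y: "y \<in> carrier A" "star A y = y" "s \<ge> 0" "nrm A (rsc s \<ominus> y) \<le> s"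
    using assms by (auto simp: pos_def)
  have "rsc (r + s) \<ominus> (x \<oplus> y) = (rsc r \<ominus> x) \<oplus> (rsc s \<ominus> y)"
    using x(1) y(1) sc_closed[OF one_closed, of "complex_of_real r"] sc_closed[OF one_closed, of
      "complex_of_real s"]
    unfolding rsc_add by algebra
  then have "nrm A (rsc (r + s) \<ominus> (x \<oplus> y)) \<le> r + s"
    using nrm_triangle[of "rsc r \<ominus> x" "rsc s \<ominus> y"] x y by simp
  then show ?thesis unfolding pos_def using x y
    by (intro conjI exI[of _ "r + s"]) (auto simp: star_add)
qed

lemma pos_zero [simp]: "pos \<zero>"
  using pos_square[of \<zero>] by simp

lemma pos_scale: assumes "pos x" "0 \<le> c" shows "pos (complex_of_real c \<odot> x)"
proof -
  obtain r where x: "x \<in> carrier A" "star A x = x" "r \<ge> 0" "nrm A (rsc r \<ominus> x) \<le> r"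
    using assms by (auto simp: pos_def)
  have "rsc (c * r) \<ominus> complex_of_real c \<odot> x = complex_of_real c \<odot> (rsc r \<ominus> x)"
    using x by (simp add: sc_diff_r sc_assoc)
  then have "nrm A (rsc (c * r) \<ominus> complex_of_real c \<odot> x) \<le> c * r"
    using x assms by (simp add: nrm_smult mult_left_mono)
  then show ?thesis unfolding pos_def using x assms
    by (intro conjI exI[of _ "c * r"]) (auto simp: star_smult)
qed

lemma pos_rsc: "0 \<le> r \<Longrightarrow> pos (rsc r)"
  using pos_scale[of \<one> r] pos_square[of \<one>] by simp

lemma pos_finsum: "(\<And>i. i \<in> I \<Longrightarrow> pos (f i)) \<Longrightarrow> pos (finsum A f I)"
proof (induction I rule: infinite_finite_induct)
  case (insert i I)
  then have "f \<in> I \<rightarrow> carrier A" "f i \<in> carrier A" using posD by auto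
  then show ?case using insert by (simp add: pos_add)
qed (auto simp: finsum_infinite)

text \<open>
  The square roots of \<open>x\<close> and \<open>r - x\<close> commute and their squares add up to \<open>r\<close>.
\<close>

lemma pos_bound:
  assumes "pos x" "pos (rsc r \<ominus> x)" "0 \<le> r"
  shows "nrm A x \<le> r"
proof -
  obtain y where y: "pos y" "y \<otimes> y = x" "bicommutes x y" using pos_sqrt assms by blast
  obtain z where z: "pos z" "z \<otimes> z = rsc r \<ominus> x" "bicommutes (rsc r \<ominus> x) z" using pos_sqrt assms
    by blast
  have c: "x \<in> carrier A" "y \<in> carrier A" "z \<in> carrier A" using assms y z posD by auto
  have "y \<otimes> x = x \<otimes> y" using bicommutes_commute[OF y(3)] c by simp
  then have "y \<otimes> (rsc r \<ominus> x) = (rsc r \<ominus> x) \<otimes> y"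
    using c by (simp add: a_minus_def l_distr r_distr l_minus r_minus sc_mult)
  then have yz: "y \<otimes> z = z \<otimes> y" using bicommutesD z c by blast
  have "y \<otimes> y \<oplus> z \<otimes> z = rsc r" unfolding y z
    using c(1) sc_closed[OF one_closed, of "complex_of_real r"] by algebra
  then have "(nrm A y)\<^sup>2 \<le> r" using commuting_squares_bound[of y z r] c y z posD yz assms by auto
  then show ?thesis using nrm_sq_sa[of y] y c posD by auto
qed

lemma pos_norm_minus:
  assumes "x \<in> carrier A" "star A x = x" "nrm A x \<le> r" shows "pos (rsc r \<ominus> x)"
proof -
  have "rsc r \<ominus> (rsc r \<ominus> x) = x"
    using assms(1) sc_closed[OF one_closed, of "complex_of_real r"] by algebra
  moreover have "0 \<le> r" using assms nrm_nonneg order_trans by blast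
  ultimately show ?thesis unfolding pos_def using assms
    by (auto simp: star_diff intro!: exI[of _ r])
qed

lemma pos_mono_nrm:
  assumes "pos x" "pos (y \<ominus> x)" "y \<in> carrier A" shows "nrm A x \<le> nrm A y"
proof (rule pos_bound[OF assms(1)])
  have x: "x \<in> carrier A" "star A x = x" using assms posD by auto
  have "y = (y \<ominus> x) \<oplus> x" using x assms by algebra
  then have "star A y = y" using assms x posD star_add by (metis minus_closed)
  then have "pos ((rsc (nrm A y) \<ominus> y) \<oplus> (y \<ominus> x))" using pos_norm_minus[of y] assms
    by (auto intro: pos_add)
  moreover have "(rsc (nrm A y) \<ominus> y) \<oplus> (y \<ominus> x) = rsc (nrm A y) \<ominus> x"
    using x assms sc_closed[OF one_closed, of "complex_of_real (nrm A y)"] by algebra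
  ultimately show "pos (rsc (nrm A y) \<ominus> x)" by simp
qed (use assms nrm_nonneg in auto)

lemma pos_antisym: assumes "pos x" "pos y" "x \<oplus> y = \<zero>" shows "x = \<zero>"
proof -
  have c: "x \<in> carrier A" "y \<in> carrier A" using assms posD by auto
  then have "y = \<zero> \<ominus> x" using assms(3)
    by (metis a_comm a_minus_def l_zero minus_equality a_inv_closed)
  then have "nrm A x \<le> nrm A \<zero>" using assms by (intro pos_mono_nrm) auto
  then show ?thesis using nrm_eq_0[of x] nrm_nonneg[of x] c by simp
qed

text \<open>
  If both \<open>d* d\<close> and \<open>d d*\<close> are negative then so is their sum; but twice that sum is \<open>x\<^sup>2 + y\<^sup>2\<close> for the
  selfadjoint elements \<open>x = d + d*\<close> and \<open>y = i (d - d*)\<close>, hence positive. So everything vanishes.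
\<close>

lemma pos_adj_neg_zero:
  assumes d: "d \<in> carrier A" "pos k" "pos m" "star A d \<otimes> d = \<ominus> k" "d \<otimes> star A d = \<ominus> m"
  shows "k = \<zero>"
proof -
  define x where "x = d \<oplus> star A d"
  define y where "y = \<i> \<odot> (d \<ominus> star A d)"
  have x: "x \<in> carrier A" "star A x = x" using d by (auto simp: x_def star_add a_comm)
  have y: "y \<in> carrier A" using d by (auto simp: y_def)
  have "star A d \<ominus> d = \<ominus> (d \<ominus> star A d)" using d by (simp add: a_minus_def minus_add a_comm)
  then have sy: "star A y = y" using d
    by (simp add: y_def star_smult star_diff sc_minus_l sc_minus_r)
  have yy: "y \<otimes> y = \<ominus> ((d \<ominus> star A d) \<otimes> (d \<ominus> star A d))"
    using d by (simp add: y_def sc_mult sc_assoc sc_minus_l)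
  have "x \<otimes> x \<oplus> y \<otimes> y = (star A d \<otimes> d \<oplus> d \<otimes> star A d) \<oplus> (star A d \<otimes> d \<oplus> d \<otimes> star A d)"
    unfolding yy x_def using d(1) star_closed[OF d(1)] by algebra
  also have "\<dots> = \<ominus> (k \<oplus> m \<oplus> k \<oplus> m)"
    unfolding d using posD(1)[OF d(2)] posD(1)[OF d(3)] by algebra
  finally have s: "x \<otimes> x \<oplus> y \<otimes> y = \<ominus> (k \<oplus> m \<oplus> k \<oplus> m)" .
  have c: "x \<otimes> x \<oplus> y \<otimes> y \<in> carrier A" "k \<in> carrier A" "m \<in> carrier A" using x y d posD by auto
  have p: "pos (x \<otimes> x \<oplus> y \<otimes> y)" using pos_square x y sy pos_add by auto
  have "k \<oplus> (m \<oplus> k \<oplus> m \<oplus> (x \<otimes> x \<oplus> y \<otimes> y)) = \<zero>" unfolding s using c by algebra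
  then show ?thesis using pos_antisym[of k "m \<oplus> k \<oplus> m \<oplus> (x \<otimes> x \<oplus> y \<otimes> y)"] d p pos_add by blast
qed

subsection \<open>Positivity of \<open>a* a\<close>\<close>

lemma sa_square_zero: "x \<in> carrier A \<Longrightarrow> star A x = x \<Longrightarrow> x \<otimes> x = \<zero> \<Longrightarrow> x = \<zero>"
  using nrm_sq_sa[of x] nrm_eq_0[of x] by simp

text \<open>
  Let \<open>b = a* a\<close> and \<open>w = |b|\<close>; the claim is that the negative part \<open>g = w - b\<close> (up to a factor \<open>2\<close>)
  vanishes. For \<open>c = a g\<close> one gets \<open>c* c = -k\<close> with \<open>k = g w g\<close> positive. The usual proof compares
  the spectra of \<open>c* c\<close> and \<open>c c*\<close>. Here one more step avoids spectra: with \<open>q\<^sup>2 = k\<close> and \<open>d = c q\<close>,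
  both \<open>d* d = -k\<^sup>2\<close> and \<open>d d* = -(c c*)\<^sup>2\<close> are negatives of squares, so \<open>k\<^sup>2 = 0\<close>.
\<close>

theorem pos_star_mult:
  assumes a: "a \<in> carrier A" shows "pos (star A a \<otimes> a)"
proof -
  define b where "b = star A a \<otimes> a"
  have b: "b \<in> carrier A" "star A b = b" using a by (auto simp: b_def star_mult)
  obtain w where w: "pos w" "w \<otimes> w = b \<otimes> b" "bicommutes (b \<otimes> b) w"
    using pos_sqrt pos_square b by blast
  have wc: "w \<in> carrier A" "star A w = w" using w posD by auto
  have wb: "w \<otimes> b = b \<otimes> w" using bicommutesD[OF w(3) b(1)] b by (simp add: m_assoc)
  obtain s where s: "pos s" "s \<otimes> s = w" "bicommutes w s" using pos_sqrt w by blast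
  have sc: "s \<in> carrier A" "star A s = s" using s posD by auto
  define g where "g = w \<ominus> b"
  have g: "g \<in> carrier A" "star A g = g" using b wc by (auto simp: g_def star_diff)
  have wg: "w \<otimes> g = g \<otimes> w" using wb b wc
    by (simp add: g_def a_minus_def l_distr r_distr l_minus r_minus)
  then have sg: "s \<otimes> g = g \<otimes> s" using bicommutesD[OF s(3) g(1)] by simp
  have bg: "b \<otimes> g = \<ominus> (w \<otimes> g)"
  proof -
    have "b \<otimes> g = b \<otimes> w \<ominus> b \<otimes> b" using b wc unfolding g_def by algebra
    also have "\<dots> = w \<otimes> b \<ominus> w \<otimes> w" using wb w by simp
    also have "\<dots> = \<ominus> (w \<otimes> g)" using b(1) wc(1) unfolding g_def by algebra
    finally show ?thesis .
  qed
  define k where "k = g \<otimes> w \<otimes> g"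
  have "k = (s \<otimes> g) \<otimes> (s \<otimes> g)"
    using sg sc g unfolding k_def s(2)[symmetric] by (simp add: m_assoc)
  moreover have "star A (s \<otimes> g) = s \<otimes> g" using sg sc g by (simp add: star_mult)
  ultimately have k: "pos k" using pos_square sc g by (metis m_closed)
  have kc: "k \<in> carrier A" "star A k = k" using k posD by auto
  define c where "c = a \<otimes> g"
  have c: "c \<in> carrier A" using a g by (simp add: c_def)
  have cc: "star A c \<otimes> c = \<ominus> k"
  proof -
    have "star A c \<otimes> c = g \<otimes> (b \<otimes> g)" using a g by (simp add: c_def b_def star_mult m_assoc)
    then show ?thesis using bg g wc b by (simp add: k_def r_minus m_assoc)
  qed
  obtain q where q: "pos q" "q \<otimes> q = k" "bicommutes k q" using pos_sqrt k by blast
  have qc: "q \<in> carrier A" "star A q = q" using q posD by auto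
  have kq: "k \<otimes> q = q \<otimes> k" using bicommutes_commute q kc by blast
  define m where "m = c \<otimes> star A c"
  have m: "m \<in> carrier A" "star A m = m" using c by (auto simp: m_def star_mult)
  define d where "d = c \<otimes> q"
  have d: "d \<in> carrier A" using c qc by (simp add: d_def)
  have "star A d \<otimes> d = q \<otimes> (star A c \<otimes> c) \<otimes> q" using c qc by (simp add: d_def star_mult m_assoc)
  also have "\<dots> = \<ominus> (q \<otimes> k \<otimes> q)" using cc qc kc by (simp add: l_minus r_minus)
  also have "q \<otimes> k \<otimes> q = k \<otimes> k" using kq q(2) qc kc by (metis m_assoc)
  finally have 1: "star A d \<otimes> d = \<ominus> (k \<otimes> k)" .
  have "d \<otimes> star A d = c \<otimes> (q \<otimes> q) \<otimes> star A c" using c qc by (simp add: d_def star_mult m_assoc)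
  moreover have "m \<otimes> m = c \<otimes> (star A c \<otimes> c) \<otimes> star A c" using c by (simp add: m_def m_assoc)
  ultimately have 2: "d \<otimes> star A d = \<ominus> (m \<otimes> m)"
    unfolding cc q(2) using c kc by (simp add: l_minus r_minus)
  have "k \<otimes> k = \<zero>"
    by (rule pos_adj_neg_zero[OF d _ _ 1 2]) (use pos_square kc m in auto)
  then have "k = \<zero>" using sa_square_zero kc by blast
  have "g \<otimes> g = w \<otimes> g \<ominus> b \<otimes> g" using g b wc unfolding g_def by algebra
  then have "g \<otimes> g = w \<otimes> g \<oplus> w \<otimes> g" using bg g wc by (simp add: a_minus_def)
  then have "g \<otimes> (g \<otimes> g) = k \<oplus> k" using g wc by (simp add: k_def r_distr m_assoc)
  then have "(g \<otimes> g) \<otimes> (g \<otimes> g) = \<zero>" using \<open>k = \<zero>\<close> g by (simp add: m_assoc)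
  then have "g \<otimes> g = \<zero>" using sa_square_zero[of "g \<otimes> g"] g by (simp add: star_mult)
  then have "g = \<zero>" using sa_square_zero g by blast
  then have "b = w" using b wc by (simp add: g_def)
  then show ?thesis using w by (simp add: b_def)
qed

text \<open>
  From here on positivity may be used in whichever form is convenient: cone properties from the
  left, preservation under homomorphisms from the right.
\<close>

lemma cpositive_iff_pos: "cpositive A x \<longleftrightarrow> pos x"
proof
  show "cpositive A x \<Longrightarrow> pos x" using pos_star_mult by (auto simp: cpositive_def)
  assume "pos x"
  then obtain w where "pos w" "w \<otimes> w = x" using pos_sqrt by blast
  then show "cpositive A x" unfolding cpositive_def using posD by metis
qed

lemma pos_conj:
  assumes "pos p" "c \<in> carrier A" shows "pos (star A c \<otimes> p \<otimes> c)"
proof -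
  obtain w where w: "pos w" "w \<otimes> w = p" using pos_sqrt assms by blast
  then have wc: "w \<in> carrier A" "star A w = w" using posD by auto
  have "star A c \<otimes> p \<otimes> c = star A (w \<otimes> c) \<otimes> (w \<otimes> c)"
    using wc assms by (simp add: star_mult m_assoc flip: w(2))
  then show ?thesis using pos_star_mult[of "w \<otimes> c"] wc assms by simp
qed

subsection \<open>Finite sums\<close>

lemma sc_finsum: "finite I \<Longrightarrow> f \<in> I \<rightarrow> carrier A \<Longrightarrow> c \<odot> finsum A f I = finsum A (\<lambda>i. c \<odot> f i) I"
  using scal.finsum_smult_ldistr[of I c f] by (simp add: complex_ring_def)

lemma star_finsum: "f \<in> I \<rightarrow> carrier A \<Longrightarrow> star A (finsum A f I) = finsum A (\<lambda>i. star A (f i)) I"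
proof (induction I rule: infinite_finite_induct)
  case (insert i I)
  then have "f \<in> I \<rightarrow> carrier A" "f i \<in> carrier A" "(\<lambda>i. star A (f i)) \<in> I \<rightarrow> carrier A" by auto
  then show ?case using insert by (simp add: star_add)
qed (auto simp: finsum_infinite)

lemma finsum_minus:
  assumes "finite I" "f \<in> I \<rightarrow> carrier A" shows "finsum A (\<lambda>i. \<ominus> f i) I = \<ominus> finsum A f I"
proof -
  have "finsum A (\<lambda>i. \<ominus> f i) I = finsum A (\<lambda>i. (-1) \<odot> f i) I"
    using assms by (intro finsum_cong') (auto simp: sc_minus_l Pi_iff)
  then show ?thesis using assms sc_finsum[of I f "-1"] by (simp add: sc_minus_l)
qed

lemma finsum_diff:
  assumes "finite I" "f \<in> I \<rightarrow> carrier A" "g \<in> I \<rightarrow> carrier A"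
  shows "finsum A (\<lambda>i. f i \<ominus> g i) I = finsum A f I \<ominus> finsum A g I"
  using assms finsum_minus[of I g] finsum_addf[of f I "\<lambda>i. \<ominus> g i"] by (simp add: a_minus_def Pi_iff)

lemma nrm_finsum: "finite I \<Longrightarrow> f \<in> I \<rightarrow> carrier A \<Longrightarrow> nrm A (finsum A f I) \<le> (\<Sum>i\<in>I. nrm A (f i))"
proof (induction I rule: finite_induct)
  case (insert i I)
  then have "f \<in> I \<rightarrow> carrier A" "f i \<in> carrier A" by auto
  then show ?case using insert nrm_triangle[of "f i" "finsum A f I"] by simp
qed simp

lemma pos_finsum_member:
  assumes "finite I" "\<And>i. i \<in> I \<Longrightarrow> pos (f i)" "i \<in> I"
  shows "pos (finsum A f I \<ominus> f i)"
proof -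
  have f: "f \<in> I - {i} \<rightarrow> carrier A" "f i \<in> carrier A" using assms posD by auto
  have "finsum A f (insert i (I - {i})) = f i \<oplus> finsum A f (I - {i})"
    using f assms by (intro finsum_insert) auto
  then have "finsum A f I = f i \<oplus> finsum A f (I - {i})" using assms by (simp add: insert_absorb)
  then have "finsum A f I \<ominus> f i = finsum A f (I - {i})"
    using f by (metis a_comm finsum_closed add.inv_solve_right minus_eq a_closed)
  then show ?thesis using assms pos_finsum[of "I - {i}" f] by simp
qed

text \<open>
  The standard argument for Hilbert modules: expand \<open>\<Sum> (x\<^sub>i - y\<^sub>i c)* (x\<^sub>i - y\<^sub>i c) \<ge> 0\<close> for \<open>c = F / d\<close>,
  where \<open>F = \<Sum> y\<^sub>i* x\<^sub>i\<close>, and use \<open>c* D c \<le> d c* c\<close> for \<open>D = \<Sum> y\<^sub>i* y\<^sub>i\<close>. Working with any bound \<open>d > 0\<close>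
  of \<open>\<parallel>D\<parallel>\<close> avoids treating \<open>D = 0\<close> separately.
\<close>

theorem finsum_cauchy_schwarz:
  assumes I: "finite I" and x: "x \<in> I \<rightarrow> carrier A" and y: "y \<in> I \<rightarrow> carrier A"
    and d: "nrm A (\<Oplus>i\<in>I. star A (y i) \<otimes> y i) \<le> d" "0 < d"
  shows "(nrm A (\<Oplus>i\<in>I. star A (y i) \<otimes> x i))\<^sup>2 \<le> d * nrm A (\<Oplus>i\<in>I. star A (x i) \<otimes> x i)"
proof -
  define D where "D = (\<Oplus>i\<in>I. star A (y i) \<otimes> y i)"
  define E where "E = (\<Oplus>i\<in>I. star A (x i) \<otimes> x i)"
  define F where "F = (\<Oplus>i\<in>I. star A (y i) \<otimes> x i)"
  have xi: "i \<in> I \<Longrightarrow> x i \<in> carrier A" and yi: "i \<in> I \<Longrightarrow> y i \<in> carrier A" for i using x y by auto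
  note DEF = D_def E_def F_def
  have D: "D \<in> carrier A" "star A D = D" and E: "E \<in> carrier A" and F: "F \<in> carrier A"
    using xi yi star_finsum[of "\<lambda>i. star A (y i) \<otimes> y i" I]
    unfolding DEF by (auto intro!: finsum_closed finsum_cong' simp: star_mult Pi_iff)
  have sF: "star A F = (\<Oplus>i\<in>I. star A (x i) \<otimes> y i)"
    using xi yi star_finsum[of "\<lambda>i. star A (y i) \<otimes> x i" I]
    unfolding DEF by (auto intro!: finsum_cong' simp: star_mult Pi_iff)
  define c where "c = complex_of_real (1/d) \<odot> F"
  have c: "c \<in> carrier A" using F by (simp add: c_def)
  define G where "G = complex_of_real (1/d) \<odot> (star A F \<otimes> F)"
  have G: "star A F \<otimes> c = G" "star A c \<otimes> F = G" "complex_of_real d \<odot> (star A c \<otimes> c) = G"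
    "G \<in> carrier A"
    using F d by (auto simp: c_def G_def star_smult sc_mult sc_assoc)
  define Q where "Q = (\<Oplus>i\<in>I. star A (x i \<ominus> y i \<otimes> c) \<otimes> (x i \<ominus> y i \<otimes> c))"
  have "pos Q" unfolding Q_def using xi yi c by (intro pos_finsum pos_star_mult) auto
  have Qe: "Q = (E \<ominus> G) \<ominus> (G \<ominus> star A c \<otimes> D \<otimes> c)"
  proof -
    have e: "star A (x i \<ominus> y i \<otimes> c) \<otimes> (x i \<ominus> y i \<otimes> c) =
        (star A (x i) \<otimes> x i \<ominus> (star A (x i) \<otimes> y i) \<otimes> c)
        \<ominus> (star A c \<otimes> (star A (y i) \<otimes> x i) \<ominus> star A c \<otimes> (star A (y i) \<otimes> y i) \<otimes> c)"
      if "i \<in> I" for i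
    proof -
      have "star A (x i \<ominus> y i \<otimes> c) = star A (x i) \<ominus> star A c \<otimes> star A (y i)"
        using that xi yi c by (simp add: star_diff star_mult)
      then show ?thesis using xi[OF that] yi[OF that] c by simp algebra
    qed
    have "Q = (\<Oplus>i\<in>I. (star A (x i) \<otimes> x i \<ominus> (star A (x i) \<otimes> y i) \<otimes> c)
        \<ominus> (star A c \<otimes> (star A (y i) \<otimes> x i) \<ominus> star A c \<otimes> (star A (y i) \<otimes> y i) \<otimes> c))"
      unfolding Q_def using xi yi c e by (intro finsum_cong') auto
    also have "\<dots> = (E \<ominus> (\<Oplus>i\<in>I. star A (x i) \<otimes> y i) \<otimes> c)
        \<ominus> (star A c \<otimes> F \<ominus> star A c \<otimes> D \<otimes> c)"
      unfolding DEF using I xi yi c by (simp add: finsum_diff finsum_ldistr finsum_rdistr Pi_iff)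
    finally show ?thesis unfolding sF[symmetric] G .
  qed
  have "pos (star A c \<otimes> (rsc d \<ominus> D) \<otimes> c)"
    using D d(1)[folded D_def] c by (intro pos_conj pos_norm_minus) auto
  moreover have "star A c \<otimes> (rsc d \<ominus> D) \<otimes> c = G \<ominus> star A c \<otimes> D \<otimes> c"
  proof -
    have "star A c \<otimes> (rsc d \<ominus> D) \<otimes> c = star A c \<otimes> (complex_of_real d \<odot> \<one>) \<otimes> c \<ominus> star A c \<otimes> D \<otimes> c"
      using c D(1) by algebra
    also have "star A c \<otimes> (complex_of_real d \<odot> \<one>) \<otimes> c = G" using c G(3) by (simp add: sc_mult)
    finally show ?thesis .
  qed
  ultimately have "pos (Q \<oplus> (G \<ominus> star A c \<otimes> D \<otimes> c))" using \<open>pos Q\<close> pos_add by metis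
  moreover have "Q \<oplus> (G \<ominus> star A c \<otimes> D \<otimes> c) = E \<ominus> G"
    unfolding Qe using E G(4) c D(1) by algebra
  ultimately have "pos (E \<ominus> G)" by simp
  moreover have "pos G" unfolding G_def using d F by (intro pos_scale pos_star_mult) auto
  ultimately have "nrm A G \<le> nrm A E" using E by (intro pos_mono_nrm) auto
  moreover have "nrm A G = (nrm A F)\<^sup>2 / d" using F d
    by (simp add: G_def nrm_smult cstar_identity norm_divide)
  ultimately have "(nrm A F)\<^sup>2 \<le> d * nrm A E" using d by (simp add: field_simps)
  then show ?thesis unfolding DEF .
qed

end

subsection \<open>Homomorphisms are contractive\<close>

locale cstar_morphism = A: unital_cstar_algebra A + B: unital_cstar_algebra B
  for A :: "'a cstar" and B :: "'b cstar" and \<phi> +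
  assumes hom: "\<phi> \<in> cstar_hom A B"

lemma cstar_morphismI:
  "unital_cstar_algebra A \<Longrightarrow> unital_cstar_algebra B \<Longrightarrow> \<phi> \<in> cstar_hom A B \<Longrightarrow> cstar_morphism A B \<phi>"
  by (simp add: cstar_morphism_def cstar_morphism_axioms_def)

context cstar_morphism
begin

lemma ring_hom: "\<phi> \<in> ring_hom A B" using hom by (simp add: cstar_hom_def)

lemma closed [simp, intro]: "x \<in> carrier A \<Longrightarrow> \<phi> x \<in> carrier B"
  using ring_hom ring_hom_closed by metis

lemma mult: "x \<in> carrier A \<Longrightarrow> y \<in> carrier A \<Longrightarrow> \<phi> (x \<otimes>\<^bsub>A\<^esub> y) = \<phi> x \<otimes>\<^bsub>B\<^esub> \<phi> y"
  using ring_hom ring_hom_mult by metis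

lemma add: "x \<in> carrier A \<Longrightarrow> y \<in> carrier A \<Longrightarrow> \<phi> (x \<oplus>\<^bsub>A\<^esub> y) = \<phi> x \<oplus>\<^bsub>B\<^esub> \<phi> y"
  using ring_hom ring_hom_add by metis

lemma one [simp]: "\<phi> \<one>\<^bsub>A\<^esub> = \<one>\<^bsub>B\<^esub>"
  using ring_hom ring_hom_one by metis

lemma smult: "x \<in> carrier A \<Longrightarrow> \<phi> (c \<odot>\<^bsub>A\<^esub> x) = c \<odot>\<^bsub>B\<^esub> \<phi> x"
  using hom by (simp add: cstar_hom_def)

lemma star: "x \<in> carrier A \<Longrightarrow> \<phi> (star A x) = star B (\<phi> x)"
  using hom by (simp add: cstar_hom_def)

lemma zero [simp]: "\<phi> \<zero>\<^bsub>A\<^esub> = \<zero>\<^bsub>B\<^esub>"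
  using smult[of "\<zero>\<^bsub>A\<^esub>" 0] by simp

lemma minus: "x \<in> carrier A \<Longrightarrow> \<phi> (\<ominus>\<^bsub>A\<^esub> x) = \<ominus>\<^bsub>B\<^esub> \<phi> x"
  using smult[of x "-1"] by (simp add: A.sc_minus_l B.sc_minus_l)

lemma diff: "x \<in> carrier A \<Longrightarrow> y \<in> carrier A \<Longrightarrow> \<phi> (x \<ominus>\<^bsub>A\<^esub> y) = \<phi> x \<ominus>\<^bsub>B\<^esub> \<phi> y"
  by (simp add: a_minus_def add minus)

lemma finsum: "f \<in> I \<rightarrow> carrier A \<Longrightarrow> \<phi> (finsum A f I) = finsum B (\<lambda>i. \<phi> (f i)) I"
proof (induction I rule: infinite_finite_induct)
  case (insert i I)
  then have "f \<in> I \<rightarrow> carrier A" "f i \<in> carrier A" "(\<lambda>i. \<phi> (f i)) \<in> I \<rightarrow> carrier B" by auto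
  then show ?case using insert by (simp add: add)
qed (auto simp: A.finsum_infinite B.finsum_infinite)

text \<open>
  The relation \<open>x\<^sup>2 + z\<^sup>2 = \<parallel>x\<parallel>\<^sup>2\<close> with \<open>z\<close> commuting with \<open>x\<close> is algebraic, so it survives any
  homomorphism, and it bounds the norm of the image of \<open>x\<close>.
\<close>

lemma contractive_sa:
  assumes x: "x \<in> carrier A" "star A x = x" shows "nrm B (\<phi> x) \<le> nrm A x"
proof -
  let ?r = "(nrm A x)\<^sup>2"
  have "A.pos (A.rsc ?r \<ominus>\<^bsub>A\<^esub> x \<otimes>\<^bsub>A\<^esub> x)"
    using x A.nrm_sq_sa by (intro A.pos_norm_minus) (auto simp: A.star_mult)
  then obtain z where z: "A.pos z" "z \<otimes>\<^bsub>A\<^esub> z = A.rsc ?r \<ominus>\<^bsub>A\<^esub> x \<otimes>\<^bsub>A\<^esub> x"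
     "A.bicommutes (A.rsc ?r \<ominus>\<^bsub>A\<^esub> x \<otimes>\<^bsub>A\<^esub> x) z" using A.pos_sqrt by blast
  have zc: "z \<in> carrier A" "star A z = z" using z A.posD by auto
  have "x \<otimes>\<^bsub>A\<^esub> (A.rsc ?r \<ominus>\<^bsub>A\<^esub> x \<otimes>\<^bsub>A\<^esub> x) = (A.rsc ?r \<ominus>\<^bsub>A\<^esub> x \<otimes>\<^bsub>A\<^esub> x) \<otimes>\<^bsub>A\<^esub> x"
    using x by (simp add: a_minus_def A.l_distr A.r_distr A.l_minus A.r_minus A.sc_mult A.m_assoc)
  then have xz: "x \<otimes>\<^bsub>A\<^esub> z = z \<otimes>\<^bsub>A\<^esub> x" using A.bicommutesD z x by blast
  have "x \<otimes>\<^bsub>A\<^esub> x \<oplus>\<^bsub>A\<^esub> z \<otimes>\<^bsub>A\<^esub> z = A.rsc ?r"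
    unfolding z using x(1) by (simp add: a_minus_def A.a_ac A.r_neg1 A.r_neg2 A.r_neg)
  then have "\<phi> (x \<otimes>\<^bsub>A\<^esub> x \<oplus>\<^bsub>A\<^esub> z \<otimes>\<^bsub>A\<^esub> z) = B.rsc ?r" using smult by simp
  then have "\<phi> x \<otimes>\<^bsub>B\<^esub> \<phi> x \<oplus>\<^bsub>B\<^esub> \<phi> z \<otimes>\<^bsub>B\<^esub> \<phi> z = B.rsc ?r" using x zc by (simp add: add mult)
  moreover have "\<phi> x \<otimes>\<^bsub>B\<^esub> \<phi> z = \<phi> z \<otimes>\<^bsub>B\<^esub> \<phi> x" using arg_cong[OF xz, of \<phi>] x zc by (simp add: mult)
  ultimately have "(nrm B (\<phi> x))\<^sup>2 \<le> ?r"
    using x zc by (intro B.commuting_squares_bound[of "\<phi> x" "\<phi> z"]) (auto simp flip: star)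
  then show ?thesis using A.nrm_nonneg x power2_le_imp_le by blast
qed

theorem contractive:
  assumes x: "x \<in> carrier A" shows "nrm B (\<phi> x) \<le> nrm A x"
proof -
  have "(nrm B (\<phi> x))\<^sup>2 = nrm B (\<phi> (star A x \<otimes>\<^bsub>A\<^esub> x))"
    using x by (simp add: mult star B.cstar_identity)
  also have "\<dots> \<le> nrm A (star A x \<otimes>\<^bsub>A\<^esub> x)"
    using x by (intro contractive_sa) (auto simp: A.star_mult)
  also have "\<dots> = (nrm A x)\<^sup>2" using x by (simp add: A.cstar_identity)
  finally show ?thesis using A.nrm_nonneg x power2_le_imp_le by blast
qed

lemma tends: assumes "A.tends F y L" shows "B.tends F (\<lambda>t. \<phi> (y t)) (\<phi> L)"
proof (rule B.tendsI)
  note c = assms[unfolded A.tends_def]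
  show "\<forall>\<^sub>F t in F. \<phi> (y t) \<in> carrier B" using c by (auto elim: eventually_mono)
  show "\<phi> L \<in> carrier B" using c by simp
  have "nrm B (\<phi> y' \<ominus>\<^bsub>B\<^esub> \<phi> L) \<le> nrm A (y' \<ominus>\<^bsub>A\<^esub> L)" if "y' \<in> carrier A" for y'
    using that c contractive[of "y' \<ominus>\<^bsub>A\<^esub> L"] by (simp add: diff)
  then show "\<forall>\<^sub>F t in F. nrm B (\<phi> (y t) \<ominus>\<^bsub>B\<^esub> \<phi> L) \<le> nrm A (y t \<ominus>\<^bsub>A\<^esub> L)"
    using c by (auto elim: eventually_mono)
qed (use assms in \<open>simp add: A.tends_def\<close>)

end

section \<open>Matrices\<close>

definition mtx_add :: "'a cstar \<Rightarrow> 'a mtx \<Rightarrow> 'a mtx \<Rightarrow> 'a mtx" where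
  "mtx_add A a b = (\<lambda>i j. a i j \<oplus>\<^bsub>A\<^esub> b i j)"

definition mtx_smult :: "'a cstar \<Rightarrow> complex \<Rightarrow> 'a mtx \<Rightarrow> 'a mtx" where
  "mtx_smult A c a = (\<lambda>i j. c \<odot>\<^bsub>A\<^esub> a i j)"

definition mtx_zero :: "'a cstar \<Rightarrow> 'a mtx" where
  "mtx_zero A = (\<lambda>i j. \<zero>\<^bsub>A\<^esub>)"

text \<open>
  The matrix with blocks \<open>a\<close>, \<open>b\<close> in the first \<open>k\<close> rows and \<open>c\<close>, \<open>d\<close> below, the left blocks having \<open>l\<close>
  columns. All the matrices of K-theory used here (block sums, flips, rotations) are of this form.
\<close>

definition block_mtx :: "nat \<Rightarrow> nat \<Rightarrow> 'a mtx \<Rightarrow> 'a mtx \<Rightarrow> 'a mtx \<Rightarrow> 'a mtx \<Rightarrow> 'a mtx" where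
  "block_mtx k l a b c d = (\<lambda>i j. if i < k then (if j < l then a i j else b i (j - l))
     else (if j < l then c (i - k) j else d (i - k) (j - l)))"

context unital_cstar_algebra
begin

lemma matsD [simp]: "a \<in> mats A k l \<Longrightarrow> a i j \<in> carrier A"
  unfolding mats_def by blast

lemma mats_outside: "a \<in> mats A k l \<Longrightarrow> k \<le> i \<or> l \<le> j \<Longrightarrow> a i j = \<zero>"
  unfolding mats_def by blast

lemma matsI: "(\<And>i j. a i j \<in> carrier A) \<Longrightarrow> (\<And>i j. k \<le> i \<or> l \<le> j \<Longrightarrow> a i j = \<zero>) \<Longrightarrow> a \<in> mats A k l"
  unfolding mats_def by blast

lemma finsum_eq_zero: "(\<And>i. i \<in> I \<Longrightarrow> f i = \<zero>) \<Longrightarrow> finsum A f I = \<zero>"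
  using finsum_cong'[of I I "\<lambda>_. \<zero>" f] by (simp add: finsum_zero)

lemma finsum_swap:
  assumes "finite I" "finite J" "\<And>i j. i \<in> I \<Longrightarrow> j \<in> J \<Longrightarrow> f i j \<in> carrier A"
  shows "(\<Oplus>i\<in>I. \<Oplus>j\<in>J. f i j) = (\<Oplus>j\<in>J. \<Oplus>i\<in>I. f i j)"
  using assms(1,3)
proof (induction I rule: finite_induct)
  case empty then show ?case by (simp add: finsum_zero)
next
  case (insert i I)
  have "(\<Oplus>i\<in>insert i I. \<Oplus>j\<in>J. f i j) = (\<Oplus>j\<in>J. f i j) \<oplus> (\<Oplus>j\<in>J. \<Oplus>i\<in>I. f i j)"
    using insert assms(2) by (subst finsum_insert) (auto intro!: finsum_closed)
  also have "\<dots> = (\<Oplus>j\<in>J. f i j \<oplus> (\<Oplus>i\<in>I. f i j))"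
    using insert by (intro finsum_addf[symmetric]) (auto intro!: finsum_closed)
  also have "\<dots> = (\<Oplus>j\<in>J. \<Oplus>i\<in>insert i I. f i j)"
    using insert by (intro finsum_cong') (auto intro!: finsum_closed simp: finsum_insert Pi_iff)
  finally show ?case .
qed

lemma finsum_lessThan_add:
  fixes k l :: nat
  assumes "\<And>i. i < k + l \<Longrightarrow> f i \<in> carrier A"
  shows "(\<Oplus>i\<in>{..<k + l}. f i) = (\<Oplus>i\<in>{..<k}. f i) \<oplus> (\<Oplus>i\<in>{..<l}. f (k + i))"
  using assms
proof (induction l)
  case (Suc l)
  have e: "{..<k + Suc l} = insert (k + l) {..<k + l}" "{..<Suc l} = insert l {..<l}" by auto
  have 1: "(\<Oplus>i\<in>{..<k + Suc l}. f i) = f (k + l) \<oplus> (\<Oplus>i\<in>{..<k + l}. f i)"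
    unfolding e using Suc by (intro finsum_insert) auto
  have 2: "(\<Oplus>i\<in>{..<Suc l}. f (k + i)) = f (k + l) \<oplus> (\<Oplus>i\<in>{..<l}. f (k + i))"
    unfolding e using Suc by (intro finsum_insert) auto
  have c: "(\<Oplus>i\<in>{..<k}. f i) \<in> carrier A" "(\<Oplus>i\<in>{..<l}. f (k + i)) \<in> carrier A"
    "f (k + l) \<in> carrier A"
    using Suc by (auto intro!: finsum_closed)
  have "(\<Oplus>i\<in>{..<k + l}. f i) = (\<Oplus>i\<in>{..<k}. f i) \<oplus> (\<Oplus>i\<in>{..<l}. f (k + i))" using Suc by simp
  then show ?case unfolding 1 2 using c by (simp add: a_lcomm)
qed (auto intro!: finsum_closed)

lemma mtx_mult_closed [simp, intro]:
  assumes "a \<in> mats A k m" "b \<in> mats A m' l" shows "mtx_mult A n a b \<in> mats A k l"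
proof (rule matsI)
  show "mtx_mult A n a b i j \<in> carrier A" for i j
    using assms unfolding mtx_mult_def by (intro finsum_closed) auto
  show "mtx_mult A n a b i j = \<zero>" if "k \<le> i \<or> l \<le> j" for i j
    unfolding mtx_mult_def using assms that
    by (intro finsum_eq_zero) (auto simp: mats_outside[OF assms(1)] mats_outside[OF assms(2)])
qed

lemma mtx_one_closed [simp, intro]: "mtx_one A k \<in> mats A k k"
  by (rule matsI) (auto simp: mtx_one_def)

lemma mtx_star_closed [simp, intro]: "a \<in> mats A k l \<Longrightarrow> mtx_star A a \<in> mats A l k"
  by (rule matsI) (auto simp: mtx_star_def mats_outside)

lemma mtx_add_closed [simp, intro]: "a \<in> mats A k l \<Longrightarrow> b \<in> mats A k l \<Longrightarrow> mtx_add A a b \<in> mats A k l"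
  by (rule matsI) (auto simp: mtx_add_def mats_outside)

lemma mtx_smult_closed [simp, intro]: "a \<in> mats A k l \<Longrightarrow> mtx_smult A c a \<in> mats A k l"
  by (rule matsI) (auto simp: mtx_smult_def mats_outside)

lemma mtx_zero_closed [simp, intro]: "mtx_zero A \<in> mats A k l"
  by (rule matsI) (auto simp: mtx_zero_def mats_outside)

lemma mtx_mult_assoc:
  assumes "a \<in> mats A k m" "b \<in> mats A m n" "c \<in> mats A n l"
  shows "mtx_mult A n (mtx_mult A m a b) c = mtx_mult A m a (mtx_mult A n b c)"
proof (intro ext)
  fix i j
  have "mtx_mult A n (mtx_mult A m a b) c i j = (\<Oplus>q\<in>{..<n}. \<Oplus>p\<in>{..<m}. a i p \<otimes> b p q \<otimes> c q j)"
    unfolding mtx_mult_def using assms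
      by (intro finsum_cong') (auto simp: finsum_ldistr intro!: finsum_closed)
  also have "\<dots> = (\<Oplus>p\<in>{..<m}. \<Oplus>q\<in>{..<n}. a i p \<otimes> b p q \<otimes> c q j)"
    using assms by (intro finsum_swap) auto
  also have "\<dots> = mtx_mult A m a (mtx_mult A n b c) i j"
    unfolding mtx_mult_def using assms
    by (intro finsum_cong') (auto simp: finsum_rdistr m_assoc Pi_iff intro!: finsum_closed)
  finally show "mtx_mult A n (mtx_mult A m a b) c i j = mtx_mult A m a (mtx_mult A n b c) i j" .
qed

lemma mtx_one_left [simp]: assumes "a \<in> mats A k l" shows "mtx_mult A k (mtx_one A k) a = a"
proof (intro ext)
  fix i j
  show "mtx_mult A k (mtx_one A k) a i j = a i j"
  proof (cases "i < k")
    case True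
    have "mtx_mult A k (mtx_one A k) a i j = (\<Oplus>p\<in>{..<k}. if i = p then a p j else \<zero>)"
      unfolding mtx_mult_def using assms True by (intro finsum_cong') (auto simp: mtx_one_def)
    then show ?thesis using True assms finsum_singleton[of i "{..<k}" "\<lambda>p. a p j"] by auto
  next
    case False
    then show ?thesis
      using mats_outside[OF mtx_mult_closed[OF mtx_one_closed assms]] mats_outside[OF assms] by auto
  qed
qed

lemma mtx_star_star [simp]: "a \<in> mats A k l \<Longrightarrow> mtx_star A (mtx_star A a) = a"
  by (simp add: mtx_star_def)

lemma mtx_star_mult:
  assumes "a \<in> mats A k m" "b \<in> mats A m' l"
  shows "mtx_star A (mtx_mult A n a b) = mtx_mult A n (mtx_star A b) (mtx_star A a)"
  unfolding mtx_star_def mtx_mult_def using assms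
  by (intro ext) (auto simp: star_finsum star_mult Pi_iff intro!: finsum_cong')

lemma mtx_star_one [simp]: "mtx_star A (mtx_one A k) = mtx_one A k"
  by (auto simp: mtx_star_def mtx_one_def intro!: ext)

lemma mtx_star_zero [simp]: "mtx_star A (mtx_zero A) = mtx_zero A"
  by (auto simp: mtx_star_def mtx_zero_def)

lemma mtx_star_smult: "a \<in> mats A k l \<Longrightarrow> mtx_star A (mtx_smult A c a)
    = mtx_smult A (cnj c) (mtx_star A a)"
  by (simp add: mtx_star_def mtx_smult_def star_smult)

lemma mtx_star_add: "a \<in> mats A k l \<Longrightarrow> b \<in> mats A k l \<Longrightarrow> mtx_star A (mtx_add A a b)
    = mtx_add A (mtx_star A a) (mtx_star A b)"
  by (simp add: mtx_star_def mtx_add_def star_add)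

lemma mtx_one_right [simp]: assumes "a \<in> mats A k l" shows "mtx_mult A l a (mtx_one A l) = a"
  using mtx_star_mult[OF assms mtx_one_closed, of l l] assms
  by (metis mtx_one_left mtx_star_closed mtx_star_one mtx_star_star mtx_mult_closed mtx_one_closed)

lemma mtx_add_distr_right:
  assumes "a \<in> mats A k m" "b \<in> mats A k m" "c \<in> mats A m' l"
  shows "mtx_mult A n (mtx_add A a b) c = mtx_add A (mtx_mult A n a c) (mtx_mult A n b c)"
  unfolding mtx_mult_def mtx_add_def using assms
  by (intro ext) (auto simp: l_distr finsum_addf Pi_iff)

lemma mtx_add_distr_left:
  assumes "a \<in> mats A k m" "b \<in> mats A m' l" "c \<in> mats A m' l"
  shows "mtx_mult A n a (mtx_add A b c) = mtx_add A (mtx_mult A n a b) (mtx_mult A n a c)"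
  unfolding mtx_mult_def mtx_add_def using assms
  by (intro ext) (auto simp: r_distr finsum_addf Pi_iff)

lemma mtx_smult_left:
  assumes "a \<in> mats A k m" "b \<in> mats A m' l"
  shows "mtx_mult A n (mtx_smult A c a) b = mtx_smult A c (mtx_mult A n a b)"
  unfolding mtx_mult_def mtx_smult_def using assms
  by (intro ext) (auto simp: sc_finsum sc_mult Pi_iff)

lemma mtx_smult_right:
  assumes "a \<in> mats A k m" "b \<in> mats A m' l"
  shows "mtx_mult A n a (mtx_smult A c b) = mtx_smult A c (mtx_mult A n a b)"
  unfolding mtx_mult_def mtx_smult_def using assms
  by (intro ext) (auto simp: sc_finsum sc_mult Pi_iff)

lemma mtx_mult_zero_left [simp]: "b \<in> mats A k l \<Longrightarrow> mtx_mult A n (mtx_zero A) b = mtx_zero A"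
  unfolding mtx_mult_def mtx_zero_def by (intro ext finsum_eq_zero) auto

lemma mtx_mult_zero_right [simp]: "b \<in> mats A k l \<Longrightarrow> mtx_mult A n b (mtx_zero A) = mtx_zero A"
  unfolding mtx_mult_def mtx_zero_def by (intro ext finsum_eq_zero) auto

lemma mtx_add_zero_left [simp]: "b \<in> mats A k l \<Longrightarrow> mtx_add A (mtx_zero A) b = b"
  by (simp add: mtx_add_def mtx_zero_def)

lemma mtx_add_zero_right [simp]: "b \<in> mats A k l \<Longrightarrow> mtx_add A b (mtx_zero A) = b"
  by (simp add: mtx_add_def mtx_zero_def)

lemma mtx_smult_zero [simp]: "mtx_smult A c (mtx_zero A) = mtx_zero A"
  by (simp add: mtx_smult_def mtx_zero_def)

lemma mtx_smult_zero_left: "a \<in> mats A k l \<Longrightarrow> mtx_smult A 0 a = mtx_zero A"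
  by (simp add: mtx_smult_def mtx_zero_def)

lemma mtx_smult_one_left [simp]: "a \<in> mats A k l \<Longrightarrow> mtx_smult A 1 a = a"
  by (simp add: mtx_smult_def)

lemma mtx_smult_smult: "a \<in> mats A k l \<Longrightarrow> mtx_smult A c (mtx_smult A d a) = mtx_smult A (c * d) a"
  by (simp add: mtx_smult_def sc_assoc)

lemma mtx_smult_add: "a \<in> mats A k l \<Longrightarrow> mtx_add A (mtx_smult A c a) (mtx_smult A d a)
    = mtx_smult A (c + d) a"
  by (simp add: mtx_smult_def mtx_add_def sc_add_l)

subsection \<open>Block matrices\<close>

lemma block_mtx_closed [simp, intro]:
  assumes "a \<in> mats A k l" "b \<in> mats A k l'" "c \<in> mats A k' l" "d \<in> mats A k' l'"
  shows "block_mtx k l a b c d \<in> mats A (k + k') (l + l')"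
proof (rule matsI)
  fix i j
  show "block_mtx k l a b c d i j \<in> carrier A" using assms by (auto simp: block_mtx_def)
  assume "k + k' \<le> i \<or> l + l' \<le> j"
  then have "k' \<le> i - k \<and> k \<le> i \<or> l' \<le> j - l \<and> l \<le> j" by auto
  then show "block_mtx k l a b c d i j = \<zero>"
    using assms[THEN mats_outside] by (auto simp: block_mtx_def)
qed

text \<open>
  All computations with block sums, flips and rotations reduce to this rule, which is where the
  index ranges of the sums are split.
\<close>

lemma block_mtx_mult:
  assumes "a \<in> mats A k m" "b \<in> mats A k m'" "c \<in> mats A k' m" "d \<in> mats A k' m'"
    and "a' \<in> mats A m l" "b' \<in> mats A m l'" "c' \<in> mats A m' l" "d' \<in> mats A m' l'"
  shows "mtx_mult A (m + m') (block_mtx k m a b c d) (block_mtx m l a' b' c' d') =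
    block_mtx k l (mtx_add A (mtx_mult A m a a') (mtx_mult A m' b c'))
      (mtx_add A (mtx_mult A m a b') (mtx_mult A m' b d'))
      (mtx_add A (mtx_mult A m c a') (mtx_mult A m' d c'))
        (mtx_add A (mtx_mult A m c b') (mtx_mult A m' d d'))"
    (is "?L = ?R")
proof (intro ext)
  fix i j
  let ?x = "block_mtx k m a b c d" and ?y = "block_mtx m l a' b' c' d'"
  have x: "?x \<in> mats A (k + k') (m + m')" and y: "?y \<in> mats A (m + m') (l + l')" using assms by auto
  have "?L i j = (\<Oplus>p\<in>{..<m}. ?x i p \<otimes> ?y p j) \<oplus> (\<Oplus>p\<in>{..<m'}. ?x i (m + p) \<otimes> ?y (m + p) j)"
    unfolding mtx_mult_def by (intro finsum_lessThan_add m_closed matsD[OF x] matsD[OF y])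
  also have "(\<Oplus>p\<in>{..<m}. ?x i p \<otimes> ?y p j) =
     (\<Oplus>p\<in>{..<m}. (if i < k then a i p else c (i - k) p) \<otimes> (if j < l then a' p j else b' p (j - l)))"
    using assms by (intro finsum_cong') (auto simp: block_mtx_def)
  also have "(\<Oplus>p\<in>{..<m'}. ?x i (m + p) \<otimes> ?y (m + p) j) =
     (\<Oplus>p\<in>{..<m'}. (if i < k then b i p else d (i - k) p) \<otimes> (if j < l then c' p j else d' p
       (j - l)))"
    using assms by (intro finsum_cong') (auto simp: block_mtx_def)
  finally show "?L i j = ?R i j" by (auto simp: block_mtx_def mtx_mult_def mtx_add_def)
qed

lemma block_mtx_star:
  "mtx_star A (block_mtx k l a b c d)
      = block_mtx l k (mtx_star A a) (mtx_star A c) (mtx_star A b) (mtx_star A d)"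
  by (auto simp: mtx_star_def block_mtx_def intro!: ext)

lemma block_mtx_smult: "mtx_smult A z (block_mtx k l a b c d) =
   block_mtx k l (mtx_smult A z a) (mtx_smult A z b) (mtx_smult A z c) (mtx_smult A z d)"
  by (auto simp: mtx_smult_def block_mtx_def intro!: ext)

lemma block_mtx_one: "mtx_one A (k + l)
    = block_mtx k k (mtx_one A k) (mtx_zero A) (mtx_zero A) (mtx_one A l)"
  by (auto simp: mtx_one_def block_mtx_def mtx_zero_def intro!: ext)

abbreviation diag_blocks :: "nat \<Rightarrow> nat \<Rightarrow> 'a mtx \<Rightarrow> 'a mtx \<Rightarrow> 'a mtx" where
  "diag_blocks k l a d \<equiv> block_mtx k l a (mtx_zero A) (mtx_zero A) d"

lemma diag_blocks_mult:
  assumes "a \<in> mats A k m" "d \<in> mats A k' m'" "a' \<in> mats A m l" "d' \<in> mats A m' l'"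
  shows "mtx_mult A (m + m') (diag_blocks k m a d) (diag_blocks m l a' d')
      = diag_blocks k l (mtx_mult A m a a') (mtx_mult A m' d d')"
proof -
  have c: "mtx_mult A m a a' \<in> mats A k l" "mtx_mult A m' d d' \<in> mats A k' l'" using assms by auto
  show ?thesis using assms
    by (subst block_mtx_mult[where k' = k' and l' = l'])
       (auto simp: mtx_add_zero_right[OF c(1)] mtx_add_zero_left[OF c(2)])
qed

lemma block_sum_diag_blocks:
  assumes "a \<in> mats A k k" "b \<in> mats A l l"
  shows "block_sum A (k, a) (l, b) = (k + l, diag_blocks k k a b)"
  by (auto simp: block_sum_def block_mtx_def mtx_zero_def intro!: ext)

lemma block_sum_assoc:
  "block_sum A (block_sum A p q) r = block_sum A p (block_sum A q r)"
  by (auto simp: block_sum_def intro!: ext)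

end

section \<open>Matrix algebras are C*-algebras\<close>

text \<open>
  Columns form the Hilbert module over \<open>A\<close> on which the square matrices act; this is its norm.
\<close>

definition col_norm :: "'a cstar \<Rightarrow> nat \<Rightarrow> 'a mtx \<Rightarrow> real" where
  "col_norm A k x = sqrt (nrm A (mtx_mult A k (mtx_star A x) x 0 0))"

text \<open>
  The operator norm of the action on columns. Norms computed from the norms of the entries violate
  the C*-identity in general.
\<close>

definition mtx_norm :: "'a cstar \<Rightarrow> nat \<Rightarrow> 'a mtx \<Rightarrow> real" where
  "mtx_norm A k a = Sup {col_norm A k (mtx_mult A k a x) | x. x \<in> mats A k 1 \<and> col_norm A k x \<le> 1}"

definition matalg :: "'a cstar \<Rightarrow> nat \<Rightarrow> 'a mtx cstar" where
  "matalg A k = \<lparr>carrier = mats A k k, mult = mtx_mult A k, one = mtx_one A k, zero = mtx_zero A,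
     add = mtx_add A, smult = mtx_smult A, star = mtx_star A, nrm = mtx_norm A k\<rparr>"

context unital_cstar_algebra
begin

abbreviation col_ip :: "nat \<Rightarrow> 'a mtx \<Rightarrow> 'a mtx \<Rightarrow> 'a" where
  "col_ip k x y \<equiv> mtx_mult A k (mtx_star A x) y 0 0"

lemma col_ip_finsum: "col_ip k x y = (\<Oplus>i\<in>{..<k}. star A (x i 0) \<otimes> y i 0)"
  by (simp add: mtx_mult_def mtx_star_def)

lemma col_ip_closed [simp]: "x \<in> mats A k l \<Longrightarrow> y \<in> mats A k' l' \<Longrightarrow> col_ip n x y \<in> carrier A"
  by (rule matsD[OF mtx_mult_closed]) auto

lemma col_norm_nonneg [simp]: "x \<in> mats A k l \<Longrightarrow> 0 \<le> col_norm A n x"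
  unfolding col_norm_def by (intro real_sqrt_ge_zero nrm_nonneg col_ip_closed)

lemma col_norm_square: "x \<in> mats A k l \<Longrightarrow> (col_norm A n x)\<^sup>2 = nrm A (col_ip n x x)"
  unfolding col_norm_def by (intro real_sqrt_pow2 nrm_nonneg col_ip_closed)

text \<open>
  Cauchy--Schwarz holds with every bound \<open>d\<close> above \<open>\<langle>x, x\<rangle>\<close> in place of \<open>\<langle>x, x\<rangle>\<close>; let \<open>d\<close> decrease.
\<close>

lemma col_ip_bound:
  assumes x: "x \<in> mats A k l" and y: "y \<in> mats A k' l'"
  shows "nrm A (col_ip n x y) \<le> col_norm A n x * col_norm A n y"
proof -
  have b: "(nrm A (col_ip n x y))\<^sup>2 \<le> d * nrm A (col_ip n y y)" if "nrm A (col_ip n x x) < d" for d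
  proof -
    have "0 < d" using that nrm_nonneg[OF col_ip_closed[OF x x]] by (metis order_le_less_trans)
    then show ?thesis
      using that x y finsum_cauchy_schwarz[of "{..<n}" "\<lambda>i. y i 0"
        "\<lambda>i. x i 0" d] unfolding col_ip_finsum by auto
  qed
  have "(nrm A (col_ip n x y))\<^sup>2 \<le> nrm A (col_ip n x x) * nrm A (col_ip n y y)"
  proof (cases "nrm A (col_ip n y y) = 0")
    case True
    then show ?thesis using b[of "nrm A (col_ip n x x) + 1"] by simp
  next
    case False
    then have p: "0 < nrm A (col_ip n y y)" using nrm_nonneg[OF col_ip_closed[OF y y]]
      by (metis order_le_less)
    have "(nrm A (col_ip n x y))\<^sup>2 / nrm A (col_ip n y y) \<le> nrm A (col_ip n x x)"
      by (rule dense_ge) (use b p in \<open>simp add: field_simps\<close>)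
    then show ?thesis using p by (simp add: field_simps)
  qed
  also have "\<dots> = (col_norm A n x * col_norm A n y)\<^sup>2"
    by (simp add: power_mult_distrib col_norm_square[OF x] col_norm_square[OF y])
  finally show ?thesis
    by (rule power2_le_imp_le) (use x y in \<open>auto intro!: mult_nonneg_nonneg col_norm_nonneg\<close>)
qed

lemma col_norm_add:
  assumes x: "x \<in> mats A k l" and y: "y \<in> mats A k l"
  shows "col_norm A n (mtx_add A x y) \<le> col_norm A n x + col_norm A n y"
proof -
  note c = col_ip_closed[OF x x, of n] col_ip_closed[OF x y, of n] col_ip_closed[OF y x, of n]
    col_ip_closed[OF y y, of n]
  have xy: "mtx_add A x y \<in> mats A k l" using x y by auto
  have "mtx_mult A n (mtx_star A (mtx_add A x y)) (mtx_add A x y) =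
     mtx_add A (mtx_add A (mtx_mult A n (mtx_star A x) x) (mtx_mult A n (mtx_star A x) y))
        (mtx_add A (mtx_mult A n (mtx_star A y) x) (mtx_mult A n (mtx_star A y) y))"
    unfolding mtx_star_add[OF x y]
      mtx_add_distr_right[OF mtx_star_closed[OF x] mtx_star_closed[OF y] xy]
      mtx_add_distr_left[OF mtx_star_closed[OF x] x y] mtx_add_distr_left[OF mtx_star_closed[OF y]
        x y] ..
  then have "col_ip n (mtx_add A x y) (mtx_add A x y) = (col_ip n x x \<oplus> col_ip n x y)
      \<oplus> (col_ip n y x \<oplus> col_ip n y y)"
    by (simp add: mtx_add_def)
  then have "nrm A (col_ip n (mtx_add A x y) (mtx_add A x y)) \<le>
    (nrm A (col_ip n x x) + nrm A (col_ip n x y)) + (nrm A (col_ip n y x) + nrm A (col_ip n y y))"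
    using nrm_triangle[OF a_closed[OF c(1,2)] a_closed[OF c(3,4)]] nrm_triangle[OF c(1,2)]
      nrm_triangle[OF c(3,4)]
    by simp
  also have "\<dots> \<le> ((col_norm A n x)\<^sup>2 + col_norm A n x * col_norm A n y) +
      (col_norm A n y * col_norm A n x + (col_norm A n y)\<^sup>2)"
    using col_ip_bound[OF x y] col_ip_bound[OF y x]
      by (intro add_mono) (auto simp: col_norm_square[OF x] col_norm_square[OF y])
  also have "\<dots> = (col_norm A n x + col_norm A n y)\<^sup>2" by (simp add: power2_eq_square algebra_simps)
  finally have "(col_norm A n (mtx_add A x y))\<^sup>2 \<le> (col_norm A n x + col_norm A n y)\<^sup>2"
    by (simp add: col_norm_square[OF xy])
  then show ?thesis
    by (rule power2_le_imp_le) (use x y in \<open>auto intro!: add_nonneg_nonneg col_norm_nonneg\<close>)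
qed

lemma col_norm_smult:
  assumes x: "x \<in> mats A k l" shows "col_norm A n (mtx_smult A c x) = cmod c * col_norm A n x"
proof -
  have "mtx_mult A n (mtx_star A (mtx_smult A c x)) (mtx_smult A c x) =
     mtx_smult A (cnj c * c) (mtx_mult A n (mtx_star A x) x)"
    unfolding mtx_star_smult[OF x]
     mtx_smult_left[OF mtx_star_closed[OF x] mtx_smult_closed[OF x]]
       mtx_smult_right[OF mtx_star_closed[OF x] x]
    by (rule mtx_smult_smult[OF mtx_mult_closed[OF mtx_star_closed[OF x] x]])
  then have "col_ip n (mtx_smult A c x) (mtx_smult A c x) = (cnj c * c) \<odot> col_ip n x x"
    by (simp add: mtx_smult_def)
  then have "nrm A (col_ip n (mtx_smult A c x) (mtx_smult A c x))
      = (cmod c)\<^sup>2 * nrm A (col_ip n x x)"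
    using nrm_smult[OF col_ip_closed[OF x x]] by (simp add: norm_mult power2_eq_square)
  then show ?thesis unfolding col_norm_def by (simp add: real_sqrt_mult)
qed

lemma col_norm_entry:
  assumes x: "x \<in> mats A k l" and i: "i < n" shows "nrm A (x i 0) \<le> col_norm A n x"
proof -
  have p: "pos (col_ip n x x \<ominus> star A (x i 0) \<otimes> x i 0)"
    unfolding col_ip_finsum using i x by (intro pos_finsum_member pos_star_mult) auto
  have "nrm A (star A (x i 0) \<otimes> x i 0) \<le> nrm A (col_ip n x x)"
    using x by (intro pos_mono_nrm p pos_star_mult col_ip_closed[OF x x]) auto
  then have "(nrm A (x i 0))\<^sup>2 \<le> (col_norm A n x)\<^sup>2" using x
    by (simp add: cstar_identity col_norm_square[OF x])
  then show ?thesis by (rule power2_le_imp_le) (use x in auto)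
qed

lemma col_norm_le_sum:
  assumes x: "x \<in> mats A k l" shows "col_norm A n x \<le> (\<Sum>i<n. nrm A (x i 0))"
proof -
  have nn: "0 \<le> nrm A (x i 0)" for i using nrm_nonneg x by auto
  have "nrm A (col_ip n x x) \<le> (\<Sum>i<n. nrm A (star A (x i 0) \<otimes> x i 0))"
    unfolding col_ip_finsum using x by (intro nrm_finsum) auto
  also have "\<dots> = (\<Sum>i<n. (nrm A (x i 0))\<^sup>2)" using x by (simp add: cstar_identity)
  also have "\<dots> \<le> (\<Sum>i<n. nrm A (x i 0) * (\<Sum>i<n. nrm A (x i 0)))"
    unfolding power2_eq_square using nn by (intro sum_mono mult_left_mono member_le_sum) auto
  also have "\<dots> = (\<Sum>i<n. nrm A (x i 0))\<^sup>2" by (simp add: power2_eq_square sum_distrib_right)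
  finally have "(col_norm A n x)\<^sup>2 \<le> (\<Sum>i<n. nrm A (x i 0))\<^sup>2" by (simp add: col_norm_square[OF x])
  then show ?thesis by (rule power2_le_imp_le) (use nn in \<open>auto intro: sum_nonneg\<close>)
qed

text \<open>
  A crude bound, which makes the supremum in the operator norm finite and shows that entrywise
  convergence implies convergence in norm.
\<close>

lemma col_norm_mult_le:
  assumes a: "a \<in> mats A k k" and x: "x \<in> mats A k 1"
  shows "col_norm A k (mtx_mult A k a x) \<le> (\<Sum>i<k. \<Sum>j<k. nrm A (a i j)) * col_norm A k x"
proof -
  have nn: "0 \<le> nrm A (a i j)" for i j using nrm_nonneg a by auto
  have "nrm A (mtx_mult A k a x i 0) \<le> (\<Sum>j<k. nrm A (a i j)) * col_norm A k x" for i
  proof -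
    have "nrm A (mtx_mult A k a x i 0) \<le> (\<Sum>j<k. nrm A (a i j \<otimes> x j 0))"
      unfolding mtx_mult_def using a x by (intro nrm_finsum) auto
    also have "\<dots> \<le> (\<Sum>j<k. nrm A (a i j) * col_norm A k x)"
      using a x col_norm_entry[OF x] by (intro sum_mono mult_closed_norm) auto
    finally show ?thesis by (simp add: sum_distrib_right)
  qed
  then have "(\<Sum>i<k. nrm A (mtx_mult A k a x i 0)) \<le> (\<Sum>i<k. (\<Sum>j<k. nrm A (a i j)) * col_norm A k x)"
    by (intro sum_mono)
  then show ?thesis using col_norm_le_sum[OF mtx_mult_closed[OF a x], of k k]
    by (simp add: sum_distrib_right)
qed

lemma col_norm_zero [simp]: "col_norm A k (mtx_zero A) = 0"
  by (simp add: col_norm_def mtx_mult_zero_left[OF mtx_zero_closed]) (simp add: mtx_zero_def)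

lemma mtx_norm_bdd:
  assumes a: "a \<in> mats A k k"
  shows "bdd_above {col_norm A k (mtx_mult A k a x) | x. x \<in> mats A k 1 \<and> col_norm A k x \<le> 1}"
proof (rule bdd_aboveI)
  fix c assume "c \<in> {col_norm A k (mtx_mult A k a x) | x. x \<in> mats A k 1 \<and> col_norm A k x \<le> 1}"
  then obtain x where x: "c = col_norm A k (mtx_mult A k a x)" "x \<in> mats A k 1" "col_norm A k x \<le> 1"
    by auto
  have "0 \<le> (\<Sum>i<k. \<Sum>j<k. nrm A (a i j))" using a nrm_nonneg by (intro sum_nonneg) auto
  then show "c \<le> (\<Sum>i<k. \<Sum>j<k. nrm A (a i j))"
    using col_norm_mult_le[OF a x(2)] x by (smt (verit) mult_left_le)
qed

lemma mtx_norm_upper: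
  assumes a: "a \<in> mats A k k" and x: "x \<in> mats A k 1" "col_norm A k x \<le> 1"
  shows "col_norm A k (mtx_mult A k a x) \<le> mtx_norm A k a"
  unfolding mtx_norm_def by (rule cSup_upper[OF _ mtx_norm_bdd[OF a]]) (use x in auto)

lemma mtx_norm_least:
  assumes "\<And>x. x \<in> mats A k 1 \<Longrightarrow> col_norm A k x \<le> 1 \<Longrightarrow> col_norm A k (mtx_mult A k a x) \<le> C"
  shows "mtx_norm A k a \<le> C"
  unfolding mtx_norm_def
proof (rule cSup_least)
  have "mtx_zero A \<in> mats A k 1" "col_norm A k (mtx_zero A) \<le> 1" by auto
  then show "{col_norm A k (mtx_mult A k a x) |x. x \<in> mats A k 1 \<and> col_norm A k x \<le> 1} \<noteq> {}"
    by blast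
qed (use assms in auto)

lemma mtx_norm_nonneg:
  assumes a: "a \<in> mats A k k" shows "0 \<le> mtx_norm A k a"
  using mtx_norm_upper[OF a mtx_zero_closed] mtx_mult_zero_right[OF a] by simp

lemma mtx_norm_bound:
  assumes a: "a \<in> mats A k k" and x: "x \<in> mats A k 1"
  shows "col_norm A k (mtx_mult A k a x) \<le> mtx_norm A k a * col_norm A k x"
proof (cases "col_norm A k x = 0")
  case True
  then show ?thesis using col_norm_mult_le[OF a x] by simp
next
  case False
  then have p: "0 < col_norm A k x" using col_norm_nonneg[OF x] by (metis order_le_less)
  define y where "y = mtx_smult A (complex_of_real (1 / col_norm A k x)) x"
  have y: "y \<in> mats A k 1" using x by (auto simp: y_def)
  have "col_norm A k y \<le> 1" using p x by (simp add: y_def col_norm_smult[OF x] norm_divide)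
  from mtx_norm_upper[OF a y this]
  have "(1 / col_norm A k x) * col_norm A k (mtx_mult A k a x) \<le> mtx_norm A k a"
    using p unfolding y_def mtx_smult_right[OF a x] col_norm_smult[OF mtx_mult_closed[OF a x]]
      by (simp add: norm_divide)
  then show ?thesis using p by (simp add: field_simps)
qed

text \<open>
  The entry is a coordinate of the image of a standard basis column.
\<close>

lemma mtx_norm_entry:
  assumes a: "a \<in> mats A k k" shows "nrm A (a i j) \<le> mtx_norm A k a"
proof (cases "i < k \<and> j < k")
  case True
  define e where "e = (\<lambda>p q. if p = j \<and> q = (0::nat) then \<one> else \<zero>)"
  have e: "e \<in> mats A k 1" by (rule matsI) (use True in \<open>auto simp: e_def\<close>)
  have "col_ip k e e = (\<Oplus>i\<in>{..<k}. if j = i then \<one> else \<zero>)"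
    unfolding col_ip_finsum by (intro finsum_cong') (auto simp: e_def)
  then have "col_ip k e e = \<one>" using True finsum_singleton[of j "{..<k}" "\<lambda>_. \<one>"] by simp
  then have "col_norm A k e \<le> 1" using nrm_one by (simp add: col_norm_def)
  moreover have "mtx_mult A k a e i 0 = (\<Oplus>p\<in>{..<k}. if j = p then a i p else \<zero>)"
    unfolding mtx_mult_def using a by (intro finsum_cong') (auto simp: e_def)
  then have "mtx_mult A k a e i 0 = a i j" using True a finsum_singleton[of j "{..<k}"
    "\<lambda>p. a i p"] by auto
  moreover have "nrm A (mtx_mult A k a e i 0) \<le> col_norm A k (mtx_mult A k a e)"
    by (rule col_norm_entry[OF mtx_mult_closed[OF a e]]) (use True in simp)
  ultimately show ?thesis
    using mtx_norm_upper[OF a e] by simp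
next
  case False
  then have "a i j = \<zero>" using a mats_outside not_le by metis
  then show ?thesis using mtx_norm_nonneg[OF a] by simp
qed

lemma mtx_norm_le_sum:
  assumes a: "a \<in> mats A k k" shows "mtx_norm A k a \<le> (\<Sum>i<k. \<Sum>j<k. nrm A (a i j))"
proof (rule mtx_norm_least)
  fix x assume x: "x \<in> mats A k 1" "col_norm A k x \<le> 1"
  have "0 \<le> (\<Sum>i<k. \<Sum>j<k. nrm A (a i j))" using a nrm_nonneg by (intro sum_nonneg) auto
  then show "col_norm A k (mtx_mult A k a x) \<le> (\<Sum>i<k. \<Sum>j<k. nrm A (a i j))"
    using col_norm_mult_le[OF a x(1)] x by (smt (verit) mult_left_le)
qed

lemma mtx_norm_mult:
  assumes a: "a \<in> mats A k k" and b: "b \<in> mats A k k"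
  shows "mtx_norm A k (mtx_mult A k a b) \<le> mtx_norm A k a * mtx_norm A k b"
proof (rule mtx_norm_least)
  fix x assume x: "x \<in> mats A k 1" "col_norm A k x \<le> 1"
  have "col_norm A k (mtx_mult A k (mtx_mult A k a b) x)
      \<le> mtx_norm A k a * col_norm A k (mtx_mult A k b x)"
    unfolding mtx_mult_assoc[OF a b x(1)] by (rule mtx_norm_bound[OF a mtx_mult_closed[OF b x(1)]])
  also have "\<dots> \<le> mtx_norm A k a * mtx_norm A k b"
    by (intro mult_left_mono mtx_norm_upper b x mtx_norm_nonneg a)
  finally show "col_norm A k (mtx_mult A k (mtx_mult A k a b) x) \<le> mtx_norm A k a * mtx_norm A k b"
    .
qed

text \<open>
  This is \<open>\<parallel>a x\<parallel>\<^sup>2 = \<parallel>\<langle>x, a* a x\<rangle>\<parallel> \<le> \<parallel>a* a\<parallel>\<close> for columns \<open>x\<close> of norm at most \<open>1\<close>.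
\<close>

lemma mtx_norm_square_le:
  assumes a: "a \<in> mats A k k"
  shows "(mtx_norm A k a)\<^sup>2 \<le> mtx_norm A k (mtx_mult A k (mtx_star A a) a)"
proof -
  note sa = mtx_star_closed[OF a]
  have saa: "mtx_mult A k (mtx_star A a) a \<in> mats A k k" using a by auto
  have "mtx_norm A k a \<le> sqrt (mtx_norm A k (mtx_mult A k (mtx_star A a) a))"
  proof (rule mtx_norm_least)
    fix x assume x: "x \<in> mats A k 1" "col_norm A k x \<le> 1"
    note ax = mtx_mult_closed[OF a x(1)]
    have "mtx_mult A k (mtx_star A (mtx_mult A k a x)) (mtx_mult A k a x) =
      mtx_mult A k (mtx_star A x) (mtx_mult A k (mtx_mult A k (mtx_star A a) a) x)"
      unfolding mtx_star_mult[OF a x(1)] mtx_mult_assoc[OF mtx_star_closed[OF x(1)] sa ax]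
        mtx_mult_assoc[OF sa a x(1)] ..
    then have "(col_norm A k (mtx_mult A k a x))\<^sup>2
        = nrm A (col_ip k x (mtx_mult A k (mtx_mult A k (mtx_star A a) a) x))"
      by (simp add: col_norm_square[OF ax])
    also have "\<dots> \<le> col_norm A k x * col_norm A k (mtx_mult A k (mtx_mult A k (mtx_star A a) a) x)"
      by (rule col_ip_bound[OF x(1) mtx_mult_closed[OF saa x(1)]])
    also have "\<dots> \<le> 1 * mtx_norm A k (mtx_mult A k (mtx_star A a) a)"
      by (intro mult_mono mtx_norm_upper saa x col_norm_nonneg[OF mtx_mult_closed[OF saa x(1)]])
        auto
    finally show "col_norm A k (mtx_mult A k a x)
        \<le> sqrt (mtx_norm A k (mtx_mult A k (mtx_star A a) a))"
      by (simp add: real_le_rsqrt)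
  qed
  then have "(mtx_norm A k a)\<^sup>2 \<le> (sqrt (mtx_norm A k (mtx_mult A k (mtx_star A a) a)))\<^sup>2"
    by (rule power_mono[OF _ mtx_norm_nonneg[OF a]])
  then show ?thesis using mtx_norm_nonneg[OF saa] by simp
qed

lemma mtx_norm_star_le:
  assumes a: "a \<in> mats A k k" shows "mtx_norm A k a \<le> mtx_norm A k (mtx_star A a)"
proof (cases "mtx_norm A k a = 0")
  case False
  then have p: "0 < mtx_norm A k a" using mtx_norm_nonneg[OF a] by simp
  have "mtx_norm A k a * mtx_norm A k a \<le> mtx_norm A k (mtx_star A a) * mtx_norm A k a"
    using mtx_norm_square_le[OF a] mtx_norm_mult[OF mtx_star_closed[OF a] a]
      by (simp add: power2_eq_square)
  then show ?thesis using p by simp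
qed (use mtx_norm_nonneg[OF mtx_star_closed[OF a]] in simp)

lemma mtx_norm_cstar:
  assumes a: "a \<in> mats A k k"
  shows "mtx_norm A k (mtx_mult A k (mtx_star A a) a) = (mtx_norm A k a)\<^sup>2"
proof -
  have "mtx_norm A k (mtx_star A a) = mtx_norm A k a"
    using mtx_norm_star_le[OF a] mtx_norm_star_le[OF mtx_star_closed[OF a]]
      by (simp add: mtx_star_star[OF a])
  then show ?thesis
    using mtx_norm_square_le[OF a] mtx_norm_mult[OF mtx_star_closed[OF a] a]
      by (simp add: power2_eq_square)
qed

lemma mtx_norm_add:
  assumes a: "a \<in> mats A k k" and b: "b \<in> mats A k k"
  shows "mtx_norm A k (mtx_add A a b) \<le> mtx_norm A k a + mtx_norm A k b"
proof (rule mtx_norm_least)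
  fix x assume x: "x \<in> mats A k 1" "col_norm A k x \<le> 1"
  show "col_norm A k (mtx_mult A k (mtx_add A a b) x) \<le> mtx_norm A k a + mtx_norm A k b"
    unfolding mtx_add_distr_right[OF a b x(1)]
    using col_norm_add[OF mtx_mult_closed[OF a x(1)] mtx_mult_closed[OF b x(1)], of k k k]
      mtx_norm_upper[OF a x] mtx_norm_upper[OF b x] by simp
qed

lemma mtx_norm_smult:
  assumes a: "a \<in> mats A k k" shows "mtx_norm A k (mtx_smult A c a) = cmod c * mtx_norm A k a"
proof -
  have le: "mtx_norm A k (mtx_smult A c a) \<le> cmod c * mtx_norm A k a" if a: "a \<in> mats A k k" for a c
  proof (rule mtx_norm_least)
    fix x assume x: "x \<in> mats A k 1" "col_norm A k x \<le> 1"
    show "col_norm A k (mtx_mult A k (mtx_smult A c a) x) \<le> cmod c * mtx_norm A k a"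
      unfolding mtx_smult_left[OF a x(1)] col_norm_smult[OF mtx_mult_closed[OF a x(1)]]
      by (intro mult_left_mono mtx_norm_upper a x) auto
  qed
  show ?thesis
  proof (cases "c = 0")
    case True
    have "mtx_norm A k (mtx_zero A) \<le> 0"
      using le[OF a, of 0] by (simp add: mtx_smult_zero_left[OF a])
    then show ?thesis using True mtx_norm_nonneg[OF mtx_zero_closed]
      by (simp add: mtx_smult_zero_left[OF a] order_antisym)
  next
    case False
    have "mtx_norm A k a \<le> cmod (1/c) * mtx_norm A k (mtx_smult A c a)"
      using le[OF mtx_smult_closed[OF a], of "1/c" c] False by
        (simp add: mtx_smult_smult[OF a] mtx_smult_one_left[OF a])
    then show ?thesis using le[OF a, of c] False by (simp add: norm_divide field_simps)
  qed
qed

lemma ring_matalg: "ring (matalg A k)"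
proof (intro ringI abelian_groupI monoidI)
  fix x assume x: "x \<in> carrier (matalg A k)"
  show "\<exists>y\<in>carrier (matalg A k). y \<oplus>\<^bsub>matalg A k\<^esub> x = \<zero>\<^bsub>matalg A k\<^esub>"
  proof (rule bexI)
    show "mtx_smult A (-1) x \<oplus>\<^bsub>matalg A k\<^esub> x = \<zero>\<^bsub>matalg A k\<^esub>"
      using x by (auto simp: matalg_def mtx_add_def mtx_smult_def mtx_zero_def sc_minus_l l_neg
        intro!: ext)
  qed (use x in \<open>auto simp: matalg_def\<close>)
qed (auto simp: matalg_def mtx_mult_assoc mtx_add_distr_left mtx_add_distr_right,
     auto simp: mtx_add_def mtx_zero_def a_ac)

lemma matalg_minus:
  assumes "x \<in> mats A k k" shows "\<ominus>\<^bsub>matalg A k\<^esub> x = (\<lambda>i j. \<ominus> x i j)"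
proof -
  interpret M: ring "matalg A k" by (rule ring_matalg)
  have "(\<lambda>i j. \<ominus> x i j) \<in> mats A k k" by (rule matsI) (use assms in \<open>auto simp: mats_outside\<close>)
  then show ?thesis
    using assms by (intro M.minus_equality)
      (auto simp: matalg_def mtx_add_def mtx_zero_def l_neg intro!: ext)
qed

lemma matalg_diff:
  "x \<in> mats A k k \<Longrightarrow> y \<in> mats A k k \<Longrightarrow> x \<ominus>\<^bsub>matalg A k\<^esub> y = (\<lambda>i j. x i j \<ominus> y i j)"
  by (auto simp: a_minus_def[of "matalg A k"] matalg_minus)
    (auto simp: matalg_def mtx_add_def a_minus_def)

lemma matalg_entry_diff:
  assumes "x \<in> mats A k k" "y \<in> mats A k k"
  shows "nrm A (x i j \<ominus> y i j) \<le> nrm (matalg A k) (x \<ominus>\<^bsub>matalg A k\<^esub> y)"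
proof -
  interpret M: ring "matalg A k" by (rule ring_matalg)
  have "x \<ominus>\<^bsub>matalg A k\<^esub> y \<in> mats A k k" using M.minus_closed[of x y] assms by (simp add: matalg_def)
  from mtx_norm_entry[OF this, of i j] show ?thesis using assms
    by (simp add: matalg_diff) (simp add: matalg_def)
qed

lemma matalg_diff_le_sum:
  assumes "x \<in> mats A k k" "y \<in> mats A k k"
  shows "nrm (matalg A k) (x \<ominus>\<^bsub>matalg A k\<^esub> y) \<le> (\<Sum>i<k. \<Sum>j<k. nrm A (x i j \<ominus> y i j))"
proof -
  interpret M: ring "matalg A k" by (rule ring_matalg)
  have "x \<ominus>\<^bsub>matalg A k\<^esub> y \<in> mats A k k" using M.minus_closed[of x y] assms by (simp add: matalg_def)
  from mtx_norm_le_sum[OF this] show ?thesis using assms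
    by (simp add: matalg_diff) (simp add: matalg_def)
qed

lemma cring_complex_ring: "cring complex_ring"
  by (rule cringI[OF abelian_groupI comm_monoidI])
     (auto simp: complex_ring_def algebra_simps intro: exI[of _ "- x" for x] add.left_inverse)

text \<open>
  Completeness in terms of the norm, without the metric, which is a default value off the carrier.
\<close>

lemma mcompleteI:
  assumes M: "Metric_space (carrier M) (cdist M)"
    and lim: "\<And>y. (\<And>n. y n \<in> carrier M) \<Longrightarrow>
      (\<And>e. e > 0 \<Longrightarrow> \<exists>N. \<forall>m\<ge>N. \<forall>n\<ge>N. nrm M (y m \<ominus>\<^bsub>M\<^esub> y n) < e) \<Longrightarrow>
      \<exists>L\<in>carrier M. (\<lambda>n. nrm M (y n \<ominus>\<^bsub>M\<^esub> L)) \<longlonglongrightarrow> 0"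
  shows "Metric_space.mcomplete (carrier M) (cdist M)"
proof -
  interpret MS: Metric_space "carrier M" "cdist M" by (rule M)
  show ?thesis unfolding MS.mcomplete_def
  proof (intro allI impI)
    fix y assume c: "MS.MCauchy y"
    then have y: "y n \<in> carrier M" for n by (auto simp: MS.MCauchy_def)
    have "\<exists>N. \<forall>m\<ge>N. \<forall>n\<ge>N. nrm M (y m \<ominus>\<^bsub>M\<^esub> y n) < e" if "e > 0" for e
      using c that y unfolding MS.MCauchy_def cdist_def by auto
    from lim[OF y this] obtain L where L: "L \<in> carrier M" "(\<lambda>n. nrm M (y n \<ominus>\<^bsub>M\<^esub> L)) \<longlonglongrightarrow> 0" by blast
    then have "limitin MS.mtopology y L sequentially"
      unfolding MS.limitin_metric_dist_null using y by (simp add: cdist_def)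
    then show "\<exists>x. limitin MS.mtopology y x sequentially" by blast
  qed
qed

end

lemma Metric_space_cdistI:
  fixes M (structure)
  assumes "ring M" and nn: "\<And>x. x \<in> carrier M \<Longrightarrow> 0 \<le> nrm M x"
    and z: "\<And>x. x \<in> carrier M \<Longrightarrow> nrm M x = 0 \<longleftrightarrow> x = \<zero>"
    and m: "\<And>x. x \<in> carrier M \<Longrightarrow> nrm M (\<ominus> x) = nrm M x"
    and t: "\<And>x y. x \<in> carrier M \<Longrightarrow> y \<in> carrier M \<Longrightarrow> nrm M (x \<oplus> y) \<le> nrm M x + nrm M y"
  shows "Metric_space (carrier M) (cdist M)"
proof
  interpret ring M by fact
  show "0 \<le> cdist M x y" for x y by (auto simp: cdist_def intro: nn)
  show "cdist M x y = cdist M y x" for x y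
  proof (cases "x \<in> carrier M \<and> y \<in> carrier M")
    case True
    then have "y \<ominus> x = \<ominus> (x \<ominus> y)" by (simp add: minus_eq minus_add a_comm)
    then show ?thesis using True m[of "x \<ominus> y"] by (simp add: cdist_def)
  qed (auto simp: cdist_def)
  show "cdist M x y = 0 \<longleftrightarrow> x = y" if "x \<in> carrier M" "y \<in> carrier M" for x y
    using that by (simp add: cdist_def z)
  show "cdist M x z \<le> cdist M x y + cdist M y z"
    if "x \<in> carrier M" "y \<in> carrier M" "z \<in> carrier M" for x y z
  proof -
    have "x \<ominus> z = (x \<ominus> y) \<oplus> (y \<ominus> z)"
      using that by (simp add: minus_eq a_assoc r_neg1)
    then show ?thesis using that t[of "x \<ominus> y" "y \<ominus> z"] by (simp add: cdist_def)
  qed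
qed

text \<open>
  Completeness is inherited from \<open>A\<close> because the norm is equivalent to the sum of the norms of the
  entries.
\<close>

theorem (in unital_cstar_algebra) unital_cstar_algebra_matalg: "unital_cstar_algebra (matalg A k)"
proof -
  interpret M: ring "matalg A k" by (rule ring_matalg)
  have z: "mtx_norm A k x = 0 \<longleftrightarrow> x = mtx_zero A" if x: "x \<in> mats A k k" for x
  proof
    assume "mtx_norm A k x = 0"
    then have "nrm A (x i j) = 0" for i j
      using mtx_norm_entry[OF x, of i j] nrm_nonneg[OF matsD[OF x]] by (simp add: order_antisym)
    then show "x = mtx_zero A" using nrm_eq_0[OF matsD[OF x]] by (auto simp: mtx_zero_def)
  next
    assume "x = mtx_zero A"
    then show "mtx_norm A k x = 0"
      using mtx_norm_smult[OF mtx_zero_closed, of k 0] mtx_smult_zero by simp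
  qed
  have m: "mtx_norm A k (\<ominus>\<^bsub>matalg A k\<^esub> x) = mtx_norm A k x" if x: "x \<in> mats A k k" for x
  proof -
    have "\<ominus>\<^bsub>matalg A k\<^esub> x = mtx_smult A (-1) x"
      using x by (simp add: matalg_minus mtx_smult_def sc_minus_l)
    then show ?thesis using mtx_norm_smult[OF x, of "-1"] by simp
  qed
  have ms: "Metric_space (carrier (matalg A k)) (cdist (matalg A k))"
    by (rule Metric_space_cdistI[OF ring_matalg])
      (auto simp: matalg_def mtx_norm_nonneg mtx_norm_add z m[unfolded matalg_def])
  have comp: "Metric_space.mcomplete (carrier (matalg A k)) (cdist (matalg A k))"
  proof (rule mcompleteI[OF ms])
    fix y :: "nat \<Rightarrow> 'a mtx"
    assume "\<And>n. y n \<in> carrier (matalg A k)"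
    then have y: "y n \<in> mats A k k" for n by (simp add: matalg_def)
    assume C: "\<And>e. e > 0 \<Longrightarrow> \<exists>N. \<forall>m\<ge>N. \<forall>n\<ge>N. nrm (matalg A k) (y m \<ominus>\<^bsub>matalg A k\<^esub> y n) < e"
    have "\<exists>L. tends sequentially (\<lambda>n. y n i j) L" for i j
    proof (rule Cauchy_tends)
      show "y n i j \<in> carrier A" for n by (rule matsD[OF y])
      show "\<exists>N. \<forall>m\<ge>N. \<forall>n\<ge>N. nrm A (y m i j \<ominus> y n i j) < e" if "e > 0" for e
        using C[OF that] matalg_entry_diff[OF y y] by (meson order_le_less_trans)
    qed
    then obtain L where L: "\<And>i j. tends sequentially (\<lambda>n. y n i j) (L i j)" by metis
    have Lc: "L \<in> mats A k k"
    proof (rule matsI)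
      show "L i j \<in> carrier A" for i j using L tends_closed by blast
      show "L i j = \<zero>" if "k \<le> i \<or> k \<le> j" for i j
        using tends_unique[OF L[of i j], of \<zero>] that mats_outside[OF y] by (simp add: tends_const)
    qed
    have "(\<lambda>n. \<Sum>i<k. \<Sum>j<k. nrm A (y n i j \<ominus> L i j)) \<longlonglongrightarrow> (\<Sum>i<k. \<Sum>j<k. 0)"
      using L unfolding tends_def by (intro tendsto_sum) auto
    then have s: "(\<lambda>n. \<Sum>i<k. \<Sum>j<k. nrm A (y n i j \<ominus> L i j)) \<longlonglongrightarrow> 0" by simp
    have "(\<lambda>n. nrm (matalg A k) (y n \<ominus>\<^bsub>matalg A k\<^esub> L)) \<longlonglongrightarrow> 0"
    proof (rule tendsto_sandwich[OF _ _ tendsto_const s])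
      have "y n \<ominus>\<^bsub>matalg A k\<^esub> L \<in> mats A k k" for n
        using M.minus_closed[of "y n" L] y Lc by (simp add: matalg_def)
      then show "\<forall>\<^sub>F n in sequentially. 0 \<le> nrm (matalg A k) (y n \<ominus>\<^bsub>matalg A k\<^esub> L)"
        using mtx_norm_nonneg by (simp add: matalg_def)
      show "\<forall>\<^sub>F n in sequentially. nrm (matalg A k) (y n \<ominus>\<^bsub>matalg A k\<^esub> L)
          \<le> (\<Sum>i<k. \<Sum>j<k. nrm A (y n i j \<ominus> L i j))"
        using matalg_diff_le_sum[OF y Lc] by simp
    qed
    then show "\<exists>L\<in>carrier (matalg A k). (\<lambda>n. nrm (matalg A k) (y n \<ominus>\<^bsub>matalg A k\<^esub> L)) \<longlonglongrightarrow> 0"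
      using Lc by (intro bexI[of _ L]) (auto simp: matalg_def)
  qed
  have ab: "abelian_group (matalg A k)" by (rule M.is_abelian_group)
  have mod: "module complex_ring (matalg A k)"
    by (rule moduleI[OF cring_complex_ring ab])
       (auto simp: matalg_def complex_ring_def mtx_smult_add[symmetric] mtx_smult_smult,
        auto simp: mtx_smult_def mtx_add_def sc_add_r)
  show ?thesis
    by (intro unital_cstar_algebra.intro unital_cstar_algebra_axioms.intro ring_matalg mod comp)
       (auto simp: matalg_def mtx_smult_left mtx_smult_right mtx_star_add mtx_star_smult
         mtx_star_mult
         mtx_norm_nonneg mtx_norm_add mtx_norm_smult mtx_norm_mult mtx_norm_cstar z)
qed

section \<open>Grothendieck groups and quotient isomorphisms\<close>

text \<open>
  Projections up to equivalence and unitaries up to stable homotopy both form a commutative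
  semigroup under block sum. What follows from this alone is done once, here. Associativity holds
  on the nose for block sums.
\<close>

locale comm_congruence =
  fixes P :: "'x set"
    and opr :: "'x \<Rightarrow> 'x \<Rightarrow> 'x" (infixl "\<star>" 65) and R :: "'x \<Rightarrow> 'x \<Rightarrow> bool" (infix "\<sim>" 50)
  assumes opr_closed [simp]: "x \<in> P \<Longrightarrow> y \<in> P \<Longrightarrow> x \<star> y \<in> P"
    and R_in: "x \<sim> y \<Longrightarrow> x \<in> P \<and> y \<in> P"
    and R_refl [simp]: "x \<in> P \<Longrightarrow> x \<sim> x"
    and R_sym: "x \<sim> y \<Longrightarrow> y \<sim> x"
    and R_trans [trans]: "x \<sim> y \<Longrightarrow> y \<sim> z \<Longrightarrow> x \<sim> z"
    and R_cong: "x \<sim> y \<Longrightarrow> x' \<sim> y' \<Longrightarrow> x \<star> x' \<sim> y \<star> y'"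
    and opr_assoc: "(x \<star> y) \<star> z = x \<star> (y \<star> z)"
    and opr_comm: "x \<in> P \<Longrightarrow> y \<in> P \<Longrightarrow> x \<star> y \<sim> y \<star> x"
begin

lemma interchange:
  assumes "a \<in> P" "b \<in> P" "c \<in> P" "d \<in> P"
  shows "(a \<star> b) \<star> (c \<star> d) \<sim> (a \<star> c) \<star> (b \<star> d)"
proof -
  have "a \<star> ((b \<star> c) \<star> d) \<sim> a \<star> ((c \<star> b) \<star> d)"
    using assms by (intro R_cong opr_comm R_refl)
  then show ?thesis by (simp add: opr_assoc)
qed

text \<open>
  Equality in the Grothendieck group of the semigroup.
\<close>

definition stably :: "'x \<Rightarrow> 'x \<Rightarrow> bool" where
  "stably x y \<longleftrightarrow> x \<in> P \<and> y \<in> P \<and> (\<exists>r\<in>P. x \<star> r \<sim> y \<star> r)"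

lemma R_imp_stably: "x \<sim> y \<Longrightarrow> stably x y"
  unfolding stably_def using R_in R_cong R_refl by blast

lemma stably_congruence: "comm_congruence P opr stably"
proof
  show "x \<star> y \<in> P" if "x \<in> P" "y \<in> P" for x y using that by simp
  show "stably x y \<Longrightarrow> x \<in> P \<and> y \<in> P" for x y by (simp add: stably_def)
  show "x \<in> P \<Longrightarrow> stably x x" for x using R_imp_stably by simp
  show "stably x y \<Longrightarrow> stably y x" for x y unfolding stably_def using R_sym by blast
  show "x \<star> y \<star> z = x \<star> (y \<star> z)" for x y z by (rule opr_assoc)
  show "x \<in> P \<Longrightarrow> y \<in> P \<Longrightarrow> stably (x \<star> y) (y \<star> x)" for x y using R_imp_stably opr_comm by blast
  show "stably x z" if h: "stably x y" "stably y z" for x y z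
  proof -
    obtain r s where r: "r \<in> P" "x \<star> r \<sim> y \<star> r" and s: "s \<in> P" "y \<star> s \<sim> z \<star> s"
      and c: "x \<in> P" "y \<in> P" "z \<in> P" using h unfolding stably_def by blast
    have "x \<star> (r \<star> s) \<sim> y \<star> (r \<star> s)" using R_cong[OF r(2) R_refl[OF s(1)]] by (simp add: opr_assoc)
    also have "y \<star> (r \<star> s) \<sim> y \<star> (s \<star> r)" using c r s by (intro R_cong opr_comm R_refl)
    also have "y \<star> (s \<star> r) \<sim> z \<star> (s \<star> r)" using R_cong[OF s(2) R_refl[OF r(1)]]
      by (simp add: opr_assoc)
    also have "z \<star> (s \<star> r) \<sim> z \<star> (r \<star> s)" using c r s by (intro R_cong opr_comm R_refl)
    finally show ?thesis unfolding stably_def using c r s by (intro conjI bexI[of _ "r \<star> s"]) auto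
  qed
  show "stably (x \<star> x') (y \<star> y')" if h: "stably x y" "stably x' y'" for x y x' y'
  proof -
    obtain r s where r: "r \<in> P" "x \<star> r \<sim> y \<star> r" and s: "s \<in> P" "x' \<star> s \<sim> y' \<star> s"
      and c: "x \<in> P" "y \<in> P" "x' \<in> P" "y' \<in> P" using h unfolding stably_def by blast
    have "(x \<star> x') \<star> (r \<star> s) \<sim> (x \<star> r) \<star> (x' \<star> s)" using c r s by (intro interchange)
    also have "(x \<star> r) \<star> (x' \<star> s) \<sim> (y \<star> r) \<star> (y' \<star> s)" by (rule R_cong[OF r(2) s(2)])
    also have "(y \<star> r) \<star> (y' \<star> s) \<sim> (y \<star> y') \<star> (r \<star> s)" using c r s by (intro interchange)
    finally show ?thesis unfolding stably_def using c r s by (intro conjI bexI[of _ "r \<star> s"]) auto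
  qed
qed

lemma stably_cancel: "x \<in> P \<Longrightarrow> y \<in> P \<Longrightarrow> z \<in> P \<Longrightarrow> stably (x \<star> z) (y \<star> z) \<Longrightarrow> stably x y"
  unfolding stably_def by (auto simp: opr_assoc)

definition grel :: "(('x \<times> 'x) \<times> ('x \<times> 'x)) set" where
  "grel = {((p, q), (p', q')). p \<in> P \<and> q \<in> P \<and> p' \<in> P \<and> q' \<in> P \<and> stably (p \<star> q') (p' \<star> q)}"

lemma equiv_grel: "equiv (P \<times> P) grel"
proof (rule equivI)
  interpret S: comm_congruence P opr stably by (rule stably_congruence)
  show "grel \<subseteq> (P \<times> P) \<times> (P \<times> P)" by (auto simp: grel_def)
  show "refl_on (P \<times> P) grel" unfolding refl_on_def grel_def using S.R_refl opr_closed by auto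
  show "sym grel" unfolding sym_def grel_def using S.R_sym by blast
  show "trans grel"
  proof (rule transI)
    fix x y z assume "(x, y) \<in> grel" "(y, z) \<in> grel"
    then obtain p q p' q' p'' q'' where xyz: "x = (p, q)" "y = (p', q')" "z = (p'', q'')"
      and c: "p \<in> P" "q \<in> P" "p' \<in> P" "q' \<in> P" "p'' \<in> P" "q'' \<in> P"
      and 1: "stably (p \<star> q') (p' \<star> q)" and 2: "stably (p' \<star> q'') (p'' \<star> q')"
      by (auto simp: grel_def)
    have "stably ((p \<star> q'') \<star> (q' \<star> p')) ((p \<star> q') \<star> (q'' \<star> p'))" using c by (intro S.interchange)
    also have "stably ((p \<star> q') \<star> (q'' \<star> p')) ((p' \<star> q) \<star> (p'' \<star> q'))"
      using c by (intro S.R_cong 1 S.R_trans[OF S.opr_comm 2]) auto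
    also have "stably ((p' \<star> q) \<star> (p'' \<star> q')) ((p' \<star> p'') \<star> (q \<star> q'))" using c
      by (intro S.interchange)
    also have "stably ((p' \<star> p'') \<star> (q \<star> q')) ((p'' \<star> p') \<star> (q \<star> q'))"
      using c by (intro S.R_cong S.opr_comm S.R_refl) auto
    also have "stably ((p'' \<star> p') \<star> (q \<star> q')) ((p'' \<star> q) \<star> (p' \<star> q'))" using c
      by (intro S.interchange)
    also have "stably ((p'' \<star> q) \<star> (p' \<star> q')) ((p'' \<star> q) \<star> (q' \<star> p'))"
      using c by (intro S.R_cong S.opr_comm S.R_refl) auto
    finally have "stably ((p \<star> q'') \<star> (q' \<star> p')) ((p'' \<star> q) \<star> (q' \<star> p'))" .
    from stably_cancel[OF _ _ _ this] have "stably (p \<star> q'') (p'' \<star> q)" using c by simp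
    then show "(x, z) \<in> grel" using c xyz by (auto simp: grel_def)
  qed
qed

lemma grel_cong:
  assumes "((p1, q1), (p1', q1')) \<in> grel" "((p2, q2), (p2', q2')) \<in> grel"
  shows "((p1 \<star> p2, q1 \<star> q2), (p1' \<star> p2', q1' \<star> q2')) \<in> grel"
proof -
  interpret S: comm_congruence P opr stably by (rule stably_congruence)
  from assms have c: "p1 \<in> P" "q1 \<in> P" "p1' \<in> P" "q1' \<in> P" "p2 \<in> P" "q2 \<in> P" "p2' \<in> P" "q2' \<in> P"
    and 1: "stably (p1 \<star> q1') (p1' \<star> q1)" and 2: "stably (p2 \<star> q2') (p2' \<star> q2)"
      by (auto simp: grel_def)
  have "stably ((p1 \<star> p2) \<star> (q1' \<star> q2')) ((p1 \<star> q1') \<star> (p2 \<star> q2'))" using c by (intro S.interchange)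
  also have "stably ((p1 \<star> q1') \<star> (p2 \<star> q2')) ((p1' \<star> q1) \<star> (p2' \<star> q2))" by (rule S.R_cong[OF 1 2])
  also have "stably ((p1' \<star> q1) \<star> (p2' \<star> q2)) ((p1' \<star> p2') \<star> (q1 \<star> q2))" using c
    by (intro S.interchange)
  finally show ?thesis using c by (auto simp: grel_def)
qed

end

text \<open>
  Both K-groups are quotients of explicit sets, with operations defined as unions over
  representatives. An isomorphism between two such quotients is induced by any map of
  representatives that respects the operations, preserves and reflects the relations, and hits
  every class.
\<close>

lemma quotient_iso:
  assumes r: "equiv X r" and s: "equiv Y s"
    and opX: "\<And>x x' y y'. (x, x') \<in> r \<Longrightarrow> (y, y') \<in> r \<Longrightarrow> (opX x y, opX x' y') \<in> r"
    and opY: "\<And>x x' y y'. (x, x') \<in> s \<Longrightarrow> (y, y') \<in> s \<Longrightarrow> (opY x y, opY x' y') \<in> s"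
    and f: "\<And>x. x \<in> X \<Longrightarrow> f x \<in> Y"
    and fop: "\<And>x y. x \<in> X \<Longrightarrow> y \<in> X \<Longrightarrow> f (opX x y) = opY (f x) (f y)"
    and iff: "\<And>x x'. x \<in> X \<Longrightarrow> x' \<in> X \<Longrightarrow> (x, x') \<in> r \<longleftrightarrow> (f x, f x') \<in> s"
    and surj: "\<And>y. y \<in> Y \<Longrightarrow> \<exists>x\<in>X. (f x, y) \<in> s"
  shows "(\<lambda>C. \<Union>x\<in>C. s `` {f x}) \<in>
    iso \<lparr>carrier = X // r, mult = (\<lambda>C D. \<Union>x\<in>C. \<Union>y\<in>D. r `` {opX x y}), one = e\<rparr>
        \<lparr>carrier = Y // s, mult = (\<lambda>C D. \<Union>x\<in>C. \<Union>y\<in>D. s `` {opY x y}), one = e'\<rparr>"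
proof -
  have rX: "(x, x') \<in> r \<Longrightarrow> x \<in> X \<and> x' \<in> X" for x x' using r by (auto simp: equiv_def)
  have sY: "(x, x') \<in> s \<Longrightarrow> x \<in> Y \<and> x' \<in> Y" for x x' using s by (auto simp: equiv_def)
  have reflr: "x \<in> X \<Longrightarrow> (x, x) \<in> r" for x using r by (auto simp: equiv_def refl_on_def)
  have refls: "x \<in> Y \<Longrightarrow> (x, x) \<in> s" for x using s by (auto simp: equiv_def refl_on_def)
  have opXc: "x \<in> X \<Longrightarrow> y \<in> X \<Longrightarrow> opX x y \<in> X" for x y using opX reflr rX by blast
  have F: "(\<Union>x\<in>r `` {a}. s `` {f x}) = s `` {f a}" if "a \<in> X" for a
    by (rule UN_equiv_class[OF r _ that])
       (use iff rX in \<open>auto simp: congruent_def intro!: equiv_class_eq[OF s]\<close>)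
  have MX: "(\<Union>x\<in>r `` {a}. \<Union>y\<in>r `` {b}. r `` {opX x y}) = r `` {opX a b}" if "a \<in> X" "b \<in> X" for a b
    by (rule UN_equiv_class2[OF r r _ that])
       (auto simp: congruent2_def intro!: equiv_class_eq[OF r] opX)
  have MY: "(\<Union>x\<in>s `` {a}. \<Union>y\<in>s `` {b}. s `` {opY x y}) = s `` {opY a b}" if "a \<in> Y" "b \<in> Y" for a b
    by (rule UN_equiv_class2[OF s s _ that])
       (auto simp: congruent2_def intro!: equiv_class_eq[OF s] opY)
  show ?thesis
    unfolding iso_def
  proof (intro CollectI conjI)
    show "(\<lambda>C. \<Union>x\<in>C. s `` {f x}) \<in>
    hom \<lparr>carrier = X // r, mult = (\<lambda>C D. \<Union>x\<in>C. \<Union>y\<in>D. r `` {opX x y}), one = e\<rparr>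
        \<lparr>carrier = Y // s, mult = (\<lambda>C D. \<Union>x\<in>C. \<Union>y\<in>D. s `` {opY x y}), one = e'\<rparr>"
    proof (rule homI, goal_cases)
      case (1 C)
      then have "C \<in> X // r" by simp
      then have "(\<Union>x\<in>C. s `` {f x}) \<in> Y // s"
        by (elim quotientE) (auto simp: F intro!: quotientI f)
      then show ?case by simp
    next
      case (2 C D)
      then have "C \<in> X // r" "D \<in> X // r" by simp_all
      then obtain a b where ab: "a \<in> X" "b \<in> X" "C = r `` {a}" "D = r `` {b}"
        by (auto elim!: quotientE)
      show ?case
        unfolding monoid.simps ab(3,4) F[OF ab(1)] F[OF ab(2)] MX[OF ab(1,2)] MY[OF f[OF ab(1)]
          f[OF ab(2)]] F[OF opXc[OF ab(1,2)]]
          fop[OF ab(1,2)] ..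
    qed
    show "bij_betw (\<lambda>C. \<Union>x\<in>C. s `` {f x})
      (carrier \<lparr>carrier = X // r, mult = (\<lambda>C D. \<Union>x\<in>C. \<Union>y\<in>D. r `` {opX x y}), one = e\<rparr>)
      (carrier \<lparr>carrier = Y // s, mult = (\<lambda>C D. \<Union>x\<in>C. \<Union>y\<in>D. s `` {opY x y}), one = e'\<rparr>)"
      unfolding partial_object.simps
    proof (rule bij_betw_imageI, rule inj_onI)
      fix C D assume "C \<in> X // r" "D \<in> X // r" and e: "(\<Union>x\<in>C. s `` {f x}) = (\<Union>x\<in>D. s `` {f x})"
      then obtain a b where ab: "a \<in> X" "b \<in> X" "C = r `` {a}" "D = r `` {b}"
        by (auto elim!: quotientE)
      have "(f a, f b) \<in> s" using e unfolding ab(3,4) F[OF ab(1)] F[OF ab(2)]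
        using eq_equiv_class_iff[OF s f[OF ab(1)] f[OF ab(2)]] by simp
      then have "(a, b) \<in> r" using iff ab by simp
      then show "C = D" unfolding ab by (rule equiv_class_eq[OF r])
    next
      show "(\<lambda>C. \<Union>x\<in>C. s `` {f x}) ` (X // r) = Y // s"
      proof (rule equalityI; rule subsetI)
        fix D assume "D \<in> (\<lambda>C. \<Union>x\<in>C. s `` {f x}) ` (X // r)"
        then obtain C where "C \<in> X // r" "D = (\<Union>x\<in>C. s `` {f x})" by blast
        then show "D \<in> Y // s" by (elim quotientE) (auto simp: F intro!: quotientI f)
      next
        fix D assume "D \<in> Y // s"
        then obtain b where b: "b \<in> Y" "D = s `` {b}" by (auto elim!: quotientE)
        obtain a where a: "a \<in> X" "(f a, b) \<in> s" using surj b by blast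
        have "D = (\<Union>x\<in>r `` {a}. s `` {f x})" unfolding F[OF a(1)] b using equiv_class_eq[OF s a(2)]
          by simp
        then show "D \<in> (\<lambda>C. \<Union>x\<in>C. s `` {f x}) ` (X // r)" using quotientI[OF a(1)] by blast
      qed
    qed
  qed
qed

section \<open>Projections\<close>

context unital_cstar_algebra
begin

text \<open>
  With \<open>x = p (p - q) p\<close>, of norm below \<open>1\<close>, one has \<open>p q p = p (1 - x)\<close>. Let \<open>r\<close> be the inverse square
  root of \<open>1 - x\<close>. Then \<open>v = q p r\<close> is a partial isometry with \<open>v* v = p\<close> and \<open>v v* \<le> q\<close>. The difference
  \<open>e = q - v v*\<close> kills \<open>p\<close>, hence \<open>e = e (q - p)\<close>, which forces \<open>e = 0\<close>.
\<close>

lemma close_projections: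
  assumes p: "p \<in> carrier A" "star A p = p" "p \<otimes> p = p"
    and q: "q \<in> carrier A" "star A q = q" "q \<otimes> q = q"
    and d: "nrm A (p \<ominus> q) < 1"
  shows "\<exists>v\<in>carrier A. star A v \<otimes> v = p \<and> v \<otimes> star A v = q"
proof -
  have np: "nrm A p \<le> 1"
  proof -
    have "nrm A p = (nrm A p)\<^sup>2" using cstar_identity[OF p(1)] p by simp
    then have "nrm A p = 0 \<or> nrm A p = 1" by (simp add: power2_eq_square)
    then show ?thesis by auto
  qed
  define x where "x = p \<otimes> (p \<ominus> q) \<otimes> p"
  have x: "x \<in> carrier A" "star A x = x" using p q by (auto simp: x_def star_mult star_diff m_assoc)
  have "nrm A (p \<otimes> (p \<ominus> q)) \<le> 1 * nrm A (p \<ominus> q)" using p q np by (intro mult_closed_norm) auto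
  then have "nrm A x \<le> (1 * nrm A (p \<ominus> q)) * 1" unfolding x_def using p q np
    by (intro mult_closed_norm) auto
  then have nx: "nrm A x < 1" using d by simp
  have pp: "p \<otimes> (p \<otimes> z) = p \<otimes> z" if "z \<in> carrier A" for z using p that by (simp flip: m_assoc)
  have px: "p \<otimes> x = x" "x \<otimes> p = x" using p q by (simp_all add: x_def m_assoc pp)
  have xe: "x = p \<ominus> p \<otimes> q \<otimes> p"
  proof -
    have "x = p \<otimes> p \<otimes> p \<ominus> p \<otimes> q \<otimes> p" unfolding x_def using p(1) q(1) by algebra
    then show ?thesis using p by simp
  qed
  then have pqp: "p \<otimes> q \<otimes> p = p \<ominus> x" using p q
    by (simp add: a_minus_def minus_add r_neg2 r_neg a_assoc[symmetric])
  obtain b where b: "b \<in> carrier A" "(\<one> \<ominus> x) \<otimes> b = \<one>" "b \<otimes> (\<one> \<ominus> x) = \<one>" "bicommutes x b"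
    using neumann_inverse[OF x(1) nx] by blast
  obtain y where y: "y \<in> carrier A" "star A y = y" "(\<one> \<ominus> y) \<otimes> (\<one> \<ominus> y) = \<one> \<ominus> x" "bicommutes x y"
    using sqrt_one_minus[OF x] nx by auto
  define t where "t = \<one> \<ominus> y"
  have t: "t \<in> carrier A" "star A t = t" "t \<otimes> t = \<one> \<ominus> x" using y by (auto simp: t_def star_diff)
  have sb: "star A b = b"
  proof -
    have "star A b \<otimes> (\<one> \<ominus> x) = star A ((\<one> \<ominus> x) \<otimes> b)"
      using b(1) x by (simp add: star_mult star_diff)
    also have "\<dots> = \<one>" unfolding b(2) by simp
    finally have "star A b \<otimes> (\<one> \<ominus> x) \<otimes> b = b" using b by simp
    then show ?thesis using b x by (simp add: m_assoc)
  qed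
  have com: "z \<otimes> t = t \<otimes> z" if "z \<in> carrier A" "z \<otimes> x = x \<otimes> z" for z
    using bicommutesD[OF y(4) that] that y
      by (simp add: t_def a_minus_def l_distr r_distr l_minus r_minus)
  have tb: "b \<otimes> t = t \<otimes> b" using com b bicommutes_commute[OF b(4) x(1)] by simp
  define r where "r = t \<otimes> b"
  have r: "r \<in> carrier A" "star A r = r" using t b sb tb by (auto simp: r_def star_mult)
  have rp: "r \<otimes> p = p \<otimes> r"
  proof -
    have "p \<otimes> t = t \<otimes> p" "p \<otimes> b = b \<otimes> p" using com bicommutesD[OF b(4)] px p by auto
    then show ?thesis unfolding r_def using t b p by (metis m_assoc)
  qed
  have rx: "r \<otimes> (\<one> \<ominus> x) \<otimes> r = \<one>"
  proof -
    have "r \<otimes> (\<one> \<ominus> x) \<otimes> r = t \<otimes> (b \<otimes> (\<one> \<ominus> x)) \<otimes> (t \<otimes> b)" unfolding r_def using t b x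
      by (simp add: m_assoc)
    also have "\<dots> = (t \<otimes> t) \<otimes> b" unfolding b(3) using b(1) t(1) by (simp add: m_assoc)
    finally show ?thesis unfolding t(3) b(2) .
  qed
  define v where "v = q \<otimes> p \<otimes> r"
  have v: "v \<in> carrier A" using p q r by (auto simp: v_def)
  have sv: "star A v = r \<otimes> p \<otimes> q" using p q r by (simp add: v_def star_mult m_assoc)
  have qq: "q \<otimes> (q \<otimes> z) = q \<otimes> z" if "z \<in> carrier A" for z using q that by (simp flip: m_assoc)
  have qv: "q \<otimes> v = v" using p q r by (simp add: v_def flip: m_assoc)
  have "star A v \<otimes> v = r \<otimes> (p \<otimes> (q \<otimes> q) \<otimes> p) \<otimes> r" using p q r unfolding sv unfolding v_def
    by (simp add: m_assoc qq)
  also have "\<dots> = r \<otimes> (p \<ominus> x) \<otimes> r" using q pqp by simp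
  also have "p \<ominus> x = p \<otimes> (\<one> \<ominus> x)" using p x px by (simp add: a_minus_def r_distr r_minus)
  also have "r \<otimes> (p \<otimes> (\<one> \<ominus> x)) \<otimes> r = (r \<otimes> p) \<otimes> (\<one> \<ominus> x) \<otimes> r" using p x r by (simp add: m_assoc)
  also have "\<dots> = p \<otimes> (r \<otimes> (\<one> \<ominus> x) \<otimes> r)" unfolding rp using p x r by (simp add: m_assoc)
  finally have vv: "star A v \<otimes> v = p" using rx p by simp
  have vp: "v \<otimes> p = v" using rp p q r by (simp add: v_def m_assoc pp)
  define e where "e = q \<ominus> v \<otimes> star A v"
  have e: "e \<in> carrier A" using q v by (auto simp: e_def)
  have "e \<otimes> v = q \<otimes> v \<ominus> v \<otimes> (star A v \<otimes> v)"
    unfolding e_def using q(1) v by algebra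
  then have ev: "e \<otimes> v = \<zero>" using vv qv vp v by (simp add: a_minus_def r_neg)
  have eq: "e \<otimes> q = e"
  proof -
    have "star A v \<otimes> q = star A v" using arg_cong[OF qv, of "star A"] v q by (simp add: star_mult)
    then show ?thesis unfolding e_def using q v by (simp add: a_minus_def l_distr l_minus m_assoc)
  qed
  have "e \<otimes> p = e \<otimes> (q \<otimes> p) \<otimes> (r \<otimes> (\<one> \<ominus> x) \<otimes> r)" using rx e p q eq by (simp add: m_assoc[symmetric])
  also have "\<dots> = e \<otimes> v \<otimes> ((\<one> \<ominus> x) \<otimes> r)" unfolding v_def using e p q r x by (simp add: m_assoc)
  finally have ep: "e \<otimes> p = \<zero>" using ev r x by simp
  have "e \<otimes> (q \<ominus> p) = e" using eq ep e p q by (simp add: a_minus_def r_distr r_minus)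
  then have "nrm A e \<le> nrm A e * nrm A (p \<ominus> q)"
    using nrm_mult[of e "q \<ominus> p"] e p q nrm_diff_commute[of p q] by simp
  then have "nrm A e * (1 - nrm A (p \<ominus> q)) \<le> 0" by (simp add: algebra_simps)
  then have "nrm A e \<le> 0" using d by (simp add: mult_le_0_iff)
  then have "e = \<zero>" using nrm_eq_0[OF e] nrm_nonneg[OF e] by simp
  then have "v \<otimes> star A v = q" using q v by (simp add: e_def)
  then show ?thesis using vv v by blast
qed

lemma projectionsD:
  assumes "(k, p) \<in> projections A"
  shows "p \<in> mats A k k" "mtx_star A p = p" "mtx_mult A k p p = p"
  using assms by (auto simp: projections_def)

lemma mvn_refl: "p \<in> projections A \<Longrightarrow> mvn_equiv A p p"
  unfolding mvn_equiv_def by (rule bexI[of _ "snd p"]) (auto simp: projections_def)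

lemma mvn_sym: assumes "mvn_equiv A p q" shows "mvn_equiv A q p"
proof -
  obtain v where v: "v \<in> mats A (fst q) (fst p)" "mtx_mult A (fst q) (mtx_star A v) v = snd p"
    "mtx_mult A (fst p) v (mtx_star A v) = snd q"
    using assms by (auto simp: mvn_equiv_def)
  show ?thesis unfolding mvn_equiv_def
    by (rule bexI[of _ "mtx_star A v"]) (use v in \<open>auto simp: mtx_star_star[OF v(1)]\<close>)
qed

text \<open>
  The partial isometries compose.
\<close>

lemma mvn_trans:
  assumes pq: "mvn_equiv A (k, p) (l, q)" and qr: "mvn_equiv A (l, q) (m, r)"
    and p: "(k, p) \<in> projections A" and r: "(m, r) \<in> projections A"
  shows "mvn_equiv A (k, p) (m, r)"
proof -
  obtain v where v: "v \<in> mats A l k" "mtx_mult A l (mtx_star A v) v = p"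
    "mtx_mult A k v (mtx_star A v) = q"
    using pq by (auto simp: mvn_equiv_def)
  obtain w where w: "w \<in> mats A m l" "mtx_mult A m (mtx_star A w) w = q"
    "mtx_mult A l w (mtx_star A w) = r"
    using qr by (auto simp: mvn_equiv_def)
  note sv = mtx_star_closed[OF v(1)] and sw = mtx_star_closed[OF w(1)]
  have wv: "mtx_mult A l w v \<in> mats A m k" using v w by auto
  have swv: "mtx_star A (mtx_mult A l w v) = mtx_mult A l (mtx_star A v) (mtx_star A w)"
    by (rule mtx_star_mult[OF w(1) v(1)])
  have "mtx_mult A m (mtx_star A (mtx_mult A l w v)) (mtx_mult A l w v) =
     mtx_mult A l (mtx_star A v) (mtx_mult A l (mtx_mult A m (mtx_star A w) w) v)"
    unfolding swv mtx_mult_assoc[OF sv sw wv] mtx_mult_assoc[OF sw w(1) v(1)] ..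
  also have "\<dots> = mtx_mult A k (mtx_mult A l (mtx_star A v) v) (mtx_mult A l (mtx_star A v) v)"
    unfolding w(2) v(3)[symmetric] mtx_mult_assoc[OF sv v(1) mtx_mult_closed[OF sv v(1)]]
      mtx_mult_assoc[OF v(1) sv v(1)] ..
  finally have 1: "mtx_mult A m (mtx_star A (mtx_mult A l w v)) (mtx_mult A l w v) = p"
    unfolding v(2) projectionsD(3)[OF p] .
  have "mtx_mult A k (mtx_mult A l w v) (mtx_star A (mtx_mult A l w v)) =
     mtx_mult A l w (mtx_mult A l (mtx_mult A k v (mtx_star A v)) (mtx_star A w))"
    unfolding swv mtx_mult_assoc[OF w(1) v(1) mtx_mult_closed[OF sv sw]]
      mtx_mult_assoc[OF v(1) sv sw] ..
  also have "\<dots> = mtx_mult A m (mtx_mult A l w (mtx_star A w)) (mtx_mult A l w (mtx_star A w))"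
    unfolding v(3) w(2)[symmetric] mtx_mult_assoc[OF w(1) sw mtx_mult_closed[OF w(1) sw]]
      mtx_mult_assoc[OF sw w(1) sw] ..
  finally have 2: "mtx_mult A k (mtx_mult A l w v) (mtx_star A (mtx_mult A l w v)) = r"
    unfolding w(3) projectionsD(3)[OF r] .
  show ?thesis unfolding mvn_equiv_def using wv 1 2 by auto
qed

lemma block_sum_projections:
  assumes "p \<in> projections A" "q \<in> projections A" shows "block_sum A p q \<in> projections A"
proof -
  obtain k a l b where pq: "p = (k, a)" "q = (l, b)" by (cases p, cases q)
  note a = projectionsD[OF assms(1)[unfolded pq]] and b = projectionsD[OF assms(2)[unfolded pq]]
  have "diag_blocks k k a b \<in> mats A (k + l) (k + l)" using a b by auto
  then show ?thesis
    unfolding pq block_sum_diag_blocks[OF a(1) b(1)] projections_def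
    using a b diag_blocks_mult[OF a(1) b(1) a(1) b(1)] by (simp add: block_mtx_star)
qed

lemma mvn_block_sum:
  assumes pq: "mvn_equiv A (k, p) (l, q)" and pq': "mvn_equiv A (k', p') (l', q')"
    and m: "p \<in> mats A k k" "q \<in> mats A l l" "p' \<in> mats A k' k'" "q' \<in> mats A l' l'"
  shows "mvn_equiv A (block_sum A (k, p) (k', p')) (block_sum A (l, q) (l', q'))"
proof -
  obtain v where v: "v \<in> mats A l k" "mtx_mult A l (mtx_star A v) v = p"
    "mtx_mult A k v (mtx_star A v) = q"
    using pq by (auto simp: mvn_equiv_def)
  obtain w where w: "w \<in> mats A l' k'" "mtx_mult A l' (mtx_star A w) w = p'"
    "mtx_mult A k' w (mtx_star A w) = q'"
    using pq' by (auto simp: mvn_equiv_def)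
  note sv = mtx_star_closed[OF v(1)] and sw = mtx_star_closed[OF w(1)]
  have d: "diag_blocks l k v w \<in> mats A (l + l') (k + k')" using v w by auto
  show ?thesis
    unfolding mvn_equiv_def block_sum_diag_blocks[OF m(1,3)] block_sum_diag_blocks[OF m(2,4)]
      fst_conv snd_conv
    by (rule bexI[OF _ d]) (simp add: block_mtx_star diag_blocks_mult[OF sv sw v(1) w(1)]
      diag_blocks_mult[OF v(1) w(1) sv sw] v w)
qed

text \<open>
  The flip, cut down by \<open>p\<close> and \<open>q\<close>, is the partial isometry.
\<close>

lemma mvn_comm:
  assumes p: "(k, p) \<in> projections A" and q: "(l, q) \<in> projections A"
  shows "mvn_equiv A (block_sum A (k, p) (l, q)) (block_sum A (l, q) (k, p))"
proof -
  note p = projectionsD[OF p] and q = projectionsD[OF q]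
  let ?z = "mtx_zero A"
  have v: "block_mtx l k ?z q p ?z \<in> mats A (l + k) (k + l)" using p q by auto
  have 1: "mtx_mult A (l + k) (block_mtx k l ?z p q ?z) (block_mtx l k ?z q p ?z)
      = diag_blocks k k p q"
    by (subst block_mtx_mult[where k' = l and l' = l])
       (use p q mtx_add_zero_left[OF p(1)] mtx_add_zero_right[OF q(1)]
         in \<open>auto simp: mtx_mult_zero_left[OF p(1)] mtx_mult_zero_right[OF p(1)] mtx_mult_zero_left[OF q(1)] mtx_mult_zero_right[OF q(1)] mtx_mult_zero_left[OF mtx_zero_closed] mtx_add_zero_left[OF mtx_zero_closed]\<close>)
  have 2: "mtx_mult A (k + l) (block_mtx l k ?z q p ?z) (block_mtx k l ?z p q ?z)
      = diag_blocks l l q p"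
    by (subst block_mtx_mult[where k' = k and l' = k])
       (use p q mtx_add_zero_left[OF q(1)] mtx_add_zero_right[OF p(1)]
         in \<open>auto simp: mtx_mult_zero_left[OF p(1)] mtx_mult_zero_right[OF p(1)] mtx_mult_zero_left[OF q(1)] mtx_mult_zero_right[OF q(1)] mtx_mult_zero_left[OF mtx_zero_closed] mtx_add_zero_left[OF mtx_zero_closed]\<close>)
  show ?thesis
    unfolding mvn_equiv_def block_sum_diag_blocks[OF p(1) q(1)] block_sum_diag_blocks[OF q(1) p(1)]
      fst_conv snd_conv
    by (rule bexI[OF _ v]) (simp add: block_mtx_star p(2) q(2) 1 2)
qed

text \<open>
  The projections equivalent to a given one form a relatively open set of parameters, and the
  interval is connected.
\<close>

lemma projection_path:
  assumes w: "\<And>t. t \<in> {0..1::real} \<Longrightarrow> (k, w t) \<in> projections A"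
    and cont: "\<And>t i j. t \<in> {0..1} \<Longrightarrow> tends (at t within {0..1}) (\<lambda>t. w t i j) (w t i j)"
  shows "mvn_equiv A (k, w 0) (k, w 1)"
proof -
  interpret M: unital_cstar_algebra "matalg A k" by (rule unital_cstar_algebra_matalg)
  have close: "mvn_equiv A (k, p) (k, q)" if p: "(k, p) \<in> projections A"
    and q: "(k, q) \<in> projections A"
    and d: "nrm (matalg A k) (p \<ominus>\<^bsub>matalg A k\<^esub> q) < 1" for p q
    using M.close_projections[OF _ _ _ _ _ _ d] p q
    by (auto simp: matalg_def mvn_equiv_def projections_def)
  define R where "R s t \<longleftrightarrow> mvn_equiv A (k, w s) (k, w t) \<and> s \<in> {0..1} \<and> t \<in> {0..1}" for s t
  have "R 0 1"
  proof (rule connected_equivalence_relation[of "{0..1::real}"])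
    show "connected {0..1::real}" by simp
    show "R x y \<Longrightarrow> R y x" for x y unfolding R_def using mvn_sym by blast
    show "R x y \<Longrightarrow> R y z \<Longrightarrow> R x z" for x y z unfolding R_def using mvn_trans w by blast
    fix t :: real assume t: "t \<in> {0..1}"
    have "((\<lambda>s. \<Sum>i<k. \<Sum>j<k. nrm A (w s i j \<ominus> w t i j)) \<longlongrightarrow> (\<Sum>i<k. \<Sum>j<k. 0)) (at t within {0..1})"
      using cont[OF t] unfolding tends_def by (intro tendsto_sum) auto
    then have "\<forall>\<^sub>F s in at t within {0..1}. (\<Sum>i<k. \<Sum>j<k. nrm A (w s i j \<ominus> w t i j)) < 1"
      by (rule order_tendstoD) simp
    then obtain d where d: "d > 0" "\<And>s. s \<in> {0..1} \<Longrightarrow> s \<noteq> t \<Longrightarrow> dist s t < d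
        \<Longrightarrow> (\<Sum>i<k. \<Sum>j<k. nrm A (w s i j \<ominus> w t i j)) < 1"
      unfolding eventually_at by blast
    show "\<exists>T. openin (top_of_set {0..1}) T \<and> t \<in> T \<and> (\<forall>x\<in>T. R t x)"
    proof (intro exI[of _ "{0..1} \<inter> ball t d"] conjI ballI)
      show "openin (top_of_set {0..1}) ({0..1} \<inter> ball t d)" by (simp add: openin_open_Int)
      show "t \<in> {0..1} \<inter> ball t d" using t d by simp
      fix s assume s: "s \<in> {0..1} \<inter> ball t d"
      show "R t s"
      proof (cases "s = t")
        case True then show ?thesis using t mvn_refl w by (simp add: R_def)
      next
        case False
        then have "(\<Sum>i<k. \<Sum>j<k. nrm A (w s i j \<ominus> w t i j)) < 1" using d s
          by (auto simp: dist_commute)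
        then have "nrm (matalg A k) (w s \<ominus>\<^bsub>matalg A k\<^esub> w t) < 1"
          using matalg_diff_le_sum[of "w s" k "w t"] projectionsD(1)[OF w] s t by auto
        then have "mvn_equiv A (k, w s) (k, w t)" using close w s t by auto
        then show ?thesis using mvn_sym s t by (auto simp: R_def)
      qed
    qed
  qed auto
  then show ?thesis by (simp add: R_def)
qed

definition mvn :: "'a sqmtx \<Rightarrow> 'a sqmtx \<Rightarrow> bool" where
  "mvn p q \<longleftrightarrow> p \<in> projections A \<and> q \<in> projections A \<and> mvn_equiv A p q"

lemma mvn_congruence: "comm_congruence (projections A) (block_sum A) mvn"
proof
  show "mvn x z" if "mvn x y" "mvn y z" for x y z
    using that mvn_trans[of "fst x" "snd x" "fst y" "snd y" "fst z" "snd z"] by (auto simp: mvn_def)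
  show "mvn (block_sum A x x') (block_sum A y y')" if "mvn x y" "mvn x' y'" for x y x' y'
    using that mvn_block_sum[of "fst x" "snd x" "fst y" "snd y" "fst x'" "snd x'" "fst y'" "snd y'"]
     projectionsD(1)[of "fst x" "snd x"] projectionsD(1)[of "fst y" "snd y"]
     projectionsD(1)[of "fst x'" "snd x'"] projectionsD(1)[of "fst y'" "snd y'"]
    by (auto simp: mvn_def block_sum_projections)
  show "mvn (block_sum A x y) (block_sum A y x)" if "x \<in> projections A" "y \<in> projections A" for x y
    using that mvn_comm[of "fst x" "snd x" "fst y"
      "snd y"] by (auto simp: mvn_def block_sum_projections)
qed (auto simp: mvn_def block_sum_projections mvn_refl mvn_sym block_sum_assoc)

sublocale K0: comm_congruence "projections A" "block_sum A" mvn
  by (rule mvn_congruence)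

lemma K0_rel_eq: "K0_rel A = K0.grel"
  unfolding K0_rel_def K0.grel_def K0.stably_def mvn_def by (auto simp: block_sum_projections)

end

section \<open>Unitaries\<close>

context unital_cstar_algebra
begin

definition unitary :: "'a \<Rightarrow> bool" where
  "unitary u \<longleftrightarrow> u \<in> carrier A \<and> star A u \<otimes> u = \<one> \<and> u \<otimes> star A u = \<one>"

text \<open>
  Connected by a path of unitaries. Paths are multiplied pointwise, which already gives symmetry and
  transitivity; no path is ever concatenated.
\<close>

definition path_joined :: "'a \<Rightarrow> 'a \<Rightarrow> bool" where
  "path_joined u v
      \<longleftrightarrow> (\<exists>w :: real \<Rightarrow> 'a. (\<forall>t\<in>{0..1}. unitary (w t) \<and> tends (at t within {0..1}) w (w t)) \<and> w 0 = u
    \<and> w 1 = v)"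

lemma unitaryD [simp]: "unitary u \<Longrightarrow> u \<in> carrier A" "unitary u \<Longrightarrow> star A u \<otimes> u = \<one>"
  "unitary u \<Longrightarrow> u \<otimes> star A u = \<one>"
  by (auto simp: unitary_def)

lemma unitary_one [simp]: "unitary \<one>"
  unfolding unitary_def by simp

lemma unitary_star [simp]: "unitary u \<Longrightarrow> unitary (star A u)"
  unfolding unitary_def by simp

lemma unitary_mult [simp]: assumes "unitary u" "unitary v" shows "unitary (u \<otimes> v)"
proof -
  have c: "u \<in> carrier A" "v \<in> carrier A" using assms by auto
  have "star A (u \<otimes> v) \<otimes> (u \<otimes> v) = star A v \<otimes> (star A u \<otimes> u) \<otimes> v" using c
    by (simp add: star_mult m_assoc)
  moreover have "(u \<otimes> v) \<otimes> star A (u \<otimes> v) = u \<otimes> (v \<otimes> star A v) \<otimes> star A u" using c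
    by (simp add: star_mult m_assoc)
  ultimately show ?thesis unfolding unitary_def using assms c by simp
qed

lemma path_joinedI:
  assumes "\<And>t. t \<in> {0..1::real} \<Longrightarrow> unitary (w t)"
    "\<And>t. t \<in> {0..1} \<Longrightarrow> tends (at t within {0..1}) w (w t)" "w 0 = u" "w 1 = v"
  shows "path_joined u v"
  using assms unfolding path_joined_def by blast

lemma path_joinedE:
  assumes "path_joined u v"
  obtains w where "\<And>t. t \<in> {0..1::real} \<Longrightarrow> unitary (w t)"
    "\<And>t. t \<in> {0..1} \<Longrightarrow> tends (at t within {0..1}) w (w t)" "w 0 = u" "w 1 = v"
  using assms unfolding path_joined_def by blast

lemma path_joined_unitary: assumes "path_joined u v" shows "unitary u" "unitary v"
proof -
  from assms obtain w where w: "\<And>t. t \<in> {0..1::real} \<Longrightarrow> unitary (w t)" "w 0 = u" "w 1 = v"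
    unfolding path_joined_def by blast
  then show "unitary u" "unitary v" using w(1)[of 0] w(1)[of 1] by auto
qed

lemma path_joined_refl [simp]: "unitary u \<Longrightarrow> path_joined u u"
  by (rule path_joinedI[of "\<lambda>_. u"]) (auto intro: tends_const)

lemma path_joined_mult: assumes "path_joined u v" "path_joined u' v'"
  shows "path_joined (u \<otimes> u') (v \<otimes> v')"
proof -
  obtain w where w: "\<And>t. t \<in> {0..1::real} \<Longrightarrow> unitary (w t)"
    "\<And>t. t \<in> {0..1} \<Longrightarrow> tends (at t within {0..1}) w (w t)" "w 0 = u" "w 1 = v"
    using path_joinedE assms(1) by blast
  obtain w' where w': "\<And>t. t \<in> {0..1::real} \<Longrightarrow> unitary (w' t)"
    "\<And>t. t \<in> {0..1} \<Longrightarrow> tends (at t within {0..1}) w' (w' t)" "w' 0 = u'" "w' 1 = v'"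
    using path_joinedE assms(2) by blast
  show ?thesis by (rule path_joinedI[of "\<lambda>t. w t \<otimes> w' t"]) (use w w' in \<open>auto intro: tends_mult\<close>)
qed

lemma path_joined_star: assumes "path_joined u v" shows "path_joined (star A u) (star A v)"
proof -
  obtain w where w: "\<And>t. t \<in> {0..1::real} \<Longrightarrow> unitary (w t)"
    "\<And>t. t \<in> {0..1} \<Longrightarrow> tends (at t within {0..1}) w (w t)" "w 0 = u" "w 1 = v"
    using path_joinedE assms(1) by blast
  show ?thesis by (rule path_joinedI[of "\<lambda>t. star A (w t)"]) (use w in \<open>auto intro: tends_star\<close>)
qed

text \<open>
  If \<open>w\<close> runs from \<open>u\<close> to \<open>v\<close> then \<open>u w* v\<close> runs from \<open>v\<close> to \<open>u\<close>.
\<close>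

lemma path_joined_sym: assumes "path_joined u v" shows "path_joined v u"
proof -
  have uv: "unitary u" "unitary v" using path_joined_unitary assms by auto
  have "path_joined (u \<otimes> star A u \<otimes> v) (u \<otimes> star A v \<otimes> v)"
    using assms uv by (intro path_joined_mult path_joined_star path_joined_refl)
  then show ?thesis using uv by (simp add: m_assoc)
qed

text \<open>
  If \<open>w\<close> runs from \<open>u\<close> to \<open>v\<close> and \<open>z\<close> from \<open>v\<close> to \<open>x\<close> then \<open>w v* z\<close> runs from \<open>u\<close> to \<open>x\<close>.
\<close>

lemma path_joined_trans: assumes "path_joined u v" "path_joined v x" shows "path_joined u x"
proof -
  have uv: "unitary u" "unitary v" "unitary x" using path_joined_unitary assms by auto
  have "path_joined (u \<otimes> star A v \<otimes> v) (v \<otimes> star A v \<otimes> x)"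
    using assms uv by (intro path_joined_mult path_joined_star path_joined_refl) auto
  then show ?thesis using uv by (simp add: m_assoc)
qed

text \<open>
  If \<open>J\<close> is skewadjoint with \<open>J\<^sup>2 = -1\<close>, this is the path \<open>exp (\<pi> t J / 2)\<close> of unitaries from \<open>1\<close> to \<open>J\<close>.
  It is stated for an abstract \<open>J\<close> so that it serves rotations of blocks of any size.
\<close>

definition rot :: "'a \<Rightarrow> real \<Rightarrow> 'a" where
  "rot J t = complex_of_real (cos (pi / 2 * t)) \<odot> \<one> \<oplus> complex_of_real (sin (pi / 2 * t)) \<odot> J"

lemma rot_0: "J \<in> carrier A \<Longrightarrow> rot J 0 = \<one>"
  by (simp add: rot_def)

lemma rot_1: "J \<in> carrier A \<Longrightarrow> rot J 1 = J"
  by (simp add: rot_def)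

lemma rot_tends: "J \<in> carrier A \<Longrightarrow> tends (at t within S) (rot J) (rot J t)"
  unfolding rot_def by (intro tends_add tends_smult tends_const tendsto_intros) auto

lemma rot_unitary:
  assumes J: "J \<in> carrier A" "star A J = \<ominus> J" "J \<otimes> J = \<ominus> \<one>" shows "unitary (rot J t)"
proof -
  define c s where "c = complex_of_real (cos (pi / 2 * t))"
    and "s = complex_of_real (sin (pi / 2 * t))"
  have cs: "c * c + s * s = 1" unfolding c_def s_def
    by (metis of_real_1 of_real_add of_real_mult power2_eq_square sin_cos_squared_add2)
  have r: "rot J t = c \<odot> \<one> \<oplus> s \<odot> J" by (simp add: rot_def c_def s_def)
  have sr: "star A (rot J t) = c \<odot> \<one> \<ominus> s \<odot> J"
    unfolding r using J by (simp add: star_add star_smult sc_minus_r a_minus_def)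
      (simp add: c_def s_def)
  have sJ: "(s \<odot> J) \<otimes> (s \<odot> J) = \<ominus> ((s * s) \<odot> \<one>)" using J by (simp add: sc_mult sc_assoc sc_minus_r)
  have cc: "(c \<odot> \<one>) \<otimes> (c \<odot> \<one>) = (c * c) \<odot> \<one>" by (simp add: sc_mult sc_assoc)
  have cJ: "(c \<odot> \<one>) \<otimes> (s \<odot> J) = (s \<odot> J) \<otimes> (c \<odot> \<one>)" using J
    by (simp add: sc_mult sc_assoc mult.commute)
  have o: "(c * c) \<odot> \<one> \<oplus> (s * s) \<odot> \<one> = \<one>" using cs by (simp flip: sc_add_l)
  define X Y where "X = c \<odot> \<one>" and "Y = s \<odot> J"
  have XY: "X \<in> carrier A" "Y \<in> carrier A" "X \<otimes> Y = Y \<otimes> X" "X \<otimes> X \<ominus> Y \<otimes> Y = \<one>"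
    using J o cJ by (auto simp: X_def Y_def cc sJ a_minus_def)
  have "(X \<ominus> Y) \<otimes> (X \<oplus> Y) = (X \<otimes> X \<ominus> Y \<otimes> Y) \<oplus> (X \<otimes> Y \<ominus> Y \<otimes> X)" using XY(1,2) by algebra
  moreover have "(X \<oplus> Y) \<otimes> (X \<ominus> Y) = (X \<otimes> X \<ominus> Y \<otimes> Y) \<oplus> (Y \<otimes> X \<ominus> X \<otimes> Y)" using XY(1,2) by algebra
  ultimately show ?thesis unfolding unitary_def sr unfolding r
    unfolding X_def[symmetric] Y_def[symmetric] using XY by (simp add: a_minus_def r_neg)
qed

lemma path_joined_rot:
  assumes J: "J \<in> carrier A" "star A J = \<ominus> J" "J \<otimes> J = \<ominus> \<one>"
    and a: "unitary a" and b: "unitary b" and Ja: "J \<otimes> a = b \<otimes> J"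
  shows "path_joined a b"
proof -
  have u: "path_joined \<one> J"
    by (rule path_joinedI[of "rot J"]) (use rot_unitary[OF J] rot_tends J rot_0 rot_1 in auto)
  then have uJ: "unitary J" using path_joined_unitary by blast
  have "path_joined (\<one> \<otimes> a \<otimes> star A \<one>) (J \<otimes> a \<otimes> star A J)"
    using u a by (intro path_joined_mult path_joined_star path_joined_refl)
  moreover have "J \<otimes> a \<otimes> star A J = b" unfolding Ja using uJ b by (simp add: m_assoc del: J)
  ultimately show ?thesis using a by simp
qed

text \<open>
  This reconciles the two ways of looking at paths of matrices: K-theory is defined with entrywise
  continuity, while multiplying paths is easiest in norm.
\<close>

lemma matalg_tends:
  assumes "\<forall>\<^sub>F t in F. y t \<in> mats A k k" "L \<in> mats A k k"
  shows "unital_cstar_algebra.tends (matalg A k) F y L \<longleftrightarrow> (\<forall>i j. tends F (\<lambda>t. y t i j) (L i j))"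
proof -
  interpret M: unital_cstar_algebra "matalg A k" by (rule unital_cstar_algebra_matalg)
  have c: "carrier (matalg A k) = mats A k k" by (simp add: matalg_def)
  show ?thesis
  proof (intro iffI allI)
    fix i j assume t: "M.tends F y L"
    show "tends F (\<lambda>t. y t i j) (L i j)"
    proof (rule tendsI)
      show "\<forall>\<^sub>F t in F. y t i j \<in> carrier A" using assms(1) by (rule eventually_mono) simp
      show "L i j \<in> carrier A" using assms(2) by simp
      show "\<forall>\<^sub>F t in F. nrm A (y t i j \<ominus> L i j) \<le> nrm (matalg A k) (y t \<ominus>\<^bsub>matalg A k\<^esub> L)"
        using assms(1) by (rule eventually_mono) (use assms(2) in \<open>simp add: matalg_entry_diff\<close>)
    qed (use t in \<open>simp add: M.tends_def\<close>)
  next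
    assume t: "\<forall>i j. tends F (\<lambda>t. y t i j) (L i j)"
    have "((\<lambda>t. \<Sum>i<k. \<Sum>j<k. nrm A (y t i j \<ominus> L i j)) \<longlongrightarrow> (\<Sum>i<k. \<Sum>j<k. 0)) F"
      using t unfolding tends_def by (intro tendsto_sum) auto
    then have l: "((\<lambda>t. \<Sum>i<k. \<Sum>j<k. nrm A (y t i j \<ominus> L i j)) \<longlongrightarrow> 0) F" by simp
    show "M.tends F y L"
    proof (rule M.tendsI[OF _ _ _ l])
      show "\<forall>\<^sub>F t in F. nrm (matalg A k) (y t \<ominus>\<^bsub>matalg A k\<^esub> L)
          \<le> (\<Sum>i<k. \<Sum>j<k. nrm A (y t i j \<ominus> L i j))"
        using assms(1) by (rule eventually_mono) (use assms(2) in \<open>simp add: matalg_diff_le_sum\<close>)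
    qed (use assms c in auto)
  qed
qed

lemma matalg_simps [simp]:
  "carrier (matalg A k) = mats A k k" "mult (matalg A k) = mtx_mult A k"
    "one (matalg A k) = mtx_one A k"
  "zero (matalg A k) = mtx_zero A" "add (matalg A k) = mtx_add A" "smult (matalg A k) = mtx_smult A"
  "star (matalg A k) = mtx_star A" "nrm (matalg A k) = mtx_norm A k"
  by (simp_all add: matalg_def)

abbreviation mtx_unitary where "mtx_unitary k \<equiv> unital_cstar_algebra.unitary (matalg A k)"
abbreviation mtx_path_joined where "mtx_path_joined k \<equiv> unital_cstar_algebra.path_joined
    (matalg A k)"

lemmas M_unitary_def = unital_cstar_algebra.unitary_def[OF unital_cstar_algebra_matalg, simplified]

lemma unitaries_iff: "(k, u) \<in> unitaries A \<longleftrightarrow> mtx_unitary k u"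
  by (simp add: unitaries_def M_unitary_def)

lemma unitary_homotopic_iff: "unitary_homotopic A (k, u) (l, v) \<longleftrightarrow> k = l \<and> mtx_path_joined k u v"
proof -
  interpret M: unital_cstar_algebra "matalg A k" by (rule unital_cstar_algebra_matalg)
  have "(\<forall>t\<in>{0..1}. mtx_unitary k (w t)) \<and>
        (\<forall>i j. continuous_map (top_of_set {0..1}) (ctopology A) (\<lambda>t. w t i j)) \<longleftrightarrow>
     (\<forall>t\<in>{0..1}. mtx_unitary k (w t) \<and> M.tends (at t within {0..1}) w (w t))" for w :: "real \<Rightarrow> 'a
       mtx"
  proof (cases "\<forall>t\<in>{0..1}. mtx_unitary k (w t)")
    case True
    then have m: "t \<in> {0..1} \<Longrightarrow> w t \<in> mats A k k" for t using M.unitaryD(1) by auto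
    have ev: "\<forall>\<^sub>F s in at t within {0..1}. w s \<in> mats A k k" for t :: real
      unfolding eventually_at_filter by (rule always_eventually) (use m in auto)
    have "M.tends (at t within {0..1}) w (w t)
        \<longleftrightarrow> (\<forall>i j. tends (at t within {0..1}) (\<lambda>t. w t i j) (w t i j))"
      if "t \<in> {0..1}" for t using matalg_tends[OF ev m] that by blast
    moreover have "w t i j \<in> carrier A" if "t \<in> {0..1}" for t i j using matsD[OF m[OF that]] .
    ultimately show ?thesis using True unfolding continuous_map_tends by auto
  qed auto
  then show ?thesis
    unfolding unitary_homotopic_def M.path_joined_def fst_conv snd_conv unitaries_iff by blast
qed

lemma diag_blocks_unitary:
  assumes "mtx_unitary k u" "mtx_unitary l v" shows "mtx_unitary (k + l) (diag_blocks k k u v)"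
proof -
  have m: "u \<in> mats A k k" "v \<in> mats A l l" using assms by (auto simp: M_unitary_def)
  note s = mtx_star_closed[OF m(1)] mtx_star_closed[OF m(2)]
  show ?thesis using assms m unfolding M_unitary_def
    by (simp add: block_mtx_star diag_blocks_mult[OF m s] diag_blocks_mult[OF s m] block_mtx_one)
qed

lemma diag_blocks_path_joined:
  assumes "mtx_path_joined k u v" "mtx_path_joined l u' v'"
    shows "mtx_path_joined (k + l) (diag_blocks k k u u') (diag_blocks k k v v')"
proof -
  interpret M: unital_cstar_algebra "matalg A k" by (rule unital_cstar_algebra_matalg)
  interpret N: unital_cstar_algebra "matalg A l" by (rule unital_cstar_algebra_matalg)
  interpret S: unital_cstar_algebra "matalg A (k + l)" by (rule unital_cstar_algebra_matalg)
  obtain w where w: "\<And>t. t \<in> {0..1::real} \<Longrightarrow> M.unitary (w t)"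
    "\<And>t. t \<in> {0..1} \<Longrightarrow> M.tends (at t within {0..1}) w (w t)" "w 0 = u" "w 1 = v"
    using M.path_joinedE assms(1) by blast
  obtain x where x: "\<And>t. t \<in> {0..1::real} \<Longrightarrow> N.unitary (x t)"
    "\<And>t. t \<in> {0..1} \<Longrightarrow> N.tends (at t within {0..1}) x (x t)" "x 0 = u'" "x 1 = v'"
    using N.path_joinedE assms(2) by blast
  have wm: "w t \<in> mats A k k" and xm: "x t \<in> mats A l l" if "t \<in> {0..1}" for t
    using M.unitaryD(1)[OF w(1)[OF that]] N.unitaryD(1)[OF x(1)[OF that]] by auto
  show ?thesis
  proof (rule S.path_joinedI[of "\<lambda>t. diag_blocks k k (w t) (x t)"])
    fix t :: real assume t: "t \<in> {0..1}"
    show "S.unitary (diag_blocks k k (w t) (x t))" using diag_blocks_unitary w x t by blast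
    have ev: "\<forall>\<^sub>F s in at t within {0..1}. s \<in> {0..1}"
      unfolding eventually_at_filter by (rule always_eventually) auto
    have wv: "\<forall>\<^sub>F s in at t within {0..1}. w s \<in> mats A k k"
      and xv: "\<forall>\<^sub>F s in at t within {0..1}. x s \<in> mats A l l"
      and ev': "\<forall>\<^sub>F s in at t within {0..1}. diag_blocks k k (w s) (x s) \<in> mats A (k + l) (k + l)"
      using ev by (auto elim!: eventually_mono simp: wm xm)
    have dm: "diag_blocks k k (w t) (x t) \<in> mats A (k + l) (k + l)" using wm xm t by auto
    show "S.tends (at t within {0..1}) (\<lambda>t. diag_blocks k k (w t) (x t))
        (diag_blocks k k (w t) (x t))"
      using w(2)[OF t, unfolded matalg_tends[OF wv wm[OF t]]]
        x(2)[OF t, unfolded matalg_tends[OF xv xm[OF t]]]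
      unfolding matalg_tends[OF ev' dm] by (auto simp: block_mtx_def mtx_zero_def tends_const)
  qed (use w x in auto)
qed

lemma mtx_neg_simps:
  assumes "x \<in> mats A k l"
  shows "mtx_smult A (-1) (mtx_smult A (-1) x) = x"
  using mtx_smult_smult[OF assms, of "-1" "-1"] mtx_smult_one_left[OF assms] by simp

definition quarter_turn :: "nat \<Rightarrow> 'a mtx" where
  "quarter_turn k = block_mtx k k (mtx_zero A) (mtx_smult A (-1) (mtx_one A k)) (mtx_one A k)
      (mtx_zero A)"

lemma quarter_turn_closed [simp]: "quarter_turn k \<in> mats A (k + k) (k + k)"
  by (auto simp: quarter_turn_def)

lemma matalg_neg: assumes "x \<in> mats A k k" shows "\<ominus>\<^bsub>matalg A k\<^esub> x = mtx_smult A (-1) x"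
  using assms by (simp add: matalg_minus mtx_smult_def sc_minus_l)

lemma mtx_add_0: "mtx_add A (mtx_zero A) (mtx_zero A) = mtx_zero A"
  by (rule mtx_add_zero_left[OF mtx_zero_closed])

lemma mtx_mult_00: "mtx_mult A n (mtx_zero A) (mtx_zero A) = mtx_zero A"
  by (rule mtx_mult_zero_left[OF mtx_zero_closed])

lemma quarter_turn_star: "mtx_star A (quarter_turn k) = mtx_smult A (-1) (quarter_turn k)"
  unfolding quarter_turn_def block_mtx_star block_mtx_smult
  by (simp add: mtx_star_smult[OF mtx_one_closed] mtx_neg_simps[OF mtx_one_closed])

lemma quarter_turn_mult:
  assumes m: "a \<in> mats A k k" "b \<in> mats A k k"
  shows "mtx_mult A (k + k) (quarter_turn k) (diag_blocks k k a b)
      = mtx_mult A (k + k) (diag_blocks k k b a) (quarter_turn k)"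
  unfolding quarter_turn_def using m
  by (subst (1 2) block_mtx_mult[where k' = k and l' = k])
     (auto simp: mtx_mult_zero_left[OF m(1)] mtx_mult_zero_left[OF m(2)]
       mtx_mult_zero_right[OF m(1)] mtx_mult_zero_right[OF m(2)]
       mtx_add_zero_left[OF m(1)] mtx_add_zero_right[OF m(1)]
         mtx_add_zero_left[OF mtx_smult_closed[OF m(2)]]
         mtx_add_zero_right[OF mtx_smult_closed[OF m(2)]]
       mtx_smult_left[OF mtx_one_closed m(2)] mtx_smult_right[OF m(2) mtx_one_closed] mtx_add_0
         mtx_mult_00
       mtx_mult_zero_left[OF mtx_one_closed]
         mtx_mult_zero_right[OF mtx_smult_closed[OF mtx_one_closed]]
       mtx_mult_zero_right[OF mtx_one_closed]
         mtx_mult_zero_left[OF mtx_smult_closed[OF mtx_one_closed]])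

lemma quarter_turn_square: "mtx_mult A (k + k) (quarter_turn k) (quarter_turn k)
    = mtx_smult A (-1) (mtx_one A (k + k))"
  unfolding quarter_turn_def block_mtx_one block_mtx_smult
  by (subst block_mtx_mult[where k' = k and l' = k])
     (auto simp: mtx_mult_zero_left[OF mtx_one_closed]
       mtx_mult_zero_right[OF mtx_smult_closed[OF mtx_one_closed]]
       mtx_mult_zero_right[OF mtx_one_closed]
         mtx_mult_zero_left[OF mtx_smult_closed[OF mtx_one_closed]] mtx_add_0 mtx_mult_00
       mtx_smult_left[OF mtx_one_closed mtx_one_closed]
         mtx_smult_right[OF mtx_one_closed mtx_one_closed]
       mtx_one_left[OF mtx_one_closed]
       mtx_add_zero_left[OF mtx_smult_closed[OF mtx_one_closed]]
         mtx_add_zero_right[OF mtx_smult_closed[OF mtx_one_closed]])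

text \<open>
  Write \<open>w \<oplus> w* = (w \<oplus> 1) (1 \<oplus> w*)\<close>. Rotating the second factor to \<open>w* \<oplus> 1\<close> turns the product
  into \<open>1\<close>.
\<close>

lemma whitehead:
  assumes w: "mtx_unitary k w"
    shows "mtx_path_joined (k + k) (mtx_one A (k + k)) (diag_blocks k k w (mtx_star A w))"
proof -
  interpret M: unital_cstar_algebra "matalg A k" by (rule unital_cstar_algebra_matalg)
  interpret S: unital_cstar_algebra "matalg A (k + k)" by (rule unital_cstar_algebra_matalg)
  have m: "w \<in> mats A k k" "mtx_star A w \<in> mats A k k" using w M.unitaryD(1) by auto
  have sw: "mtx_unitary k (mtx_star A w)" using M.unitary_star[OF w] by simp
  have o: "mtx_unitary k (mtx_one A k)" using M.unitary_one by simp
  have u: "S.unitary (diag_blocks k k (mtx_star A w) (mtx_one A k))"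
    "S.unitary (diag_blocks k k (mtx_one A k) (mtx_star A w))"
     "S.unitary (diag_blocks k k w (mtx_one A k))" using diag_blocks_unitary w sw o by auto
  have "S.path_joined (diag_blocks k k (mtx_star A w) (mtx_one A k)) (diag_blocks k k (mtx_one A k)
      (mtx_star A w))"
    by (rule S.path_joined_rot[of "quarter_turn k"])
       (use u m in \<open>simp_all add: matalg_neg quarter_turn_star quarter_turn_square quarter_turn_mult\<close>)
  then have "S.path_joined (mtx_mult A (k + k) (diag_blocks k k w (mtx_one A k))
      (diag_blocks k k (mtx_star A w) (mtx_one A k)))
     (mtx_mult A (k + k) (diag_blocks k k w (mtx_one A k)) (diag_blocks k k (mtx_one A k)
       (mtx_star A w)))"
    using S.path_joined_mult[OF S.path_joined_refl[OF u(3)]] by simp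
  then show ?thesis
    using w m by (simp add: diag_blocks_mult[OF m(1) mtx_one_closed m(2) mtx_one_closed]
      diag_blocks_mult[OF m(1) mtx_one_closed mtx_one_closed m(2)]
       mtx_one_left[OF m(2)] mtx_one_right[OF m(1)] mtx_one_left[OF mtx_one_closed] M_unitary_def
         block_mtx_one)
qed

subsection \<open>Stable homotopy of unitaries\<close>

definition sq_one :: "nat \<Rightarrow> 'a sqmtx" where "sq_one r = (r, mtx_one A r)"

definition homotopic :: "'a sqmtx \<Rightarrow> 'a sqmtx \<Rightarrow> bool" where
  "homotopic u v \<longleftrightarrow> fst u = fst v \<and> mtx_path_joined (fst u) (snd u) (snd v)"

lemma unitaries_mtx_unitary: "u \<in> unitaries A \<longleftrightarrow> mtx_unitary (fst u) (snd u)"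
  using unitaries_iff[of "fst u" "snd u"] by simp

lemma homotopic_iff: "unitary_homotopic A u v \<longleftrightarrow> homotopic u v"
  using unitary_homotopic_iff[of "fst u" "snd u" "fst v" "snd v"] by (simp add: homotopic_def)

lemma sq_one_unitary [simp]: "sq_one r \<in> unitaries A"
  using unital_cstar_algebra.unitary_one[OF unital_cstar_algebra_matalg]
    by (simp add: unitaries_mtx_unitary sq_one_def)

lemma mtx_unitary_mats: "mtx_unitary k u \<Longrightarrow> u \<in> mats A k k"
  by (simp add: M_unitary_def)

lemma block_sum_unitary [simp]:
  assumes "u \<in> unitaries A" "v \<in> unitaries A" shows "block_sum A u v \<in> unitaries A"
  using assms diag_blocks_unitary mtx_unitary_mats
  by (cases u; cases v; simp add: unitaries_mtx_unitary block_sum_diag_blocks)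

lemma homotopic_unitary: "homotopic u v \<Longrightarrow> u \<in> unitaries A \<and> v \<in> unitaries A"
  using unital_cstar_algebra.path_joined_unitary[OF unital_cstar_algebra_matalg]
  by (auto simp: homotopic_def unitaries_mtx_unitary)

lemma homotopic_refl: "u \<in> unitaries A \<Longrightarrow> homotopic u u"
  using unital_cstar_algebra.path_joined_refl[OF unital_cstar_algebra_matalg]
    by (auto simp: homotopic_def unitaries_mtx_unitary)

lemma homotopic_sym: "homotopic u v \<Longrightarrow> homotopic v u"
  using unital_cstar_algebra.path_joined_sym[OF unital_cstar_algebra_matalg]
    by (auto simp: homotopic_def)

lemma homotopic_trans: "homotopic u v \<Longrightarrow> homotopic v w \<Longrightarrow> homotopic u w"
  using unital_cstar_algebra.path_joined_trans[OF unital_cstar_algebra_matalg]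
    by (auto simp: homotopic_def)

lemma homotopic_block_sum: assumes "homotopic u v" "homotopic u' v'"
  shows "homotopic (block_sum A u u') (block_sum A v v')"
proof -
  have m: "snd u \<in> mats A (fst u) (fst u)" "snd u' \<in> mats A (fst u') (fst u')"
     "snd v \<in> mats A (fst v) (fst v)" "snd v' \<in> mats A (fst v') (fst v')"
    using homotopic_unitary assms mtx_unitary_mats by (auto simp: unitaries_mtx_unitary)
  show ?thesis using m diag_blocks_path_joined[of "fst u" "snd u" "snd v" "fst u'" "snd u'"
    "snd v'"] assms
    by (cases u; cases v; cases u'; cases v'; simp add: homotopic_def block_sum_diag_blocks)
qed

lemma sq_one_add: "block_sum A (sq_one r) (sq_one s) = sq_one (r + s)"
  unfolding sq_one_def using block_sum_diag_blocks[OF mtx_one_closed mtx_one_closed, of r s]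
    by (simp add: block_mtx_one)

text \<open>
  The relation defining \<^const>\<open>K1\<close>, as a predicate, so that the results on congruences apply.
\<close>

definition stably_homotopic :: "'a sqmtx \<Rightarrow> 'a sqmtx \<Rightarrow> bool" where
  "stably_homotopic u v \<longleftrightarrow> u \<in> unitaries A \<and> v \<in> unitaries A
      \<and> (\<exists>r s. homotopic (block_sum A u (sq_one r)) (block_sum A v (sq_one s)))"

lemma K1_rel_eq: "K1_rel A = {(u, v). stably_homotopic u v}"
  unfolding K1_rel_def stably_homotopic_def homotopic_iff sq_one_def ..

lemma homotopic_stably_homotopic: "homotopic u v \<Longrightarrow> stably_homotopic u v"
  unfolding stably_homotopic_def
    using homotopic_unitary homotopic_block_sum homotopic_refl sq_one_unitary by blast

lemma stably_homotopic_sq_one: assumes "u \<in> unitaries A"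
  shows "stably_homotopic (block_sum A u (sq_one r)) u"
  unfolding stably_homotopic_def
proof (intro conjI exI)
  show "homotopic (block_sum A (block_sum A u (sq_one r)) (sq_one 0)) (block_sum A u (sq_one r))"
    unfolding block_sum_assoc sq_one_add using assms by (simp add: homotopic_refl)
qed (use assms in auto)

lemma stably_homotopic_refl: "u \<in> unitaries A \<Longrightarrow> stably_homotopic u u"
  using homotopic_stably_homotopic homotopic_refl by blast

lemma stably_homotopic_sym: "stably_homotopic u v \<Longrightarrow> stably_homotopic v u"
  unfolding stably_homotopic_def using homotopic_sym by blast

lemma stably_homotopic_trans: assumes "stably_homotopic u v" "stably_homotopic v w"
  shows "stably_homotopic u w"
proof -
  obtain r s where 1: "homotopic (block_sum A u (sq_one r)) (block_sum A v (sq_one s))" using assms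
    by (auto simp: stably_homotopic_def)
  obtain r' s' where 2: "homotopic (block_sum A v (sq_one r')) (block_sum A w (sq_one s'))"
    using assms by (auto simp: stably_homotopic_def)
  have "homotopic (block_sum A (block_sum A u (sq_one r)) (sq_one r'))
      (block_sum A (block_sum A v (sq_one s)) (sq_one r'))"
    by (intro homotopic_block_sum 1 homotopic_refl sq_one_unitary)
  moreover have "homotopic (block_sum A (block_sum A v (sq_one r')) (sq_one s))
      (block_sum A (block_sum A w (sq_one s')) (sq_one s))"
    by (intro homotopic_block_sum 2 homotopic_refl sq_one_unitary)
  ultimately have "homotopic (block_sum A u (sq_one (r + r'))) (block_sum A w (sq_one (s' + s)))"
    unfolding block_sum_assoc sq_one_add by (metis homotopic_trans add.commute)
  then show ?thesis using assms unfolding stably_homotopic_def by blast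
qed

text \<open>
  Stably, \<open>w \<oplus> w*\<close> is connected to \<open>1\<close>; conjugate \<open>u \<oplus> 1\<close> by the path. The hypothesis on \<open>v\<close> says
  \<open>v = w u w*\<close>.
\<close>

lemma stably_homotopic_conj:
  assumes u: "mtx_unitary k u" and w: "mtx_unitary k w"
    and v: "v \<in> mats A k k" "mtx_mult A k w u = mtx_mult A k v w"
  shows "stably_homotopic (k, u) (k, v)"
proof -
  interpret M: unital_cstar_algebra "matalg A k" by (rule unital_cstar_algebra_matalg)
  interpret S: unital_cstar_algebra "matalg A (k + k)" by (rule unital_cstar_algebra_matalg)
  have m: "u \<in> mats A k k" "w \<in> mats A k k" "mtx_star A w \<in> mats A k k" using w u mtx_unitary_mats
    by auto
  have o: "mtx_unitary k (mtx_one A k)" using M.unitary_one by simp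
  let ?W = "diag_blocks k k w (mtx_star A w)"
  have U: "S.unitary (diag_blocks k k u (mtx_one A k))" by (rule diag_blocks_unitary[OF u o])
  have wh: "S.path_joined (mtx_one A (k + k)) ?W" by (rule whitehead[OF w])
  have vv: "mtx_mult A k (mtx_mult A k w u) (mtx_star A w) = v"
    unfolding v(2) using M.m_assoc[of v w "mtx_star A w"] v m w by (simp add: M_unitary_def)
  have vu: "mtx_unitary k v" using vv M.unitary_mult[OF M.unitary_mult[OF w u] M.unitary_star[OF w]]
    by simp
  have "S.path_joined (mtx_mult A (k + k) (mtx_mult A (k + k) (mtx_one A (k + k))
      (diag_blocks k k u (mtx_one A k))) (mtx_star A (mtx_one A (k + k))))
     (mtx_mult A (k + k) (mtx_mult A (k + k) ?W (diag_blocks k k u (mtx_one A k))) (mtx_star A ?W))"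
    using S.path_joined_mult[OF S.path_joined_mult[OF wh S.path_joined_refl[OF U]]
      S.path_joined_star[OF wh]] by simp
  moreover have "mtx_mult A (k + k) (mtx_mult A (k + k) ?W (diag_blocks k k u (mtx_one A k)))
      (mtx_star A ?W) = diag_blocks k k v (mtx_one A k)"
    unfolding diag_blocks_mult[OF m(2,3,1) mtx_one_closed] mtx_one_right[OF m(3)] block_mtx_star
      mtx_star_star[OF m(2)] mtx_star_zero
      diag_blocks_mult[OF mtx_mult_closed[OF m(2,1)] m(3) m(3) m(2)] vv
    using w by (simp add: M_unitary_def)
  moreover have "diag_blocks k k u (mtx_one A k) \<in> mats A (k + k) (k + k)" using m by auto
  ultimately have "S.path_joined (diag_blocks k k u (mtx_one A k))
      (diag_blocks k k v (mtx_one A k))"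
    by (simp add: mtx_one_left mtx_one_right)
  then have "homotopic (block_sum A (k, u) (sq_one k)) (block_sum A (k, v) (sq_one k))"
    unfolding sq_one_def block_sum_diag_blocks[OF m(1) mtx_one_closed]
      block_sum_diag_blocks[OF v(1) mtx_one_closed] by (simp add: homotopic_def)
  then show ?thesis unfolding stably_homotopic_def using u vu by (auto simp: unitaries_iff)
qed

text \<open>
  The two sums are conjugate by the flip. For blocks of different sizes the flip is not a rotation,
  so it is connected to \<open>1\<close> only stably, by \<open>stably_homotopic_conj\<close>.
\<close>

lemma stably_homotopic_comm:
  assumes u: "u \<in> unitaries A" and v: "v \<in> unitaries A"
    shows "stably_homotopic (block_sum A u v) (block_sum A v u)"
proof -
  obtain k x l y where uv: "u = (k, x)" "v = (l, y)" by (cases u, cases v)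
  have xu: "mtx_unitary k x" and yu: "mtx_unitary l y" using u v uv by (auto simp: unitaries_iff)
  then have x: "x \<in> mats A k k" and y: "y \<in> mats A l l" using mtx_unitary_mats by auto
  let ?z = "mtx_zero A"
  define W where "W = block_mtx l k ?z (mtx_one A l) (mtx_one A k) ?z"
  have W: "W \<in> mats A (l + k) (k + l)" by (auto simp: W_def)
  have sW: "mtx_star A W = block_mtx k l ?z (mtx_one A k) (mtx_one A l) ?z"
    by (simp add: W_def block_mtx_star)
  note zs = mtx_one_left[OF mtx_one_closed] mtx_mult_zero_left[OF mtx_one_closed]
    mtx_mult_zero_right[OF mtx_one_closed] mtx_mult_00 mtx_add_0
    mtx_mult_zero_left[OF x] mtx_mult_zero_right[OF x] mtx_mult_zero_left[OF y]
      mtx_mult_zero_right[OF y]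
    mtx_add_zero_left[OF x] mtx_add_zero_right[OF x] mtx_add_zero_left[OF y]
      mtx_add_zero_right[OF y]
    mtx_add_zero_left[OF mtx_one_closed] mtx_add_zero_right[OF mtx_one_closed]
  have "mtx_mult A (l + k) (mtx_star A W) W = mtx_one A (k + l)"
    unfolding sW unfolding W_def
    by (subst block_mtx_mult[where k' = l and l' = l]) (auto simp: zs block_mtx_one)
  moreover have "mtx_mult A (k + l) W (mtx_star A W) = mtx_one A (l + k)"
    unfolding sW unfolding W_def
    by (subst block_mtx_mult[where k' = k and l' = k]) (auto simp: zs block_mtx_one)
  ultimately have Wu: "mtx_unitary (k + l) W" using W by (simp add: M_unitary_def add.commute)
  have e: "mtx_mult A (k + l) W (diag_blocks k k x y) = mtx_mult A (l + k) (diag_blocks l l y x) W"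
    unfolding W_def using x y
    by (subst (1 2) block_mtx_mult[where k' = k and l' = l]) (auto simp: zs)
  have "stably_homotopic (k + l, diag_blocks k k x y) (k + l, diag_blocks l l y x)"
  proof (rule stably_homotopic_conj[OF diag_blocks_unitary[OF xu yu] Wu])
    show "diag_blocks l l y x \<in> mats A (k + l) (k + l)"
      using block_mtx_closed[OF y mtx_zero_closed mtx_zero_closed x] by (simp add: add.commute)
  qed (use e in \<open>simp add: add.commute\<close>)
  then show ?thesis unfolding uv block_sum_diag_blocks[OF x y] block_sum_diag_blocks[OF y x]
    by (simp add: add.commute)
qed

lemma stably_homotopic_left: assumes "stably_homotopic u v" "x \<in> unitaries A"
  shows "stably_homotopic (block_sum A x u) (block_sum A x v)"
proof -
  obtain r s where 1: "homotopic (block_sum A u (sq_one r)) (block_sum A v (sq_one s))" using assms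
    by (auto simp: stably_homotopic_def)
  have "homotopic (block_sum A x (block_sum A u (sq_one r)))
      (block_sum A x (block_sum A v (sq_one s)))"
    by (intro homotopic_block_sum 1 homotopic_refl assms)
  then show ?thesis using assms unfolding stably_homotopic_def block_sum_assoc by auto
qed

sublocale K1: comm_congruence "unitaries A" "block_sum A" stably_homotopic
proof
  show "stably_homotopic (block_sum A x x') (block_sum A y y')"
    if h: "stably_homotopic x y" "stably_homotopic x' y'" for x y x' y'
  proof -
    have c: "x \<in> unitaries A" "y \<in> unitaries A" "x' \<in> unitaries A" "y' \<in> unitaries A" using h
      by (auto simp: stably_homotopic_def)
    have "stably_homotopic (block_sum A x x') (block_sum A x y')"
      by (rule stably_homotopic_left[OF h(2) c(1)])
    moreover have "stably_homotopic (block_sum A x y') (block_sum A y' x)"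
      by (rule stably_homotopic_comm[OF c(1,4)])
    moreover have "stably_homotopic (block_sum A y' x) (block_sum A y' y)"
      by (rule stably_homotopic_left[OF h(1) c(4)])
    moreover have "stably_homotopic (block_sum A y' y) (block_sum A y y')"
      by (rule stably_homotopic_comm[OF c(4,2)])
    ultimately show ?thesis using stably_homotopic_trans by blast
  qed
qed (auto simp: stably_homotopic_comm block_sum_assoc stably_homotopic_refl stably_homotopic_sym
  intro: stably_homotopic_trans, auto simp: stably_homotopic_def)

text \<open>
  Add \<open>e*\<close>, and use that \<open>e \<oplus> e*\<close> is connected to \<open>1\<close>.
\<close>

lemma stably_homotopic_cancel:
  assumes "stably_homotopic (block_sum A x e) (block_sum A y e)" "x \<in> unitaries A" "y \<in> unitaries A"
    "e \<in> unitaries A"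
  shows "stably_homotopic x y"
proof -
  obtain k w where e: "e = (k, w)" by (cases e)
  have w: "mtx_unitary k w" using assms e by (simp add: unitaries_iff)
  then have wm: "w \<in> mats A k k" "mtx_star A w \<in> mats A k k" using mtx_unitary_mats by auto
  define f where "f = (k, mtx_star A w)"
  have f: "f \<in> unitaries A"
    using unital_cstar_algebra.unitary_star[OF unital_cstar_algebra_matalg w]
      by (simp add: f_def unitaries_iff)
  have "homotopic (sq_one (k + k)) (block_sum A e f)"
    using whitehead[OF w] unfolding e f_def block_sum_diag_blocks[OF wm]
      by (simp add: homotopic_def sq_one_def)
  then have ef: "stably_homotopic (block_sum A e f) (sq_one (k + k))"
    using homotopic_stably_homotopic homotopic_sym by blast
  have *: "stably_homotopic z (block_sum A (block_sum A z e) f)" if z: "z \<in> unitaries A" for z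
    unfolding block_sum_assoc
    using stably_homotopic_trans[OF stably_homotopic_left[OF ef z] stably_homotopic_sq_one[OF z]]
      stably_homotopic_sym by blast
  have "stably_homotopic (block_sum A (block_sum A x e) f) (block_sum A (block_sum A y e) f)"
    by (intro K1.R_cong assms stably_homotopic_refl f)
  then show ?thesis using * assms stably_homotopic_trans stably_homotopic_sym by blast
qed

lemma equiv_K1_rel: "equiv (unitaries A) (K1_rel A)"
  unfolding K1_rel_eq
  by (rule equivI)
    (auto simp: refl_on_def sym_def trans_def stably_homotopic_refl stably_homotopic_sym intro:
    stably_homotopic_trans, auto simp: stably_homotopic_def)

end

section \<open>Functoriality and homotopy invariance\<close>

context cstar_morphism
begin

lemma mtx_map_closed [simp, intro]: "a \<in> mats A k l \<Longrightarrow> mtx_map \<phi> a \<in> mats B k l"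
  by (rule B.matsI) (auto simp: mtx_map_def A.mats_outside)

lemma mtx_map_mult:
  assumes "a \<in> mats A k m" "b \<in> mats A m' l"
  shows "mtx_map \<phi> (mtx_mult A n a b) = mtx_mult B n (mtx_map \<phi> a) (mtx_map \<phi> b)"
  unfolding mtx_map_def mtx_mult_def using assms by (intro ext) (simp add: finsum mult Pi_iff)

lemma mtx_map_star: "a \<in> mats A k l \<Longrightarrow> mtx_map \<phi> (mtx_star A a) = mtx_star B (mtx_map \<phi> a)"
  by (simp add: mtx_map_def mtx_star_def star)

lemma mtx_map_one: "mtx_map \<phi> (mtx_one A k) = mtx_one B k"
  by (auto simp: mtx_map_def mtx_one_def intro!: ext)

lemma sqmtx_map_block_sum: "sqmtx_map \<phi> (block_sum A p q)
    = block_sum B (sqmtx_map \<phi> p) (sqmtx_map \<phi> q)"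
  by (auto simp: sqmtx_map_def block_sum_def mtx_map_def intro!: ext)

lemma sqmtx_map_projections:
  assumes "p \<in> projections A" shows "sqmtx_map \<phi> p \<in> projections B"
proof -
  obtain k a where p: "p = (k, a)" by (cases p)
  note a = A.projectionsD[OF assms[unfolded p]]
  show ?thesis unfolding p sqmtx_map_def projections_def
    using mtx_map_mult[OF a(1) a(1), of k] mtx_map_star[OF a(1)] a by auto
qed

lemma sqmtx_map_mvn:
  assumes "A.mvn p q" shows "B.mvn (sqmtx_map \<phi> p) (sqmtx_map \<phi> q)"
proof -
  obtain v where v: "v \<in> mats A (fst q) (fst p)" "mtx_mult A (fst q) (mtx_star A v) v = snd p"
    "mtx_mult A (fst p) v (mtx_star A v) = snd q" and pq: "p \<in> projections A" "q \<in> projections A"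
    using assms by (auto simp: A.mvn_def mvn_equiv_def)
  note sv = A.mtx_star_closed[OF v(1)]
  have "mvn_equiv B (sqmtx_map \<phi> p) (sqmtx_map \<phi> q)"
    unfolding mvn_equiv_def sqmtx_map_def fst_conv snd_conv
    by (rule bexI[OF _ mtx_map_closed[OF v(1)]])
       (simp add: mtx_map_star[OF v(1), symmetric] mtx_map_mult[OF sv v(1), symmetric]
         mtx_map_mult[OF v(1) sv, symmetric] v)
  then show ?thesis using pq sqmtx_map_projections by (simp add: B.mvn_def)
qed

lemma sqmtx_map_stably:
  assumes "A.K0.stably p q" shows "B.K0.stably (sqmtx_map \<phi> p) (sqmtx_map \<phi> q)"
proof -
  obtain r where r: "p \<in> projections A" "q \<in> projections A" "r \<in> projections A"
    "A.mvn (block_sum A p r) (block_sum A q r)"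
    using assms by (auto simp: A.K0.stably_def)
  then have "B.mvn (block_sum B (sqmtx_map \<phi> p) (sqmtx_map \<phi> r))
      (block_sum B (sqmtx_map \<phi> q) (sqmtx_map \<phi> r))"
    using sqmtx_map_mvn[OF r(4)] by (simp add: sqmtx_map_block_sum)
  then show ?thesis unfolding B.K0.stably_def using r sqmtx_map_projections by blast
qed

lemma sqmtx_map_grel:
  assumes "((p, q), (p', q')) \<in> K0_rel A"
  shows "((sqmtx_map \<phi> p, sqmtx_map \<phi> q), (sqmtx_map \<phi> p', sqmtx_map \<phi> q')) \<in> K0_rel B"
  using assms sqmtx_map_stably[of "block_sum A p q'" "block_sum A p' q"] sqmtx_map_projections
  unfolding A.K0_rel_eq B.K0_rel_eq A.K0.grel_def B.K0.grel_def by (simp add: sqmtx_map_block_sum)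

lemma mtx_map_mtx_unitary:
  assumes "A.mtx_unitary k u" shows "B.mtx_unitary k (mtx_map \<phi> u)"
proof -
  have u: "u \<in> mats A k k" by (rule A.mtx_unitary_mats[OF assms])
  show ?thesis using assms u mtx_map_mult[OF u A.mtx_star_closed[OF u], of k]
    mtx_map_mult[OF A.mtx_star_closed[OF u] u, of k]
    unfolding A.M_unitary_def B.M_unitary_def by (simp add: mtx_map_star mtx_map_one)
qed

lemma sqmtx_map_unitaries: "u \<in> unitaries A \<Longrightarrow> sqmtx_map \<phi> u \<in> unitaries B"
  using mtx_map_mtx_unitary
    by (simp add: A.unitaries_mtx_unitary B.unitaries_mtx_unitary sqmtx_map_def)

lemma sqmtx_map_sq_one: "sqmtx_map \<phi> (A.sq_one r) = B.sq_one r"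
  by (simp add: A.sq_one_def B.sq_one_def sqmtx_map_def mtx_map_one)

lemma sqmtx_map_homotopic: assumes "A.homotopic u v"
  shows "B.homotopic (sqmtx_map \<phi> u) (sqmtx_map \<phi> v)"
proof -
  have "unitary_homotopic A u v" using assms by (simp add: A.homotopic_iff)
  then obtain w where w: "fst u = fst v" "\<And>t. t \<in> {0..1::real} \<Longrightarrow> (fst u, w t) \<in> unitaries A"
    "\<And>i j. continuous_map (top_of_set {0..1}) (ctopology A) (\<lambda>t. w t i j)" "w 0 = snd u"
      "w 1 = snd v"
    unfolding unitary_homotopic_def by blast
  have "unitary_homotopic B (sqmtx_map \<phi> u) (sqmtx_map \<phi> v)"
    unfolding unitary_homotopic_def
  proof (intro conjI exI[of _ "\<lambda>t. mtx_map \<phi> (w t)"] ballI allI)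
    fix t :: real assume "t \<in> {0..1}"
    then show "(fst (sqmtx_map \<phi> u), mtx_map \<phi> (w t)) \<in> unitaries B"
      using sqmtx_map_unitaries[OF w(2)] by (simp add: sqmtx_map_def)
  next
    fix i j
    show "continuous_map (top_of_set {0..1}) (ctopology B) (\<lambda>t. mtx_map \<phi> (w t) i j)"
      unfolding B.continuous_map_tends mtx_map_def
    proof (intro ballI conjI)
      fix t :: real assume t: "t \<in> {0..1}"
      have "A.tends (at t within {0..1}) (\<lambda>t. w t i j) (w t i j)" using w(3)[of i j] t
        unfolding A.continuous_map_tends by blast
      then show "B.tends (at t within {0..1}) (\<lambda>t. \<phi> (w t i j)) (\<phi> (w t i j))" by (rule tends)
      then show "\<phi> (w t i j) \<in> carrier B" by (rule B.tends_closed)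
    qed
  qed (use w in \<open>auto simp: sqmtx_map_def\<close>)
  then show ?thesis by (simp add: B.homotopic_iff)
qed

lemma sqmtx_map_stably_homotopic: assumes "A.stably_homotopic u v"
  shows "B.stably_homotopic (sqmtx_map \<phi> u) (sqmtx_map \<phi> v)"
proof -
  obtain r s where "A.homotopic (block_sum A u (A.sq_one r)) (block_sum A v (A.sq_one s))"
    and uv: "u \<in> unitaries A" "v \<in> unitaries A" using assms by (auto simp: A.stably_homotopic_def)
  from sqmtx_map_homotopic[OF this(1)] show ?thesis
    using uv sqmtx_map_unitaries unfolding B.stably_homotopic_def
      by (auto simp: sqmtx_map_block_sum sqmtx_map_sq_one)
qed

end

lemma sqmtx_map_comp: "sqmtx_map \<psi> (sqmtx_map \<phi> p) = sqmtx_map (\<lambda>x. \<psi> (\<phi> x)) p"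
  by (simp add: sqmtx_map_def mtx_map_def)

lemma sqmtx_map_cong:
  "(\<And>i j. snd p i j \<in> S) \<Longrightarrow> (\<And>x. x \<in> S \<Longrightarrow> \<phi> x = \<psi> x) \<Longrightarrow> sqmtx_map \<phi> p = sqmtx_map \<psi> p"
  by (simp add: sqmtx_map_def mtx_map_def)

lemma sqmtx_map_ident: "sqmtx_map (\<lambda>x. x) p = p"
  by (simp add: sqmtx_map_def mtx_map_def)

text \<open>
  A left inverse of \<open>\<psi>\<close> that becomes a two-sided inverse on K-theory is an isomorphism there. The
  hypothesis \<open>retr\<close> is on representatives, and it is what makes the induced map injective.
\<close>

lemma K0_map_iso:
  assumes AB: "cstar_morphism A B \<phi>" and BA: "cstar_morphism B A \<psi>"
    and sect: "\<And>x. x \<in> carrier B \<Longrightarrow> \<phi> (\<psi> x) = x"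
    and retr: "\<And>p. p \<in> projections A
        \<Longrightarrow> comm_congruence.stably (projections A) (block_sum A) (unital_cstar_algebra.mvn A)
      (sqmtx_map (\<lambda>x. \<psi> (\<phi> x)) p) p"
  shows "K0_map B \<phi> \<in> iso (K0 A) (K0 B)"
proof -
  interpret F: cstar_morphism A B \<phi> by (rule AB)
  interpret G: cstar_morphism B A \<psi> by (rule BA)
  interpret SA: comm_congruence "projections A" "block_sum A" F.A.K0.stably
    by (rule F.A.K0.stably_congruence)
  let ?X = "projections A \<times> projections A" and ?Y = "projections B \<times> projections B"
  let ?opA = "\<lambda>(p, q) (p', q'). (block_sum A p p', block_sum A q q')"
  let ?opB = "\<lambda>(p, q) (p', q'). (block_sum B p p', block_sum B q q')"
  let ?f = "\<lambda>(p, q). (sqmtx_map \<phi> p, sqmtx_map \<phi> q)"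
  have id: "sqmtx_map \<phi> (sqmtx_map \<psi> q) = q" if "q \<in> projections B" for q
  proof -
    have "snd q i j \<in> carrier B" for i j
      using F.B.projectionsD(1)[of "fst q" "snd q"] that by (auto intro: F.B.matsD)
    then show ?thesis unfolding sqmtx_map_comp using sqmtx_map_cong[of q "carrier B" "\<lambda>x. \<phi> (\<psi> x)"
      "\<lambda>x. x"] sect
      by (simp add: sqmtx_map_ident)
  qed
  have iff: "(x, x') \<in> K0_rel A \<longleftrightarrow> (?f x, ?f x') \<in> K0_rel B" if x: "x \<in> ?X" "x' \<in> ?X" for x x'
  proof -
    obtain p q p' q' where e: "x = (p, q)" "x' = (p', q')"
      and c: "p \<in> projections A" "q \<in> projections A" "p' \<in> projections A" "q' \<in> projections A"
      using x by auto
    have "((p, q), (p', q')) \<in> K0_rel A"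
      if h: "((sqmtx_map \<phi> p, sqmtx_map \<phi> q), (sqmtx_map \<phi> p', sqmtx_map \<phi> q')) \<in> K0_rel B"
    proof -
      let ?r = "sqmtx_map (\<lambda>x. \<psi> (\<phi> x))"
      have "((?r p, ?r q), (?r p', ?r q')) \<in> K0_rel A" using G.sqmtx_map_grel[OF h]
        by (simp add: sqmtx_map_comp)
      then have "F.A.K0.stably (block_sum A (?r p) (?r q')) (block_sum A (?r p') (?r q))"
        unfolding F.A.K0_rel_eq F.A.K0.grel_def by simp
      moreover have "F.A.K0.stably (block_sum A p q') (block_sum A (?r p) (?r q'))"
        using retr c by (intro SA.R_cong SA.R_sym[OF retr])
      moreover have "F.A.K0.stably (block_sum A (?r p') (?r q)) (block_sum A p' q)"
        using retr c by (intro SA.R_cong)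
      ultimately have "F.A.K0.stably (block_sum A p q') (block_sum A p' q)" using SA.R_trans
        by blast
      then show ?thesis using c unfolding F.A.K0_rel_eq F.A.K0.grel_def by simp
    qed
    then show ?thesis using F.sqmtx_map_grel[of p q p' q'] unfolding e by auto
  qed
  have *: "(\<lambda>C. \<Union>x\<in>C. K0_rel B `` {?f x}) \<in>
    iso \<lparr>carrier = ?X // K0_rel A, mult = (\<lambda>C D. \<Union>x\<in>C. \<Union>y\<in>D. K0_rel A `` {?opA x y}), one = K0_rel A
      `` {((0, mtx_one A 0), (0, mtx_one A 0))}\<rparr>
        \<lparr>carrier = ?Y // K0_rel B, mult = (\<lambda>C D. \<Union>x\<in>C. \<Union>y\<in>D. K0_rel B `` {?opB x y}), one = K0_rel B
          `` {((0, mtx_one B 0), (0, mtx_one B 0))}\<rparr>"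
  proof (rule quotient_iso)
    show "equiv ?X (K0_rel A)" unfolding F.A.K0_rel_eq by (rule F.A.K0.equiv_grel)
    show "equiv ?Y (K0_rel B)" unfolding F.B.K0_rel_eq by (rule F.B.K0.equiv_grel)
    show "(?opA x y, ?opA x' y') \<in> K0_rel A" if "(x, x') \<in> K0_rel A" "(y, y') \<in> K0_rel A"
      for x x' y y'
      using that F.A.K0.grel_cong unfolding F.A.K0_rel_eq by (auto split: prod.splits)
    show "(?opB x y, ?opB x' y') \<in> K0_rel B" if "(x, x') \<in> K0_rel B" "(y, y') \<in> K0_rel B"
      for x x' y y'
      using that F.B.K0.grel_cong unfolding F.B.K0_rel_eq by (auto split: prod.splits)
    show "x \<in> ?X \<Longrightarrow> ?f x \<in> ?Y" for x by (auto simp: F.sqmtx_map_projections)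
    show "x \<in> ?X \<Longrightarrow> y \<in> ?X \<Longrightarrow> ?f (?opA x y) = ?opB (?f x) (?f y)" for x y
      by (auto simp: F.sqmtx_map_block_sum)
    show "x \<in> ?X \<Longrightarrow> x' \<in> ?X \<Longrightarrow> (x, x') \<in> K0_rel A \<longleftrightarrow> (?f x, ?f x') \<in> K0_rel B" for x x' by (rule iff)
    fix y assume "y \<in> ?Y"
    then obtain q q' where y: "y = (q, q')" "q \<in> projections B" "q' \<in> projections B" by auto
    have "(y, y) \<in> K0_rel B" using y F.B.K0.equiv_grel unfolding F.B.K0_rel_eq equiv_def refl_on_def
      by auto
    then show "\<exists>x\<in>?X. (?f x, y) \<in> K0_rel B"
      using y id by (intro bexI[of _ "(sqmtx_map \<psi> q, sqmtx_map \<psi> q')"])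
        (auto simp: G.sqmtx_map_projections)
  qed
  show ?thesis using * unfolding K0_def K0_map_def[abs_def] by (simp add: case_prod_unfold)
qed

lemma K1_map_iso:
  assumes AB: "cstar_morphism A B \<phi>" and BA: "cstar_morphism B A \<psi>"
    and sect: "\<And>x. x \<in> carrier B \<Longrightarrow> \<phi> (\<psi> x) = x"
    and retr: "\<And>u. u \<in> unitaries A
        \<Longrightarrow> unital_cstar_algebra.stably_homotopic A (sqmtx_map (\<lambda>x. \<psi> (\<phi> x)) u) u"
  shows "K1_map B \<phi> \<in> iso (K1 A) (K1 B)"
proof -
  interpret F: cstar_morphism A B \<phi> by (rule AB)
  interpret G: cstar_morphism B A \<psi> by (rule BA)
  have id: "sqmtx_map \<phi> (sqmtx_map \<psi> q) = q" if "q \<in> unitaries B" for q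
  proof -
    have "snd q i j \<in> carrier B" for i j
      using F.B.mtx_unitary_mats that by (auto simp: F.B.unitaries_mtx_unitary intro: F.B.matsD)
    then show ?thesis unfolding sqmtx_map_comp using sqmtx_map_cong[of q "carrier B" "\<lambda>x. \<phi> (\<psi> x)"
      "\<lambda>x. x"] sect
      by (simp add: sqmtx_map_ident)
  qed
  have "(\<lambda>C. \<Union>x\<in>C. K1_rel B `` {sqmtx_map \<phi> x}) \<in>
    iso \<lparr>carrier = unitaries A // K1_rel A, mult =
      (\<lambda>C D. \<Union>x\<in>C. \<Union>y\<in>D. K1_rel A `` {block_sum A x y}), one = K1_rel A `` {(0, mtx_one A 0)}\<rparr>
        \<lparr>carrier = unitaries B // K1_rel B, mult =
          (\<lambda>C D. \<Union>x\<in>C. \<Union>y\<in>D. K1_rel B `` {block_sum B x y}), one = K1_rel B `` {(0, mtx_one B 0)}\<rparr>"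
  proof (rule quotient_iso)
    show "equiv (unitaries A) (K1_rel A)" by (rule F.A.equiv_K1_rel)
    show "equiv (unitaries B) (K1_rel B)" by (rule F.B.equiv_K1_rel)
    show "(block_sum A x y, block_sum A x' y') \<in> K1_rel A"
      if "(x, x') \<in> K1_rel A" "(y, y') \<in> K1_rel A" for x x' y y'
      using that F.A.K1.R_cong unfolding F.A.K1_rel_eq by auto
    show "(block_sum B x y, block_sum B x' y') \<in> K1_rel B"
      if "(x, x') \<in> K1_rel B" "(y, y') \<in> K1_rel B" for x x' y y'
      using that F.B.K1.R_cong unfolding F.B.K1_rel_eq by auto
    show "x \<in> unitaries A \<Longrightarrow> sqmtx_map \<phi> x \<in> unitaries B" for x by (rule F.sqmtx_map_unitaries)
    show "sqmtx_map \<phi> (block_sum A x y) = block_sum B (sqmtx_map \<phi> x) (sqmtx_map \<phi> y)" for x y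
      by (rule F.sqmtx_map_block_sum)
    show "(x, x') \<in> K1_rel A \<longleftrightarrow> (sqmtx_map \<phi> x, sqmtx_map \<phi> x') \<in> K1_rel B"
      if x: "x \<in> unitaries A" "x' \<in> unitaries A" for x x'
    proof
      show "(x, x') \<in> K1_rel A \<Longrightarrow> (sqmtx_map \<phi> x, sqmtx_map \<phi> x') \<in> K1_rel B"
        using F.sqmtx_map_stably_homotopic unfolding F.A.K1_rel_eq F.B.K1_rel_eq by simp
      assume "(sqmtx_map \<phi> x, sqmtx_map \<phi> x') \<in> K1_rel B"
      then have "F.A.stably_homotopic (sqmtx_map (\<lambda>x. \<psi> (\<phi> x)) x) (sqmtx_map (\<lambda>x. \<psi> (\<phi> x)) x')"
        using G.sqmtx_map_stably_homotopic unfolding F.B.K1_rel_eq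
          by (simp add: sqmtx_map_comp[symmetric])
      then have "F.A.stably_homotopic x x'"
        using retr[OF x(1)] retr[OF x(2)] F.A.stably_homotopic_sym F.A.stably_homotopic_trans
        by blast
      then show "(x, x') \<in> K1_rel A" unfolding F.A.K1_rel_eq by simp
    qed
    fix y assume y: "y \<in> unitaries B"
    have "(y, y) \<in> K1_rel B" using y F.B.stably_homotopic_refl unfolding F.B.K1_rel_eq by simp
    then show "\<exists>x\<in>unitaries A. (sqmtx_map \<phi> x, y) \<in> K1_rel B"
      using y id by (intro bexI[of _ "sqmtx_map \<psi> y"]) (auto simp: G.sqmtx_map_unitaries)
  qed
  then show ?thesis unfolding K1_def K1_map_def[abs_def] .
qed

text \<open>
  Only continuity of \<open>t \<mapsto> \<Phi> t x\<close> for each fixed \<open>x\<close> is asked for. This is enough because a matrix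
  has finitely many entries, and it avoids the algebra of \<open>B\<close>-valued functions on the interval.
\<close>

definition hom_homotopy :: "'a cstar \<Rightarrow> 'b cstar \<Rightarrow> (real \<Rightarrow> 'a \<Rightarrow> 'b) \<Rightarrow> bool" where
  "hom_homotopy A B \<Phi> \<longleftrightarrow> (\<forall>t\<in>{0..1}. \<Phi> t \<in> cstar_hom A B) \<and>
     (\<forall>x\<in>carrier A. \<forall>t\<in>{0..1}. unital_cstar_algebra.tends B (at t within {0..1}) (\<lambda>s. \<Phi> s x)
       (\<Phi> t x))"

lemma homotopy_invariance:
  assumes A: "unital_cstar_algebra A" and B: "unital_cstar_algebra B" and H: "hom_homotopy A B \<Phi>"
  shows "p \<in> projections A \<Longrightarrow> unital_cstar_algebra.mvn B (sqmtx_map (\<Phi> 0) p) (sqmtx_map (\<Phi> 1) p)"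
    and "u \<in> unitaries A \<Longrightarrow> unital_cstar_algebra.homotopic B (sqmtx_map (\<Phi> 0) u) (sqmtx_map (\<Phi> 1) u)"
proof -
  interpret A: unital_cstar_algebra A by (rule A)
  interpret B: unital_cstar_algebra B by (rule B)
  have F: "cstar_morphism A B (\<Phi> t)" if "t \<in> {0..1}" for t
    using H that A B by (simp add: hom_homotopy_def cstar_morphismI)
  have c: "B.tends (at t within {0..1}) (\<lambda>s. \<Phi> s x) (\<Phi> t x)" if "x \<in> carrier A" "t \<in> {0..1}" for t x
    using H that by (simp add: hom_homotopy_def)
  show "B.mvn (sqmtx_map (\<Phi> 0) p) (sqmtx_map (\<Phi> 1) p)" if p: "p \<in> projections A"
  proof -
    have q: "sqmtx_map (\<Phi> t) p \<in> projections B" if "t \<in> {0..1}" for t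
      using cstar_morphism.sqmtx_map_projections[OF F[OF that] p] .
    have m: "snd p i j \<in> carrier A" for i j using A.projectionsD(1)[of "fst p"
      "snd p"] p by (auto intro: A.matsD)
    have "mvn_equiv B (fst p, mtx_map (\<Phi> 0) (snd p)) (fst p, mtx_map (\<Phi> 1) (snd p))"
      by (rule B.projection_path[of _ "\<lambda>t. mtx_map (\<Phi> t) (snd p)"])
        (use q c m in \<open>auto simp: sqmtx_map_def mtx_map_def\<close>)
    then show ?thesis using q[of 0] q[of 1] by (simp add: B.mvn_def sqmtx_map_def)
  qed
  show "B.homotopic (sqmtx_map (\<Phi> 0) u) (sqmtx_map (\<Phi> 1) u)" if u: "u \<in> unitaries A"
  proof -
    have m: "snd u i j \<in> carrier A" for i j
      using A.mtx_unitary_mats u by (auto simp: A.unitaries_mtx_unitary intro: A.matsD)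
    have "unitary_homotopic B (sqmtx_map (\<Phi> 0) u) (sqmtx_map (\<Phi> 1) u)"
      unfolding unitary_homotopic_def
    proof (intro conjI exI[of _ "\<lambda>t. mtx_map (\<Phi> t) (snd u)"] ballI allI)
      fix t :: real assume "t \<in> {0..1}"
      then show "(fst (sqmtx_map (\<Phi> 0) u), mtx_map (\<Phi> t) (snd u)) \<in> unitaries B"
        using cstar_morphism.sqmtx_map_unitaries[OF F u] by (simp add: sqmtx_map_def)
    next
      fix i j
      show "continuous_map (top_of_set {0..1}) (ctopology B) (\<lambda>t. mtx_map (\<Phi> t) (snd u) i j)"
        unfolding B.continuous_map_tends mtx_map_def
      proof (intro ballI conjI)
        fix t :: real assume t: "t \<in> {0..1}"
        show "B.tends (at t within {0..1}) (\<lambda>t. \<Phi> t (snd u i j)) (\<Phi> t (snd u i j))"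
          by (rule c[OF m t])
        then show "\<Phi> t (snd u i j) \<in> carrier B" by (rule B.tends_closed)
      qed
    qed (auto simp: sqmtx_map_def)
    then show ?thesis by (simp add: B.homotopic_iff)
  qed
qed

subsection \<open>Homotopies through two by two matrices\<close>

text \<open>
  The identification of \<open>k \<times> k\<close> matrices over \<open>2 \<times> 2\<close> matrices with \<open>2k \<times> 2k\<close> matrices, with the
  index of the \<open>2 \<times> 2\<close> matrix outermost. With this order a diagonal homomorphism gives a block
  sum, without a permutation.
\<close>

definition amplify :: "('a \<Rightarrow> 'b mtx) \<Rightarrow> nat \<Rightarrow> 'a mtx \<Rightarrow> 'b mtx" where
  "amplify \<phi> k a = block_mtx k k (\<lambda>i j. \<phi> (a i j) 0 0) (\<lambda>i j. \<phi> (a i j) 0 1) (\<lambda>i j. \<phi> (a i j) 1 0)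
      (\<lambda>i j. \<phi> (a i j) 1 1)"

lemma (in unital_cstar_algebra) matalg_finsum:
  assumes "\<And>x. x \<in> I \<Longrightarrow> f x \<in> mats A k k"
  shows "finsum (matalg A k) f I = (\<lambda>i j. finsum A (\<lambda>x. f x i j) I)"
proof -
  interpret M: unital_cstar_algebra "matalg A k" by (rule unital_cstar_algebra_matalg)
  show ?thesis using assms
  proof (induction I rule: infinite_finite_induct)
    case (insert x I)
    then have "f \<in> I \<rightarrow> carrier (matalg A k)" "f x \<in> carrier (matalg A k)"
      "\<And>i j. (\<lambda>x. f x i j) \<in> I \<rightarrow> carrier A" "\<And>i j. f x i j \<in> carrier A" by (auto intro: matsD)
    then show ?case using insert by (simp add: mtx_add_def)
  qed (auto simp: finsum_infinite M.finsum_infinite mtx_zero_def)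
qed

lemma (in unital_cstar_algebra) mtx_mult_2:
  assumes "a \<in> mats A k 2" "b \<in> mats A 2 l"
  shows "mtx_mult A 2 a b i j = a i 0 \<otimes> b 0 j \<oplus> a i 1 \<otimes> b 1 j"
proof -
  have "{..<2::nat} = {0, 1}" by auto
  then show ?thesis using assms unfolding mtx_mult_def by (simp add: Pi_iff)
qed

context
  fixes A :: "'a cstar" and B :: "'b cstar" and \<phi>
  assumes hom2: "cstar_morphism A (matalg B 2) \<phi>" and B: "unital_cstar_algebra B"
begin

interpretation F: cstar_morphism A "matalg B 2" \<phi> by (rule hom2)
interpretation B: unital_cstar_algebra B by (rule B)

lemma amplify_entry_closed: "x \<in> carrier A \<Longrightarrow> \<phi> x \<in> mats B 2 2"
  using F.closed by simp

lemma amplify_block_closed: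
  assumes "a \<in> mats A k l" shows "(\<lambda>i j. \<phi> (a i j) r s) \<in> mats B k l"
proof (rule B.matsI)
  show "\<phi> (a i j) r s \<in> carrier B" for i j
    using amplify_entry_closed[OF F.A.matsD[OF assms]] by (rule B.matsD)
  show "\<phi> (a i j) r s = \<zero>\<^bsub>B\<^esub>" if "k \<le> i \<or> l \<le> j" for i j
    using F.A.mats_outside[OF assms that] F.zero by (simp add: mtx_zero_def)
qed

lemma amplify_closed: "a \<in> mats A k k \<Longrightarrow> amplify \<phi> k a \<in> mats B (k + k) (k + k)"
  unfolding amplify_def by (intro B.block_mtx_closed amplify_block_closed)

lemma amplify_mult:
  assumes a: "a \<in> mats A k k" and b: "b \<in> mats A k k"
  shows "amplify \<phi> k (mtx_mult A k a b) = mtx_mult B (k + k) (amplify \<phi> k a) (amplify \<phi> k b)"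
proof -
  have e: "\<phi> (mtx_mult A k a b i j) r s =
     mtx_add B (mtx_mult B k (\<lambda>i j. \<phi> (a i j) r 0) (\<lambda>i j. \<phi> (b i j) 0 s))
       (mtx_mult B k (\<lambda>i j. \<phi> (a i j) r 1) (\<lambda>i j. \<phi> (b i j) 1 s)) i j" for i j r s
  proof -
    have ac: "\<phi> (a i l) \<in> mats B 2 2" and bc: "\<phi> (b l j) \<in> mats B 2 2" for l
      using a b by (auto intro!: amplify_entry_closed)
    have "\<phi> (mtx_mult A k a b i j)
        = finsum (matalg B 2) (\<lambda>l. mtx_mult B 2 (\<phi> (a i l)) (\<phi> (b l j))) {..<k}"
      unfolding mtx_mult_def[of A] using a b by (subst F.finsum) (auto simp: F.mult)
    also have "\<dots> = (\<lambda>r s. finsum B (\<lambda>l. mtx_mult B 2 (\<phi> (a i l)) (\<phi> (b l j)) r s) {..<k})"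
      by (rule B.matalg_finsum) (rule B.mtx_mult_closed[OF ac bc])
    finally have "\<phi> (mtx_mult A k a b i j) r s =
       finsum B (\<lambda>l. \<phi> (a i l) r 0 \<otimes>\<^bsub>B\<^esub> \<phi> (b l j) 0 s \<oplus>\<^bsub>B\<^esub> \<phi> (a i l) r 1 \<otimes>\<^bsub>B\<^esub> \<phi> (b l j) 1 s) {..<k}"
      by (simp add: B.mtx_mult_2[OF ac bc])
    also have "\<dots> = finsum B (\<lambda>l. \<phi> (a i l) r 0 \<otimes>\<^bsub>B\<^esub> \<phi> (b l j) 0 s) {..<k} \<oplus>\<^bsub>B\<^esub>
       finsum B (\<lambda>l. \<phi> (a i l) r 1 \<otimes>\<^bsub>B\<^esub> \<phi> (b l j) 1 s) {..<k}"
      using B.matsD[OF ac] B.matsD[OF bc] by (intro B.finsum_addf) auto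
    finally show ?thesis by (simp add: mtx_add_def mtx_mult_def)
  qed
  show ?thesis
    unfolding amplify_def
      by (subst B.block_mtx_mult[where k' = k and l' = k]; (intro amplify_block_closed a b)?)
      (simp add: e)
qed

lemma amplify_star:
  assumes a: "a \<in> mats A k k" shows "amplify \<phi> k (mtx_star A a) = mtx_star B (amplify \<phi> k a)"
  unfolding amplify_def B.block_mtx_star using a by (simp add: mtx_star_def F.star)

lemma amplify_one: "amplify \<phi> k (mtx_one A k) = mtx_one B (k + k)"
  unfolding amplify_def B.block_mtx_one using F.one F.zero
  by (auto simp: mtx_one_def mtx_zero_def if_distrib[of \<phi>] block_mtx_def intro!: ext)

lemma amplify_projection:
  assumes "(k, a) \<in> projections A" shows "(k + k, amplify \<phi> k a) \<in> projections B"
  using F.A.projectionsD[OF assms] amplify_mult amplify_star amplify_closed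
    unfolding projections_def
  by (simp flip: amplify_mult amplify_star)

lemma amplify_unitary:
  assumes "(k, a) \<in> unitaries A" shows "(k + k, amplify \<phi> k a) \<in> unitaries B"
proof -
  have a: "a \<in> mats A k k" "mtx_mult A k (mtx_star A a) a = mtx_one A k"
    "mtx_mult A k a (mtx_star A a) = mtx_one A k"
    using assms by (auto simp: unitaries_def)
  show ?thesis using a amplify_closed unfolding unitaries_def
    by (simp flip: amplify_mult amplify_star amplify_one)
qed

end

definition diag_pair :: "'b cstar \<Rightarrow> 'b \<Rightarrow> 'b \<Rightarrow> 'b mtx" where
  "diag_pair B x y = (\<lambda>i j. if i = 0 \<and> j = 0 then x else if i = 1 \<and> j = 1 then y else \<zero>\<^bsub>B\<^esub>)"

text \<open>
  The amplified path is a path of projections, or of unitaries, between the two block sums.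
\<close>

lemma homotopy_invariance_amplify:
  assumes A: "unital_cstar_algebra A" and B: "unital_cstar_algebra B"
    and H: "hom_homotopy A (matalg B 2) \<Phi>"
    and 0: "\<And>x. x \<in> carrier A \<Longrightarrow> \<Phi> 0 x = diag_pair B (\<alpha> x) (\<beta> x)"
    and 1: "\<And>x. x \<in> carrier A \<Longrightarrow> \<Phi> 1 x = diag_pair B (\<gamma> x) (\<delta> x)"
    and homs: "\<alpha> \<in> cstar_hom A B" "\<beta> \<in> cstar_hom A B" "\<gamma> \<in> cstar_hom A B" "\<delta> \<in> cstar_hom A B"
  shows "p \<in> projections A
      \<Longrightarrow> unital_cstar_algebra.mvn B (block_sum B (sqmtx_map \<alpha> p) (sqmtx_map \<beta> p))
            (block_sum B (sqmtx_map \<gamma> p) (sqmtx_map \<delta> p))"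
    and "u \<in> unitaries A
        \<Longrightarrow> unital_cstar_algebra.homotopic B (block_sum B (sqmtx_map \<alpha> u) (sqmtx_map \<beta> u))
            (block_sum B (sqmtx_map \<gamma> u) (sqmtx_map \<delta> u))"
proof -
  interpret A: unital_cstar_algebra A by (rule A)
  interpret B: unital_cstar_algebra B by (rule B)
  interpret B2: unital_cstar_algebra "matalg B 2" by (rule B.unital_cstar_algebra_matalg)
  have F: "cstar_morphism A (matalg B 2) (\<Phi> t)" if "t \<in> {0..1}" for t
    using H that A B2.unital_cstar_algebra_axioms by (simp add: hom_homotopy_def cstar_morphismI)
  have cm: "cstar_morphism A B \<alpha>" "cstar_morphism A B \<beta>" "cstar_morphism A B \<gamma>"
    "cstar_morphism A B \<delta>"
    using homs A B by (auto simp: cstar_morphismI)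
  have ev: "\<forall>\<^sub>F s in at t within {0..1}. s \<in> {0..1}" for t :: real
    unfolding eventually_at_filter by (rule always_eventually) auto
  have c: "B.tends (at t within {0..1}) (\<lambda>s. \<Phi> s x i j) (\<Phi> t x i j)" if x: "x \<in> carrier A"
    and t: "t \<in> {0..1}" for t x i j
  proof -
    have m1: "\<forall>\<^sub>F s in at t within {0..1}. \<Phi> s x \<in> mats B 2 2"
      using ev by (rule eventually_mono) (use amplify_entry_closed[OF F B] x in auto)
    have m2: "\<Phi> t x \<in> mats B 2 2" using amplify_entry_closed[OF F B] x t by auto
    have "B2.tends (at t within {0..1}) (\<lambda>s. \<Phi> s x) (\<Phi> t x)" using H x t
      by (simp add: hom_homotopy_def)
    then show ?thesis unfolding B.matalg_tends[OF m1 m2] by simp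
  qed
  have cont: "B.tends (at t within {0..1}) (\<lambda>s. amplify (\<Phi> s) k a i j) (amplify (\<Phi> t) k a i j)"
    if a: "a \<in> mats A k k" and t: "t \<in> {0..1}" for a k t i j
  proof -
    have "B.tends (at t within {0..1}) (\<lambda>s. \<Phi> s (a p q) r l) (\<Phi> t (a p q) r l)" for p q r l
      by (rule c[OF A.matsD[OF a] t])
    then show ?thesis unfolding amplify_def block_mtx_def by simp
  qed
  have e: "amplify \<phi> k a = B.diag_blocks k k (mtx_map \<mu> a) (mtx_map \<nu> a)"
    if "a \<in> mats A k k" "\<And>x. x \<in> carrier A \<Longrightarrow> \<phi> x = diag_pair B (\<mu> x) (\<nu> x)" for a k \<phi> \<mu> \<nu>
    using that by
      (auto simp: amplify_def block_mtx_def diag_pair_def mtx_map_def mtx_zero_def intro!: ext)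
  have e': "block_sum B (sqmtx_map \<mu> (k, a)) (sqmtx_map \<nu> (k, a))
      = (k + k, B.diag_blocks k k (mtx_map \<mu> a) (mtx_map \<nu> a))"
    if a: "a \<in> mats A k k" and m: "cstar_morphism A B \<mu>" "cstar_morphism A B \<nu>" for a k \<mu> \<nu>
    unfolding sqmtx_map_def fst_conv snd_conv
    by (rule B.block_sum_diag_blocks[OF cstar_morphism.mtx_map_closed[OF m(1) a]
      cstar_morphism.mtx_map_closed[OF m(2) a]])
  show "B.mvn (block_sum B (sqmtx_map \<alpha> p) (sqmtx_map \<beta> p))
      (block_sum B (sqmtx_map \<gamma> p) (sqmtx_map \<delta> p))"
    if p: "p \<in> projections A"
  proof -
    obtain k a where ka: "p = (k, a)" by (cases p)
    have a: "a \<in> mats A k k" using A.projectionsD p ka by auto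
    have pr: "(k + k, amplify (\<Phi> t) k a) \<in> projections B" if "t \<in> {0..1}" for t
      by (rule amplify_projection[OF F[OF that] B p[unfolded ka]])
    have "mvn_equiv B (k + k, amplify (\<Phi> 0) k a) (k + k, amplify (\<Phi> 1) k a)"
      by (rule B.projection_path[of _ "\<lambda>t. amplify (\<Phi> t) k a"]) (use pr cont[OF a] in auto)
    then have "B.mvn (k + k, amplify (\<Phi> 0) k a) (k + k, amplify (\<Phi> 1) k a)" using pr
      by (simp add: B.mvn_def)
    then show ?thesis using e[OF a 0] e[OF a 1] by (simp add: ka e'[OF a cm(1,2)] e'[OF a cm(3,4)])
  qed
  show "B.homotopic (block_sum B (sqmtx_map \<alpha> u) (sqmtx_map \<beta> u))
      (block_sum B (sqmtx_map \<gamma> u) (sqmtx_map \<delta> u))"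
    if u: "u \<in> unitaries A"
  proof -
    obtain k a where ka: "u = (k, a)" by (cases u)
    have a: "a \<in> mats A k k" using u ka by (auto simp: unitaries_def)
    have pr: "(k + k, amplify (\<Phi> t) k a) \<in> unitaries B" if "t \<in> {0..1}" for t
      by (rule amplify_unitary[OF F[OF that] B u[unfolded ka]])
    have "unitary_homotopic B (k + k, amplify (\<Phi> 0) k a) (k + k, amplify (\<Phi> 1) k a)"
      unfolding unitary_homotopic_def fst_conv snd_conv
    proof (intro conjI exI[of _ "\<lambda>t. amplify (\<Phi> t) k a"] ballI allI)
      fix i j
      have "amplify (\<Phi> t) k a i j \<in> carrier B" if "t \<in> {0..1}" for t
        by (rule B.matsD[OF amplify_closed[OF F[OF that] B a]])
      then show "continuous_map (top_of_set {0..1}) (ctopology B) (\<lambda>t. amplify (\<Phi> t) k a i j)"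
        unfolding B.continuous_map_tends using cont[OF a] by auto
    qed (use pr in auto)
    then have "B.homotopic (k + k, amplify (\<Phi> 0) k a) (k + k, amplify (\<Phi> 1) k a)"
      by (simp add: B.homotopic_iff)
    then show ?thesis using e[OF a 0] e[OF a 1] by (simp add: ka e'[OF a cm(1,2)] e'[OF a cm(3,4)])
  qed
qed

section \<open>The universal property\<close>

subsection \<open>Transport of structure\<close>

text \<open>
  The universal property speaks about algebras inside \<^typ>\<open>nat \<Rightarrow> complex\<close> only; this copies others
  into that type.
\<close>

definition transport :: "('b \<Rightarrow> 'c) \<Rightarrow> 'b cstar \<Rightarrow> 'c cstar" where
  "transport \<iota> B = (let g = the_inv_into (carrier B) \<iota> in
    \<lparr>carrier = \<iota> ` carrier B, mult = (\<lambda>x y. \<iota> (g x \<otimes>\<^bsub>B\<^esub> g y)), one = \<iota> \<one>\<^bsub>B\<^esub>, zero = \<iota> \<zero>\<^bsub>B\<^esub>,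
     add = (\<lambda>x y. \<iota> (g x \<oplus>\<^bsub>B\<^esub> g y)), smult = (\<lambda>c x. \<iota> (c \<odot>\<^bsub>B\<^esub> g x)),
     star = (\<lambda>x. \<iota> (star B (g x))), nrm = (\<lambda>x. nrm B (g x))\<rparr>)"

context unital_cstar_algebra
begin

context
  fixes \<iota> :: "'a \<Rightarrow> 'c"
  assumes inj: "inj_on \<iota> (carrier A)"
begin

private lemma inv [simp]: "x \<in> carrier A \<Longrightarrow> the_inv_into (carrier A) \<iota> (\<iota> x) = x"
  by (rule the_inv_into_f_f[OF inj])

private lemma tr_simps [simp]:
  "carrier (transport \<iota> A) = \<iota> ` carrier A"
  "x \<in> carrier A \<Longrightarrow> y \<in> carrier A \<Longrightarrow> \<iota> x \<otimes>\<^bsub>transport \<iota> A\<^esub> \<iota> y = \<iota> (x \<otimes> y)"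
  "x \<in> carrier A \<Longrightarrow> y \<in> carrier A \<Longrightarrow> \<iota> x \<oplus>\<^bsub>transport \<iota> A\<^esub> \<iota> y = \<iota> (x \<oplus> y)"
  "\<one>\<^bsub>transport \<iota> A\<^esub> = \<iota> \<one>" "\<zero>\<^bsub>transport \<iota> A\<^esub> = \<iota> \<zero>"
  "x \<in> carrier A \<Longrightarrow> c \<odot>\<^bsub>transport \<iota> A\<^esub> \<iota> x = \<iota> (c \<odot> x)"
  "x \<in> carrier A \<Longrightarrow> star (transport \<iota> A) (\<iota> x) = \<iota> (star A x)"
  "x \<in> carrier A \<Longrightarrow> nrm (transport \<iota> A) (\<iota> x) = nrm A x"
  by (simp_all add: transport_def Let_def)

lemma ring_transport: "ring (transport \<iota> A)"
proof (intro ringI abelian_groupI monoidI)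
  fix x assume "x \<in> carrier (transport \<iota> A)"
  then obtain y where y: "x = \<iota> y" "y \<in> carrier A" by auto
  show "\<exists>y\<in>carrier (transport \<iota> A). y \<oplus>\<^bsub>transport \<iota> A\<^esub> x = \<zero>\<^bsub>transport \<iota> A\<^esub>"
    by (rule bexI[of _ "\<iota> (\<ominus> y)"]) (use y in \<open>auto simp: l_neg\<close>)
qed (auto simp: m_assoc l_distr r_distr a_ac)

private lemma tr_diff: "x \<in> carrier A \<Longrightarrow> y \<in> carrier A \<Longrightarrow> \<iota> x \<ominus>\<^bsub>transport \<iota> A\<^esub> \<iota> y = \<iota> (x \<ominus> y)"
proof -
  assume xy: "x \<in> carrier A" "y \<in> carrier A"
  interpret T: ring "transport \<iota> A" by (rule ring_transport)
  have "\<ominus>\<^bsub>transport \<iota> A\<^esub> \<iota> y = \<iota> (\<ominus> y)" by (rule T.minus_equality) (use xy in \<open>auto simp: l_neg\<close>)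
  then show ?thesis using xy by (simp add: a_minus_def[of "transport \<iota> A"]) (simp add: a_minus_def)
qed

lemma unital_cstar_algebra_transport: "unital_cstar_algebra (transport \<iota> A)"
proof -
  interpret T: ring "transport \<iota> A" by (rule ring_transport)
  have z: "x \<in> carrier A \<Longrightarrow> \<iota> x = \<iota> \<zero> \<longleftrightarrow> x = \<zero>" for x using inj_onD[OF inj] by auto
  have m: "nrm (transport \<iota> A) (\<ominus>\<^bsub>transport \<iota> A\<^esub> x) = nrm (transport \<iota> A) x"
    if "x \<in> carrier (transport \<iota> A)" for x
  proof -
    from that obtain y where y: "x = \<iota> y" "y \<in> carrier A" by auto
    have "\<ominus>\<^bsub>transport \<iota> A\<^esub> x = \<iota> (\<ominus> y)" by (rule T.minus_equality) (use y in \<open>auto simp: l_neg\<close>)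
    then show ?thesis using y by simp
  qed
  have ms: "Metric_space (carrier (transport \<iota> A)) (cdist (transport \<iota> A))"
    by (rule Metric_space_cdistI[OF ring_transport])
      (use m in \<open>auto simp: nrm_nonneg nrm_triangle nrm_eq_0 z\<close>)
  have comp: "Metric_space.mcomplete (carrier (transport \<iota> A)) (cdist (transport \<iota> A))"
  proof (rule mcompleteI[OF ms])
    fix y :: "nat \<Rightarrow> 'c"
    assume yc: "\<And>n. y n \<in> carrier (transport \<iota> A)"
    assume C: "\<And>e. e > 0 \<Longrightarrow> \<exists>N. \<forall>m\<ge>N. \<forall>n\<ge>N. nrm (transport \<iota> A) (y m \<ominus>\<^bsub>transport \<iota> A\<^esub> y n) < e"
    have "\<forall>n. \<exists>x. y n = \<iota> x \<and> x \<in> carrier A" using yc by auto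
    then obtain x where x: "\<And>n. y n = \<iota> (x n)" "\<And>n. x n \<in> carrier A" by metis
    have "\<exists>L. tends sequentially x L"
      by (rule Cauchy_tends) (use C x in \<open>auto simp: tr_diff\<close>)
    then obtain L where L: "tends sequentially x L" ..
    show "\<exists>L\<in>carrier (transport \<iota> A). (\<lambda>n. nrm (transport \<iota> A) (y n \<ominus>\<^bsub>transport \<iota> A\<^esub> L)) \<longlonglongrightarrow> 0"
      by (rule bexI[of _ "\<iota> L"]) (use L x tends_closed[OF L] in \<open>auto simp: tends_def tr_diff\<close>)
  qed
  have ab: "abelian_group (transport \<iota> A)" by (rule T.is_abelian_group)
  have mod: "module complex_ring (transport \<iota> A)"
    by (rule moduleI[OF cring_complex_ring ab])
      (auto simp: complex_ring_def sc_add_l sc_add_r sc_assoc)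
  show ?thesis
    by (intro unital_cstar_algebra.intro unital_cstar_algebra_axioms.intro ring_transport mod comp)
       (auto simp: sc_mult star_add star_smult star_mult nrm_nonneg nrm_eq_0 nrm_triangle nrm_smult
         nrm_mult cstar_identity z)
qed

lemma transport_hom: "\<iota> \<in> cstar_hom A (transport \<iota> A)"
  unfolding cstar_hom_def by (auto intro!: ring_hom_memI)

lemma transport_inv_hom: "the_inv_into (carrier A) \<iota> \<in> cstar_hom (transport \<iota> A) A"
  unfolding cstar_hom_def by (auto intro!: ring_hom_memI)

end
end

lemma cstar_hom_compose:
  assumes "\<phi> \<in> cstar_hom A B" "\<psi> \<in> cstar_hom B C" shows "(\<lambda>x. \<psi> (\<phi> x)) \<in> cstar_hom A C"
proof -
  have "\<psi> \<circ> \<phi> \<in> ring_hom A C" using assms ring_hom_trans unfolding cstar_hom_def by blast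
  moreover have "x \<in> carrier A \<Longrightarrow> \<phi> x \<in> carrier B" for x
    using assms ring_hom_closed unfolding cstar_hom_def by fastforce
  ultimately show ?thesis using assms unfolding cstar_hom_def by (simp add: comp_def)
qed

lemma cstar_hom_ident: "(\<lambda>x. x) \<in> cstar_hom A A"
  unfolding cstar_hom_def by (auto intro!: ring_hom_memI)

subsection \<open>Relations\<close>

fun opp :: "vertex \<Rightarrow> vertex" where
  "opp (i, Plus) = (i, Minus)" | "opp (i, Minus) = (i, Plus)"

lemma opp_opp [simp]: "opp (opp v) = v"
  by (cases v rule: opp.cases) auto

lemma opp_neq [simp]: "opp v \<noteq> v" "v \<noteq> opp v"
  by (cases v rule: opp.cases; simp)+

lemma opp_inject [simp]: "opp v = opp w \<longleftrightarrow> v = w"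
  by (metis opp_opp)

lemma opp_vertices [simp]: "opp v \<in> sphere_vertices n \<longleftrightarrow> v \<in> sphere_vertices n"
  by (cases v rule: opp.cases) (auto simp: sphere_vertices_def)

lemma UNIV_sign: "UNIV = {Plus, Minus}"
  using sign.exhaust by auto

lemma finite_vertices [simp]: "finite (sphere_vertices n)"
  by (simp add: sphere_vertices_def UNIV_sign)

context unital_cstar_algebra
begin

lemma finsum_vertices:
  assumes "\<And>v. v \<in> sphere_vertices n \<Longrightarrow> h v \<in> carrier A"
  shows "finsum A h (sphere_vertices n) = (\<Oplus>i\<in>{..n}. h (i, Plus)) \<oplus> (\<Oplus>i\<in>{..n}. h (i, Minus))"
proof -
  let ?P = "(\<lambda>i. (i, Plus)) ` {..n}" and ?M = "(\<lambda>i. (i, Minus)) ` {..n}"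
  have V: "sphere_vertices n = ?P \<union> ?M" by (auto simp: sphere_vertices_def UNIV_sign)
  have c: "h \<in> ?P \<rightarrow> carrier A" "h \<in> ?M \<rightarrow> carrier A" using assms unfolding V by auto
  have "finsum A h (?P \<union> ?M) = finsum A h ?P \<oplus> finsum A h ?M"
    using c by (intro finsum_Un_disjoint) auto
  then show ?thesis unfolding V using c by (simp add: finsum_reindex inj_on_def)
qed

text \<open>
  The form of the relations used from here on: positivity as membership in the cone, one sum over
  all vertices, and orthogonality of opposite vertices in either order (the reverse order follows
  by taking adjoints).
\<close>

lemma sphere_relations_iff:
  "sphere_relations n A h \<longleftrightarrow> (\<forall>v\<in>sphere_vertices n. pos (h v)) \<and>
     finsum A h (sphere_vertices n) = \<one> \<and> (\<forall>v\<in>sphere_vertices n. h v \<otimes> h (opp v) = \<zero>)"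
proof (cases "\<forall>v\<in>sphere_vertices n. pos (h v)")
  case True
  then have c: "h v \<in> carrier A" "star A (h v) = h v" if "v \<in> sphere_vertices n" for v
    using that posD by auto
  have "(\<forall>i\<le>n. h (i, Plus) \<otimes> h (i, Minus) = \<zero>) \<longleftrightarrow> (\<forall>v\<in>sphere_vertices n. h v \<otimes> h (opp v) = \<zero>)"
  proof (intro iffI ballI allI impI)
    fix v assume a: "\<forall>i\<le>n. h (i, Plus) \<otimes> h (i, Minus) = \<zero>" and v: "v \<in> sphere_vertices n"
    obtain i s where vis: "v = (i, s)" by (cases v)
    then have i: "i \<le> n" and V: "(i, Plus) \<in> sphere_vertices n" "(i, Minus) \<in> sphere_vertices n"
      using v by (auto simp: sphere_vertices_def)
    have z: "h (i, Plus) \<otimes> h (i, Minus) = \<zero>" using a i by blast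
    then have "star A (h (i, Plus) \<otimes> h (i, Minus)) = \<zero>" by simp
    then have "h (i, Minus) \<otimes> h (i, Plus) = \<zero>" using c V by (simp add: star_mult)
    then show "h v \<otimes> h (opp v) = \<zero>" using z vis by (cases s) auto
  next
    fix i assume "\<forall>v\<in>sphere_vertices n. h v \<otimes> h (opp v) = \<zero>" "i \<le> n"
    then have "h (i, Plus) \<otimes> h (opp (i, Plus)) = \<zero>" unfolding sphere_vertices_def by blast
    then show "h (i, Plus) \<otimes> h (i, Minus) = \<zero>" by simp
  qed
  then show ?thesis using True finsum_vertices[of n h] c
    by (simp add: sphere_relations_def cpositive_iff_pos)
next
  case False
  then show ?thesis by (auto simp: sphere_relations_def cpositive_iff_pos)
qed

end

lemma (in cstar_morphism) sphere_relations:
  assumes "sphere_relations n A k" shows "sphere_relations n B (\<lambda>v. \<phi> (k v))"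
proof -
  note r = assms[unfolded A.sphere_relations_iff]
  have c: "k v \<in> carrier A" if "v \<in> sphere_vertices n" for v using r A.posD that by auto
  have "B.pos (\<phi> (k v))" if v: "v \<in> sphere_vertices n" for v
  proof -
    obtain y where y: "y \<in> carrier A" "k v = star A y \<otimes>\<^bsub>A\<^esub> y"
      using r v unfolding A.cpositive_iff_pos[symmetric] cpositive_def by auto
    then show ?thesis using B.pos_star_mult[of "\<phi> y"] by (simp add: mult star)
  qed
  moreover have "finsum B (\<lambda>v. \<phi> (k v)) (sphere_vertices n) = \<one>\<^bsub>B\<^esub>"
    using finsum[of k "sphere_vertices n"] r c by auto
  moreover have "\<phi> (k v) \<otimes>\<^bsub>B\<^esub> \<phi> (k (opp v)) = \<zero>\<^bsub>B\<^esub>" if "v \<in> sphere_vertices n" for v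
    using r c that by (simp flip: mult)
  ultimately show ?thesis unfolding B.sphere_relations_iff by blast
qed

subsection \<open>Separability\<close>

text \<open>
  Words in the generators with rational complex coefficients. There are countably many, which is why
  \<open>A\<close> is separable.
\<close>

datatype alg_term = Gen nat bool | Sc rat rat | Add alg_term alg_term | Mul alg_term alg_term | Star
  alg_term

instance alg_term :: countable
  by countable_datatype

primrec eval_term :: "'a cstar \<Rightarrow> (vertex \<Rightarrow> 'a) \<Rightarrow> alg_term \<Rightarrow> 'a" where
  "eval_term A h (Gen i b) = h (i, if b then Plus else Minus)"
| "eval_term A h (Sc p q) = (Complex (of_rat p) (of_rat q)) \<odot>\<^bsub>A\<^esub> \<one>\<^bsub>A\<^esub>"
| "eval_term A h (Add s t) = eval_term A h s \<oplus>\<^bsub>A\<^esub> eval_term A h t"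
| "eval_term A h (Mul s t) = eval_term A h s \<otimes>\<^bsub>A\<^esub> eval_term A h t"
| "eval_term A h (Star t) = star A (eval_term A h t)"

lemma rat_seq: "\<exists>f :: nat \<Rightarrow> rat. (\<lambda>n. real_of_rat (f n)) \<longlonglongrightarrow> r"
proof -
  have "\<exists>q. r < real_of_rat q \<and> real_of_rat q < r + 1 / real (Suc n)" for n
    by (rule of_rat_dense) simp
  then obtain f where f: "\<And>n. r < real_of_rat (f n)" "\<And>n. real_of_rat (f n) < r + 1 / real (Suc n)"
    by metis
  have l: "(\<lambda>n. r + 1 / real (Suc n)) \<longlonglongrightarrow> r + 0"
    by (intro tendsto_intros LIMSEQ_inverse_real_of_nat[unfolded inverse_eq_divide])
  have "(\<lambda>n. real_of_rat (f n)) \<longlonglongrightarrow> r"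
    by (rule tendsto_sandwich[OF _ _ tendsto_const l[simplified]])
       (use f in \<open>auto intro!: always_eventually less_imp_le simp: add_ac\<close>)
  then show ?thesis by (rule exI[of _ f])
qed

locale sphere_algebra =
  fixes n :: nat and A :: "'a cstar" (structure) and h :: "vertex \<Rightarrow> 'a"
  assumes universal: "universal_sphere_algebra n A h"

sublocale sphere_algebra \<subseteq> unital_cstar_algebra A
  using universal by (simp add: universal_sphere_algebra_def)

context sphere_algebra
begin

abbreviation V :: "vertex set" where "V \<equiv> sphere_vertices n"

lemma rel: "sphere_relations n A h"
  using universal by (simp add: universal_sphere_algebra_def)

lemma gen_pos: "v \<in> V \<Longrightarrow> pos (h v)" and gen_sum: "finsum A h V = \<one>"
  using rel unfolding sphere_relations_iff by auto

lemma gen_closed [simp]: "v \<in> V \<Longrightarrow> h v \<in> carrier A"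
  using gen_pos posD by blast

text \<open>
  Induction over a generated C*-algebra: the elements with property \<open>P\<close> form a closed unital
  *-subalgebra.
\<close>

lemma generated_induct [consumes 1, case_names gen one add mult smult star lim]:
  assumes x: "x \<in> carrier A" and gen: "\<And>v. v \<in> V \<Longrightarrow> P (h v)" and one: "P \<one>"
    and add: "\<And>x y. x \<in> carrier A \<Longrightarrow> y \<in> carrier A \<Longrightarrow> P x \<Longrightarrow> P y \<Longrightarrow> P (x \<oplus> y)"
    and mult: "\<And>x y. x \<in> carrier A \<Longrightarrow> y \<in> carrier A \<Longrightarrow> P x \<Longrightarrow> P y \<Longrightarrow> P (x \<otimes> y)"
    and smult: "\<And>c x. x \<in> carrier A \<Longrightarrow> P x \<Longrightarrow> P (c \<odot> x)"
    and star: "\<And>x. x \<in> carrier A \<Longrightarrow> P x \<Longrightarrow> P (star A x)"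
    and lim: "\<And>y L. (\<And>n. y n \<in> carrier A) \<Longrightarrow> (\<And>n. P (y n)) \<Longrightarrow> tends sequentially y L \<Longrightarrow> P L"
  shows "P x"
proof -
  let ?S = "{x \<in> carrier A. P x}"
  have "unital_cstar_subalgebra ?S A"
    unfolding unital_cstar_subalgebra_def
  proof (intro conjI)
    show "subring ?S A"
    proof (rule subringI)
      show "\<ominus> x \<in> ?S" if "x \<in> ?S" for x using smult[of x "-1"] that by (simp add: sc_minus_l)
    qed (use one add mult in auto)
    show "closedin (ctopology A) ?S"
    proof (rule closedinI)
      fix y L assume "\<And>n. y n \<in> ?S" and t: "tends sequentially y L"
      then have "\<And>n. y n \<in> carrier A" "\<And>n. P (y n)" by simp_all
      from lim[OF this t] show "L \<in> ?S" using tends_closed[OF t] by simp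
    qed simp
  qed (use smult star in auto)
  moreover have "h ` V \<subseteq> ?S" using gen by auto
  moreover have "cstar_generated_by A (h ` V)" using universal
    by (simp add: universal_sphere_algebra_def)
  ultimately have "?S = carrier A" unfolding cstar_generated_by_def by blast
  then show ?thesis using x by blast
qed

abbreviation term_val :: "alg_term \<Rightarrow> 'a" where "term_val \<equiv> eval_term A (\<lambda>v. if v
    \<in> V then h v else \<zero>)"

lemma term_val_closed [simp]: "term_val t \<in> carrier A"
  by (induction t) auto

lemma terms_dense:
  assumes "x \<in> carrier A" shows "\<exists>ts. tends sequentially (\<lambda>n. term_val (ts n)) x"
  using assms
proof (induct rule: generated_induct)
  case (gen v)
  then have "term_val (Gen (fst v) (snd v = Plus)) = h v" by (cases v; cases "snd v") auto
  then show ?case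
    using gen tends_const[of "h v"] by (intro exI[of _ "\<lambda>_. Gen (fst v) (snd v = Plus)"]) simp
next
  case one
  have "term_val (Sc 1 0) = \<one>" by (simp add: Complex_eq)
  then show ?case using tends_const[OF one_closed] by (intro exI[of _ "\<lambda>_. Sc 1 0"]) simp
next
  case (add x y)
  then obtain s t where "tends sequentially (\<lambda>n. term_val (s n)) x"
    "tends sequentially (\<lambda>n. term_val (t n)) y" by blast
  then show ?case using tends_add by (intro exI[of _ "\<lambda>n. Add (s n) (t n)"]) simp
next
  case (mult x y)
  then obtain s t where "tends sequentially (\<lambda>n. term_val (s n)) x"
    "tends sequentially (\<lambda>n. term_val (t n)) y" by blast
  then show ?case using tends_mult by (intro exI[of _ "\<lambda>n. Mul (s n) (t n)"]) simp
next
  case (smult c x)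
  then obtain s where s: "tends sequentially (\<lambda>n. term_val (s n)) x" by blast
  obtain f g where f: "(\<lambda>n. real_of_rat (f n)) \<longlonglongrightarrow> Re c" and g: "(\<lambda>n. real_of_rat (g n)) \<longlonglongrightarrow> Im c"
    using rat_seq by blast
  have "(\<lambda>n. Complex (of_rat (f n)) (of_rat (g n))) \<longlonglongrightarrow> Complex (Re c) (Im c)"
    by (rule tendsto_Complex[OF f g])
  then have "tends sequentially (\<lambda>n. Complex (of_rat (f n)) (of_rat (g n)) \<odot> term_val (s n))
      (c \<odot> x)"
    using tends_smult s by simp
  then show ?case by (intro exI[of _ "\<lambda>n. Mul (Sc (f n) (g n)) (s n)"]) (simp add: sc_mult)
next
  case (star x)
  then obtain s where "tends sequentially (\<lambda>n. term_val (s n)) x" by blast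
  then show ?case using tends_star by (intro exI[of _ "\<lambda>n. Star (s n)"]) simp
next
  case (lim y L)
  have "\<exists>t. nrm A (y n \<ominus> term_val t) < 1 / real (Suc n)" for n
  proof -
    obtain s where "tends sequentially (\<lambda>n. term_val (s n)) (y n)" using lim by blast
    then have "(\<lambda>m. nrm A (term_val (s m) \<ominus> y n)) \<longlonglongrightarrow> 0" by (simp add: tends_def)
    from order_tendstoD(2)[OF this, of "1 / real (Suc n)"]
    obtain m where "nrm A (term_val (s m) \<ominus> y n) < 1 / real (Suc n)"
      by (auto simp: eventually_sequentially)
    then show ?thesis using nrm_diff_commute[of "term_val (s m)" "y n"] lim by auto
  qed
  then obtain t where t: "\<And>n. nrm A (y n \<ominus> term_val (t n)) < 1 / real (Suc n)" by metis
  have L: "L \<in> carrier A" using lim tends_closed by blast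
  have "tends sequentially (\<lambda>n. term_val (t n)) L"
  proof (rule tendsI)
    show "\<forall>\<^sub>F n in sequentially. nrm A (term_val (t n) \<ominus> L) \<le> 1 / real (Suc n) + nrm A (y n \<ominus> L)"
    proof (rule always_eventually, rule allI)
      fix n
      have "term_val (t n) \<ominus> L = (term_val (t n) \<ominus> y n) \<oplus> (y n \<ominus> L)"
        using L lim(1)[of n] term_val_closed[of "t n"]
        by (simp add: a_minus_def a_assoc r_neg1)
      then have "nrm A (term_val (t n) \<ominus> L) \<le> nrm A (term_val (t n) \<ominus> y n) + nrm A (y n \<ominus> L)"
        using nrm_triangle[of "term_val (t n) \<ominus> y n" "y n \<ominus> L"] L lim(1)[of n] by simp
      then show "nrm A (term_val (t n) \<ominus> L) \<le> 1 / real (Suc n) + nrm A (y n \<ominus> L)"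
        using t[of n] nrm_diff_commute[of "term_val (t n)" "y n"] lim(1)[of n] by simp
    qed
    have "(\<lambda>n. 1 / real (Suc n) + nrm A (y n \<ominus> L)) \<longlonglongrightarrow> 0 + 0"
      using lim by (intro tendsto_add LIMSEQ_inverse_real_of_nat[unfolded inverse_eq_divide])
        (auto simp: tends_def)
    then show "(\<lambda>n. 1 / real (Suc n) + nrm A (y n \<ominus> L)) \<longlonglongrightarrow> 0" by simp
  qed (use L in auto)
  then show ?case by blast
qed

text \<open>
  An element is determined by its distances to a countable dense set.
\<close>

lemma carrier_injection: "\<exists>\<iota> :: 'a \<Rightarrow> (nat \<Rightarrow> complex). inj_on \<iota> (carrier A)"
proof (intro exI inj_onI)
  fix x y assume x: "x \<in> carrier A" and y: "y \<in> carrier A"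
    and e: "(\<lambda>m. complex_of_real (nrm A (x \<ominus> term_val (from_nat m))))
        = (\<lambda>m. complex_of_real (nrm A (y \<ominus> term_val (from_nat m))))"
  have eq: "nrm A (x \<ominus> term_val t) = nrm A (y \<ominus> term_val t)" for t
    using fun_cong[OF e, of "to_nat t"] by simp
  obtain ts where ts: "tends sequentially (\<lambda>n. term_val (ts n)) x" using terms_dense[OF x] ..
  have "tends sequentially (\<lambda>n. term_val (ts n)) y"
    using ts y eq nrm_diff_commute[OF term_val_closed x] nrm_diff_commute[OF term_val_closed y]
      unfolding tends_def by simp
  then show "x = y" using tends_unique[OF ts] by simp
qed

text \<open>
  Row, column and coordinate are packed into one number.
\<close>

lemma matrix_injection: "\<exists>\<iota> :: 'a mtx \<Rightarrow> (nat \<Rightarrow> complex). inj_on \<iota> (carrier (matalg A k))"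
proof -
  obtain f :: "'a \<Rightarrow> (nat \<Rightarrow> complex)" where f: "inj_on f (carrier A)" using carrier_injection
    by blast
  show ?thesis
  proof (intro exI inj_onI)
    fix a b assume a: "a \<in> carrier (matalg A k)" and b: "b \<in> carrier (matalg A k)"
      and e: "(\<lambda>m. case prod_decode m of (i, m') \<Rightarrow> case prod_decode m' of (j, l) \<Rightarrow> f (a i j) l)
          = (\<lambda>m. case prod_decode m of (i, m') \<Rightarrow> case prod_decode m' of (j, l) \<Rightarrow> f (b i j) l)"
    have "f (a i j) l = f (b i j) l" for i j l
      using fun_cong[OF e, of "prod_encode (i, prod_encode (j, l))"] by simp
    then have "f (a i j) = f (b i j)" for i j by blast
    moreover have "a i j \<in> carrier A" "b i j \<in> carrier A" for i j using a b by (auto intro: matsD)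
    ultimately show "a = b" using inj_onD[OF f] by blast
  qed
qed

text \<open>
  The universal property for every target whose carrier injects into \<^typ>\<open>nat \<Rightarrow> complex\<close>: copy the
  target there, and carry the homomorphism back.
\<close>

lemma hom_exists:
  fixes B :: "'b cstar" and \<iota> :: "'b \<Rightarrow> nat \<Rightarrow> complex"
  assumes B: "unital_cstar_algebra B" and i: "inj_on \<iota> (carrier B)" and k: "sphere_relations n B k"
  shows "\<exists>\<phi>\<in>cstar_hom A B. \<forall>v\<in>V. \<phi> (h v) = k v"
proof -
  interpret B: unital_cstar_algebra B by (rule B)
  let ?T = "transport \<iota> B"
  have T: "unital_cstar_algebra ?T" by (rule B.unital_cstar_algebra_transport[OF i])
  have "cstar_morphism B ?T \<iota>"
    using B T B.transport_hom[OF i] by (simp add: cstar_morphismI)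
  then have "sphere_relations n ?T (\<lambda>v. \<iota> (k v))" by (rule cstar_morphism.sphere_relations) (rule k)
  then obtain \<phi> where \<phi>: "\<phi> \<in> cstar_hom A ?T" "\<And>v. v \<in> V \<Longrightarrow> \<phi> (h v) = \<iota> (k v)"
    using universal T unfolding universal_sphere_algebra_def by blast
  have "k v \<in> carrier B" if "v \<in> V" for v using k that B.posD unfolding B.sphere_relations_iff
    by blast
  then have "\<forall>v\<in>V. the_inv_into (carrier B) \<iota> (\<phi> (h v)) = k v"
    using \<phi>(2) the_inv_into_f_f[OF i] by simp
  then show ?thesis using cstar_hom_compose[OF \<phi>(1) B.transport_inv_hom[OF i]] by (intro bexI) auto
qed

text \<open>
  Continuity needs to be checked on generators only: as all \<open>\<Phi> t\<close> are contractive, the elements along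
  which the family is continuous form a closed *-subalgebra.
\<close>

lemma hom_homotopyI:
  assumes B: "unital_cstar_algebra B" and \<Phi>: "\<And>t. t \<in> {0..1} \<Longrightarrow> \<Phi> t \<in> cstar_hom A B"
    and gens: "\<And>v t. v \<in> V \<Longrightarrow> t \<in> {0..1}
        \<Longrightarrow> unital_cstar_algebra.tends B (at t within {0..1}) (\<lambda>s. \<Phi> s (h v)) (\<Phi> t (h v))"
  shows "hom_homotopy A B \<Phi>"
proof -
  interpret B: unital_cstar_algebra B by (rule B)
  have F: "cstar_morphism A B (\<Phi> t)" if "t \<in> {0..1}" for t
    using B \<Phi>[OF that] unital_cstar_algebra_axioms by (simp add: cstar_morphismI)
  note Fs = cstar_morphism.add[OF F] cstar_morphism.mult[OF F] cstar_morphism.smult[OF F]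
    cstar_morphism.star[OF F]
  have ev: "\<forall>\<^sub>F s in at t within {0..1}. s \<in> {0..1}" for t :: real
    unfolding eventually_at_filter by (rule always_eventually) auto
  have "B.tends (at t within {0..1}) (\<lambda>s. \<Phi> s x) (\<Phi> t x)" if t: "t \<in> {0..1}" and x: "x \<in> carrier A"
    for t x
    using x
  proof (induct rule: generated_induct)
    case (gen v) then show ?case using gens t by blast
  next
    case one
    have "\<forall>\<^sub>F s in at t within {0..1}. \<one>\<^bsub>B\<^esub> = \<Phi> s \<one>"
      using ev by (rule eventually_mono) (simp add: cstar_morphism.one[OF F])
    then show ?case using B.tends_cong[OF _ B.tends_const[OF B.one_closed]] t
      by (simp add: cstar_morphism.one[OF F])
  next
    case (add x y)
    have "\<forall>\<^sub>F s in at t within {0..1}. \<Phi> s x \<oplus>\<^bsub>B\<^esub> \<Phi> s y = \<Phi> s (x \<oplus> y)"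
      using ev by (rule eventually_mono) (simp add: Fs add)
    from B.tends_cong[OF this B.tends_add[OF add(3,4)]] show ?case using t add by (simp add: Fs)
  next
    case (mult x y)
    have "\<forall>\<^sub>F s in at t within {0..1}. \<Phi> s x \<otimes>\<^bsub>B\<^esub> \<Phi> s y = \<Phi> s (x \<otimes> y)"
      using ev by (rule eventually_mono) (simp add: Fs mult)
    from B.tends_cong[OF this B.tends_mult[OF mult(3,4)]] show ?case using t mult by (simp add: Fs)
  next
    case (smult c x)
    have "\<forall>\<^sub>F s in at t within {0..1}. c \<odot>\<^bsub>B\<^esub> \<Phi> s x = \<Phi> s (c \<odot> x)"
      using ev by (rule eventually_mono) (simp add: Fs smult)
    from B.tends_cong[OF this B.tends_smult[OF tendsto_const smult(2)]] show ?case using t smult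
      by (simp add: Fs)
  next
    case (star x)
    have "\<forall>\<^sub>F s in at t within {0..1}. star B (\<Phi> s x) = \<Phi> s (star A x)"
      using ev by (rule eventually_mono) (simp add: Fs star)
    from B.tends_cong[OF this B.tends_star[OF star(2)]] show ?case using t star by (simp add: Fs)
  next
    case (lim y L)
    have L: "L \<in> carrier A" using lim tends_closed by blast
    have cl: "\<Phi> s x \<in> carrier B" if "s \<in> {0..1}" "x \<in> carrier A" for s x
      using cstar_morphism.closed[OF F] that by blast
    have "((\<lambda>s. nrm B (\<Phi> s L \<ominus>\<^bsub>B\<^esub> \<Phi> t L)) \<longlongrightarrow> 0) (at t within {0..1})"
    proof (rule tendstoI)
      fix e :: real assume e: "0 < e"
      have "(\<lambda>n. nrm A (y n \<ominus> L)) \<longlonglongrightarrow> 0" using lim by (simp add: tends_def)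
      from order_tendstoD(2)[OF this, of "e/3"] e obtain m where m: "nrm A (y m \<ominus> L) < e / 3"
        by (auto simp: eventually_sequentially)
      have ym: "y m \<in> carrier A" using lim by blast
      have "((\<lambda>s. nrm B (\<Phi> s (y m) \<ominus>\<^bsub>B\<^esub> \<Phi> t (y m))) \<longlongrightarrow> 0) (at t within {0..1})"
        using lim(2)[of m] by (simp add: B.tends_def)
      from order_tendstoD(2)[OF this, of "e/3"] e
      have "\<forall>\<^sub>F s in at t within {0..1}. nrm B (\<Phi> s (y m) \<ominus>\<^bsub>B\<^esub> \<Phi> t (y m)) < e / 3" by simp
      then show "\<forall>\<^sub>F s in at t within {0..1}. dist (nrm B (\<Phi> s L \<ominus>\<^bsub>B\<^esub> \<Phi> t L)) 0 < e"
        using ev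
      proof eventually_elim
        case (elim s)
        have b: "nrm B (\<Phi> s (y m) \<ominus>\<^bsub>B\<^esub> \<Phi> s L) < e / 3" if "s \<in> {0..1}" for s
          using cstar_morphism.contractive[OF F[OF that], of "y m \<ominus> L"] cstar_morphism.diff[OF
            F[OF that], of "y m" L] m ym L by simp
        have c: "\<Phi> s L \<in> carrier B" "\<Phi> t L \<in> carrier B" "\<Phi> s (y m) \<in> carrier B"
          "\<Phi> t (y m) \<in> carrier B" using cl elim(2) t ym L by auto
        have "\<Phi> s L \<ominus>\<^bsub>B\<^esub> \<Phi> t L
            = (\<Phi> s L \<ominus>\<^bsub>B\<^esub> \<Phi> s (y m)) \<oplus>\<^bsub>B\<^esub> ((\<Phi> s (y m) \<ominus>\<^bsub>B\<^esub> \<Phi> t (y m)) \<oplus>\<^bsub>B\<^esub> (\<Phi> t (y m) \<ominus>\<^bsub>B\<^esub> \<Phi> t L))"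
          using c by (simp add: a_minus_def B.a_assoc B.r_neg1)
        then have "nrm B (\<Phi> s L \<ominus>\<^bsub>B\<^esub> \<Phi> t L)
            \<le> nrm B (\<Phi> s L \<ominus>\<^bsub>B\<^esub> \<Phi> s (y m)) +
          (nrm B (\<Phi> s (y m) \<ominus>\<^bsub>B\<^esub> \<Phi> t (y m)) + nrm B (\<Phi> t (y m) \<ominus>\<^bsub>B\<^esub> \<Phi> t L))"
          using c by (smt (verit) B.nrm_triangle B.minus_closed B.a_closed)
        then show ?case
          using b[OF elim(2)] b[OF t] elim(1) c B.nrm_diff_commute[OF c(1,3)]
            B.nrm_nonneg[of "\<Phi> s L \<ominus>\<^bsub>B\<^esub> \<Phi> t L"] by simp
      qed
    qed
    moreover have "\<forall>\<^sub>F s in at t within {0..1}. \<Phi> s L \<in> carrier B"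
      using ev by (rule eventually_mono) (use cl L in auto)
    ultimately show ?case using cl L t by (simp add: B.tends_def)
  qed
  then show ?thesis using \<Phi> by (simp add: hom_homotopy_def)
qed

end

section \<open>Contractions and the rotation\<close>

context unital_cstar_algebra
begin

lemma finsum_pair_split:
  assumes "finite S" "a \<in> S" "b \<in> S" "a \<noteq> b" "\<And>x. x \<in> S \<Longrightarrow> f x \<in> carrier A"
  shows "finsum A f S = (f a \<oplus> f b) \<oplus> finsum A f (S - {a, b})"
proof -
  have e: "S = insert a (insert b (S - {a, b}))" using assms by auto
  have "finsum A f (insert a (insert b (S - {a, b}))) = f a \<oplus> (f b \<oplus> finsum A f (S - {a, b}))"
    using assms by (subst finsum_insert; (subst finsum_insert)?) auto
  moreover have "finsum A f (S - {a, b}) \<in> carrier A" using assms by (intro finsum_closed) auto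
  ultimately show ?thesis using e assms by (simp add: a_assoc)
qed

lemma relations_cong:
  assumes k: "sphere_relations n A k" and e: "\<And>v. v \<in> sphere_vertices n \<Longrightarrow> k' v = k v"
  shows "sphere_relations n A k'"
proof -
  note K = k[unfolded sphere_relations_iff]
  have "finsum A k' (sphere_vertices n) = finsum A k (sphere_vertices n)"
    by (rule finsum_cong') (use K e posD in auto)
  then show ?thesis unfolding sphere_relations_iff using K e by simp
qed

text \<open>
  The relations involve the values at \<open>v\<close> and \<open>opp v\<close> only through their product and their sum, so they
  may be taken from another family with the same sum there.
\<close>

lemma replace_relations:
  assumes k: "sphere_relations n A k" and g: "sphere_relations n A g" and v: "v \<in> sphere_vertices n"
    and sum: "g v \<oplus> g (opp v) = k v \<oplus> k (opp v)"
  shows "sphere_relations n A (\<lambda>u. if u \<in> {v, opp v} then g u else k u)"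
    (is "sphere_relations n A ?f")
proof -
  let ?V = "sphere_vertices n"
  note K = k[unfolded sphere_relations_iff] and G = g[unfolded sphere_relations_iff]
  have kc: "u \<in> ?V \<Longrightarrow> k u \<in> carrier A" and gc: "u \<in> ?V \<Longrightarrow> g u \<in> carrier A" for u using K G posD
    by auto
  have "finsum A ?f (?V - {v, opp v}) = finsum A k (?V - {v, opp v})"
    by (rule finsum_cong') (use kc in auto)
  then have "finsum A ?f ?V = \<one>"
    using finsum_pair_split[of ?V v "opp v" ?f] finsum_pair_split[of ?V v "opp v"
      k] K v kc gc sum by simp
  moreover have "opp u \<in> {v, opp v} \<longleftrightarrow> u \<in> {v, opp v}" for u by (metis insert_iff opp_opp singletonD)
  then have "?f u \<otimes> ?f (opp u) = \<zero>" if "u \<in> ?V" for u using K G that by auto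
  ultimately show ?thesis unfolding sphere_relations_iff using K G by auto
qed

lemma point_relations:
  assumes "v \<in> sphere_vertices n" shows "sphere_relations n A (\<lambda>u. if u = v then \<one> else \<zero>)"
proof -
  have "finsum A (\<lambda>u. if v = u then \<one> else \<zero>) (sphere_vertices n) = \<one>"
    using assms finsum_singleton[of v "sphere_vertices n" "\<lambda>_. \<one>"] by simp
  moreover have "pos \<one>" using pos_rsc[of 1] by simp
  ultimately show ?thesis unfolding sphere_relations_iff by (auto simp: eq_commute)
qed

text \<open>
  The orthogonality relations at all pairs other than \<open>{v, opp v}\<close> are homogeneous, and at this pair
  one factor is \<open>0\<close> throughout. The missing mass \<open>1 - t\<close> is put at \<open>v\<close>.
\<close>

lemma contraction_relations:
  assumes k: "sphere_relations n A k" and v: "v \<in> sphere_vertices n" "k (opp v) = \<zero>"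
    and t: "0 \<le> t" "t \<le> 1"
  shows "sphere_relations n A (\<lambda>u. complex_of_real t \<odot> k u \<oplus> (if u = v then rsc (1 - t) else \<zero>))"
    (is "sphere_relations n A ?f")
proof -
  let ?V = "sphere_vertices n"
  note K = k[unfolded sphere_relations_iff]
  have kc: "u \<in> ?V \<Longrightarrow> k u \<in> carrier A" for u using K posD by auto
  have "finsum A ?f ?V = finsum A (\<lambda>u. complex_of_real t \<odot> k u) ?V
      \<oplus> finsum A (\<lambda>u. if u = v then rsc (1 - t) else \<zero>) ?V"
    using kc by (intro finsum_addf) auto
  also have "finsum A (\<lambda>u. complex_of_real t \<odot> k u) ?V = complex_of_real t \<odot> finsum A k ?V"
    using kc by (intro sc_finsum[symmetric]) auto
  also have "finsum A (\<lambda>u. if u = v then rsc (1 - t) else \<zero>) ?V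
      = finsum A (\<lambda>u. if v = u then rsc (1 - t) else \<zero>) ?V"
    by (rule finsum_cong') auto
  also have "\<dots> = rsc (1 - t)" using v finsum_singleton[of v ?V "\<lambda>_. rsc (1 - t)"] by simp
  also have "complex_of_real t \<odot> finsum A k ?V \<oplus> rsc (1 - t) = rsc (t + (1 - t))"
    using K by (simp only: rsc_add)
  finally have "finsum A ?f ?V = \<one>" by simp
  moreover have "pos (?f u)" if "u \<in> ?V" for u
  proof (cases "u = v")
    case True
    have "pos (complex_of_real t \<odot> k u \<oplus> rsc (1 - t))" using K that t
      by (intro pos_add pos_scale pos_rsc) auto
    then show ?thesis using True by simp
  next
    case False
    have "pos (complex_of_real t \<odot> k u)" using K that t by (intro pos_scale) auto
    then show ?thesis using False kc[OF that] by simp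
  qed
  moreover have "?f u \<otimes> ?f (opp u) = \<zero>" if u: "u \<in> ?V" for u
  proof -
    consider "u = v" | "opp u = v" | "u \<noteq> v" "opp u \<noteq> v" by blast
    then show ?thesis
    proof cases
      case 1 then show ?thesis using v kc by simp
    next
      case 2
      then have "u = opp v" by auto
      then show ?thesis using v kc by simp
    next
      case 3
      then show ?thesis using K u kc by (simp add: sc_mult)
    qed
  qed
  ultimately show ?thesis unfolding sphere_relations_iff by blast
qed

lemma conj_hom:
  assumes R: "unitary R" shows "(\<lambda>x. R \<otimes> x \<otimes> star A R) \<in> cstar_hom A A"
proof -
  have c: "R \<in> carrier A" using R by simp
  have m: "R \<otimes> (x \<otimes> y) \<otimes> star A R = R \<otimes> x \<otimes> star A R \<otimes> (R \<otimes> y \<otimes> star A R)"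
    if "x \<in> carrier A" "y \<in> carrier A" for x y
  proof -
    have "R \<otimes> x \<otimes> star A R \<otimes> (R \<otimes> y \<otimes> star A R) = R \<otimes> x \<otimes> (star A R \<otimes> R) \<otimes> (y \<otimes> star A R)"
      using that c by (simp only: m_assoc m_closed star_closed)
    then show ?thesis using that c R by (simp add: m_assoc)
  qed
  show ?thesis unfolding cstar_hom_def
    using c R m by (auto intro!: ring_hom_memI simp: l_distr r_distr sc_mult star_mult m_assoc)
qed

lemma diag_pair_closed [simp]: "x \<in> carrier A \<Longrightarrow> y \<in> carrier A \<Longrightarrow> diag_pair A x y \<in> mats A 2 2"
  by (rule matsI) (auto simp: diag_pair_def)

lemma diag_pair_mult:
  assumes "x \<in> carrier A" "y \<in> carrier A" "x' \<in> carrier A" "y' \<in> carrier A"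
  shows "mtx_mult A 2 (diag_pair A x y) (diag_pair A x' y') = diag_pair A (x \<otimes> x') (y \<otimes> y')"
  by (intro ext)
    (use assms in
    \<open>simp add: mtx_mult_2[OF diag_pair_closed diag_pair_closed]; simp add: diag_pair_def\<close>)

lemma diag_pair_add: "mtx_add A (diag_pair A x y) (diag_pair A x' y')
    = diag_pair A (x \<oplus> x') (y \<oplus> y')"
  by (auto simp: mtx_add_def diag_pair_def intro!: ext)

lemma diag_pair_one: "diag_pair A \<one> \<one> = mtx_one A 2"
  by (auto simp: diag_pair_def mtx_one_def intro!: ext)

lemma diag_pair_smult: "mtx_smult A c (diag_pair A x y) = diag_pair A (c \<odot> x) (c \<odot> y)"
  by (auto simp: mtx_smult_def diag_pair_def intro!: ext)

lemma diag_pair_star: "mtx_star A (diag_pair A x y) = diag_pair A (star A x) (star A y)"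
  by (auto simp: mtx_star_def diag_pair_def intro!: ext)

lemma quarter_turn_diag_pair:
  assumes "x \<in> carrier A" "y \<in> carrier A"
  shows "mtx_mult A 2 (quarter_turn 1) (diag_pair A x y)
      = mtx_mult A 2 (diag_pair A y x) (quarter_turn 1)"
proof -
  define e where "e z = (\<lambda>i j. if i = (0::nat) \<and> j = (0::nat) then z else \<zero>)" for z
  have c: "z \<in> carrier A \<Longrightarrow> e z \<in> mats A 1 1" for z by (rule matsI) (auto simp: e_def)
  have d: "diag_pair A z z' = diag_blocks 1 1 (e z) (e z')" for z z'
    by (auto simp: diag_pair_def block_mtx_def e_def mtx_zero_def intro!: ext)
  show ?thesis unfolding d using quarter_turn_mult[OF c[OF assms(1)] c[OF assms(2)]]
    by (simp only: one_add_one)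
qed

lemma quarter_turn_facts:
  "quarter_turn 1 \<in> carrier (matalg A 2)"
  "star (matalg A 2) (quarter_turn 1) = \<ominus>\<^bsub>matalg A 2\<^esub> quarter_turn 1"
  "quarter_turn 1 \<otimes>\<^bsub>matalg A 2\<^esub> quarter_turn 1 = \<ominus>\<^bsub>matalg A 2\<^esub> \<one>\<^bsub>matalg A 2\<^esub>"
proof -
  show J: "quarter_turn 1 \<in> carrier (matalg A 2)" using quarter_turn_closed[of 1]
    by (simp only: one_add_one matalg_simps)
  show "star (matalg A 2) (quarter_turn 1) = \<ominus>\<^bsub>matalg A 2\<^esub> quarter_turn 1"
    using J by (simp only: matalg_simps quarter_turn_star matalg_neg)
  show "quarter_turn 1 \<otimes>\<^bsub>matalg A 2\<^esub> quarter_turn 1 = \<ominus>\<^bsub>matalg A 2\<^esub> \<one>\<^bsub>matalg A 2\<^esub>"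
    using quarter_turn_square[of 1]
      by (simp only: matalg_simps one_add_one matalg_neg[OF mtx_one_closed])
qed

end

lemma diag_hom:
  assumes A: "unital_cstar_algebra A" and B: "unital_cstar_algebra B"
    and "\<alpha> \<in> cstar_hom A B" "\<beta> \<in> cstar_hom A B"
  shows "(\<lambda>x. diag_pair B (\<alpha> x) (\<beta> x)) \<in> cstar_hom A (matalg B 2)"
proof -
  interpret F: cstar_morphism A B \<alpha> using assms by (simp add: cstar_morphismI)
  interpret G: cstar_morphism A B \<beta> using assms by (simp add: cstar_morphismI)
  show ?thesis unfolding cstar_hom_def
    by (auto intro!: ring_hom_memI simp: F.B.diag_pair_mult F.B.diag_pair_add F.B.diag_pair_one
      F.B.diag_pair_smult F.B.diag_pair_star
      F.mult G.mult F.add G.add F.smult G.smult F.star G.star)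
qed

context sphere_algebra
begin

text \<open>
  By the universal property a path of families satisfying the relations is a homotopy of
  homomorphisms. The homomorphisms at the ends are prescribed, so that no uniqueness is needed.
\<close>

lemma path_hom:
  fixes B :: "'b cstar" and \<iota> :: "'b \<Rightarrow> nat \<Rightarrow> complex" and K :: "real \<Rightarrow> vertex \<Rightarrow> 'b"
  assumes B: "unital_cstar_algebra B" and i: "inj_on \<iota> (carrier B)"
    and K: "\<And>t. t \<in> {0..1} \<Longrightarrow> sphere_relations n B (K t)"
    and cont: "\<And>t u. u \<in> V \<Longrightarrow> t \<in> {0..1}
        \<Longrightarrow> unital_cstar_algebra.tends B (at t within {0..1}) (\<lambda>s. K s u) (K t u)"
    and \<alpha>: "\<alpha> \<in> cstar_hom A B" "\<And>u. u \<in> V \<Longrightarrow> \<alpha> (h u) = K 0 u"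
    and \<beta>: "\<beta> \<in> cstar_hom A B" "\<And>u. u \<in> V \<Longrightarrow> \<beta> (h u) = K 1 u"
  shows "\<exists>\<Phi>. hom_homotopy A B \<Phi> \<and> \<Phi> 0 = \<alpha> \<and> \<Phi> (1::real) = \<beta>"
proof -
  interpret B: unital_cstar_algebra B by (rule B)
  have "\<forall>t\<in>{0..1}. \<exists>\<phi>. \<phi> \<in> cstar_hom A B \<and> (\<forall>u\<in>V. \<phi> (h u) = K t u)"
    using hom_exists[OF B i K] by blast
  then obtain \<Psi> where \<Psi>: "\<And>t. t \<in> {0..1} \<Longrightarrow> \<Psi> t \<in> cstar_hom A B \<and> (\<forall>u\<in>V. \<Psi> t (h u) = K t u)"
    by (metis (no_types, lifting))
  define \<Phi> where "\<Phi> t = (if t = 0 then \<alpha> else if t = 1 then \<beta> else \<Psi> t)" for t :: real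
  have h: "\<Phi> t \<in> cstar_hom A B" and e: "u \<in> V \<Longrightarrow> \<Phi> t (h u) = K t u" if "t \<in> {0..1}" for t u
    using \<Psi>[OF that] \<alpha> \<beta> by (auto simp: \<Phi>_def)
  have "hom_homotopy A B \<Phi>"
  proof (rule hom_homotopyI[OF B h])
    fix v t assume v: "v \<in> V" and t: "t \<in> {0..1::real}"
    have "\<forall>\<^sub>F s in at t within {0..1}. K s v = \<Phi> s (h v)"
      unfolding eventually_at_filter by (rule always_eventually) (use e v in auto)
    from B.tends_cong[OF this cont[OF v t]]
    show "B.tends (at t within {0..1}) (\<lambda>s. \<Phi> s (h v)) (\<Phi> t (h v))" using e[OF t v] by simp
  qed
  then show ?thesis by (intro exI[of _ \<Phi>]) (simp add: \<Phi>_def)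
qed

text \<open>
  Equality of the maps induced on K-theory.
\<close>

definition K_equal :: "('a \<Rightarrow> 'a) \<Rightarrow> ('a \<Rightarrow> 'a) \<Rightarrow> bool" where
  "K_equal \<alpha> \<beta> \<longleftrightarrow> (\<forall>p\<in>projections A. K0.stably (sqmtx_map \<alpha> p) (sqmtx_map \<beta> p)) \<and>
     (\<forall>u\<in>unitaries A. stably_homotopic (sqmtx_map \<alpha> u) (sqmtx_map \<beta> u))"

interpretation S: comm_congruence "projections A" "block_sum A" K0.stably
  by (rule K0.stably_congruence)

lemma K_equal_sym: "K_equal \<alpha> \<beta> \<Longrightarrow> K_equal \<beta> \<alpha>"
  unfolding K_equal_def using S.R_sym stably_homotopic_sym by blast

lemma K_equal_trans: "K_equal \<alpha> \<beta> \<Longrightarrow> K_equal \<beta> \<gamma> \<Longrightarrow> K_equal \<alpha> \<gamma>"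
  unfolding K_equal_def using S.R_trans stably_homotopic_trans by blast

lemma K_equal_homotopy: "hom_homotopy A A \<Phi> \<Longrightarrow> K_equal (\<Phi> 0) (\<Phi> 1)"
  unfolding K_equal_def
    using homotopy_invariance[OF unital_cstar_algebra_axioms unital_cstar_algebra_axioms]
    K0.R_imp_stably homotopic_stably_homotopic by blast

lemma K_equal_contraction:
  assumes v: "v \<in> V" "k (opp v) = \<zero>" and k: "sphere_relations n A k"
    and \<alpha>: "\<alpha> \<in> cstar_hom A A" "\<And>u. u \<in> V \<Longrightarrow> \<alpha> (h u) = k u"
    and \<pi>: "\<pi> \<in> cstar_hom A A" "\<And>u. u \<in> V \<Longrightarrow> \<pi> (h u) = (if u = v then \<one> else \<zero>)"
  shows "K_equal \<alpha> \<pi>"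
proof -
  obtain \<iota> :: "'a \<Rightarrow> nat \<Rightarrow> complex" where i: "inj_on \<iota> (carrier A)" using carrier_injection by blast
  have kc: "u \<in> V \<Longrightarrow> k u \<in> carrier A" for u using k posD unfolding sphere_relations_iff by auto
  define K where "K t u = complex_of_real t \<odot> k u \<oplus> (if u = v then rsc (1 - t) else \<zero>)" for t u
  have "\<exists>\<Phi>. hom_homotopy A A \<Phi> \<and> \<Phi> 0 = \<pi> \<and> \<Phi> (1::real) = \<alpha>"
  proof (rule path_hom[OF unital_cstar_algebra_axioms i, of K])
    show "sphere_relations n A (K t)" if "t \<in> {0..1}" for t
      unfolding K_def using contraction_relations[OF k v] that by simp
    show "tends (at t within {0..1}) (\<lambda>s. K s u) (K t u)" if "u \<in> V" for u t
    proof (cases "u = v")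
      case True
      have "tends (at t within {0..1}) (\<lambda>s. complex_of_real s \<odot> k u \<oplus> complex_of_real (1 - s) \<odot> \<one>)
        (complex_of_real t \<odot> k u \<oplus> complex_of_real (1 - t) \<odot> \<one>)"
        by (intro tends_add tends_smult tends_const kc that one_closed tendsto_intros)
      then show ?thesis unfolding K_def using True by simp
    next
      case False
      have "tends (at t within {0..1}) (\<lambda>s. complex_of_real s \<odot> k u \<oplus> \<zero>) (complex_of_real t \<odot> k u
          \<oplus> \<zero>)"
        by (intro tends_add tends_smult tends_const kc that zero_closed tendsto_intros)
      then show ?thesis unfolding K_def using False by simp
    qed
  qed (use \<alpha> \<pi> kc in \<open>auto simp: K_def\<close>)
  then show ?thesis using K_equal_homotopy K_equal_sym by metis
qed

text \<open>
  Start with the diagonal family \<open>D u = diag (h u, g u)\<close> and conjugate its values at \<open>v\<close> and \<open>opp v\<close> by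
  the rotation \<open>R t\<close>. Since \<open>D v + D (opp v)\<close> commutes with \<open>R t\<close>, the relations persist, and at the
  end of the quarter turn \<open>h\<close> and \<open>g\<close> have exchanged their values at the pair.
\<close>

lemma exchange_homotopy:
  assumes v: "v \<in> V" and relg: "sphere_relations n A g"
    and sum: "g v \<oplus> g (opp v) = h v \<oplus> h (opp v)"
    and \<gamma>: "\<gamma> \<in> cstar_hom A A" "\<And>u. u \<in> V \<Longrightarrow> \<gamma> (h u) = g u"
    and \<phi>: "\<phi> \<in> cstar_hom A A" "\<And>u. u \<in> V \<Longrightarrow> \<phi> (h u) = (if u \<in> {v, opp v} then g u else h u)"
    and \<psi>: "\<psi> \<in> cstar_hom A A" "\<And>u. u \<in> V \<Longrightarrow> \<psi> (h u) = (if u \<in> {v, opp v} then h u else g u)"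
  shows "\<exists>\<Phi>. hom_homotopy A (matalg A 2) \<Phi> \<and>
    \<Phi> 0 = (\<lambda>x. diag_pair A x (\<gamma> x)) \<and> \<Phi> (1::real) = (\<lambda>x. diag_pair A (\<phi> x) (\<psi> x))"
proof -
  define M where "M = matalg A 2"
  note ax = unital_cstar_algebra_axioms
  interpret M: unital_cstar_algebra M unfolding M_def by (rule unital_cstar_algebra_matalg)
  note M_simps = matalg_simps[of 2, folded M_def]
  note J = quarter_turn_facts[folded M_def]
  obtain \<iota> :: "'a mtx \<Rightarrow> nat \<Rightarrow> complex" where i: "inj_on \<iota> (carrier M)"
    unfolding M_def using matrix_injection by blast
  have gc: "u \<in> V \<Longrightarrow> g u \<in> carrier A" for u using relg posD unfolding sphere_relations_iff by auto
  define c where "c = h v \<oplus> h (opp v)"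
  have cc: "c \<in> carrier A" using v by (simp add: c_def)
  define D where "D u = diag_pair A (h u) (g u)" for u
  have Dc: "D u \<in> carrier M" if "u \<in> V" for u unfolding D_def M_simps using gc that by simp
  define R where "R t = M.rot (quarter_turn 1) t" for t
  define H where "H t u = (if u \<in> {v, opp v} then R t \<otimes>\<^bsub>M\<^esub> D u \<otimes>\<^bsub>M\<^esub> star M (R t) else D u)" for t u
  define \<Delta>0 where "\<Delta>0 = (\<lambda>x. diag_pair A x (\<gamma> x))"
  define \<Delta>1 where "\<Delta>1 = (\<lambda>x. diag_pair A (\<phi> x) (\<psi> x))"
  have \<Delta>0: "\<Delta>0 \<in> cstar_hom A M"
    unfolding \<Delta>0_def M_def by (rule diag_hom[OF ax ax cstar_hom_ident \<gamma>(1)])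
  have \<Delta>1: "\<Delta>1 \<in> cstar_hom A M"
    unfolding \<Delta>1_def M_def by (rule diag_hom[OF ax ax \<phi>(1) \<psi>(1)])
  have relD: "sphere_relations n M D"
    by (rule M.relations_cong
          [OF cstar_morphism.sphere_relations[OF cstar_morphismI[OF ax M.unital_cstar_algebra_axioms
            \<Delta>0] rel]])
       (simp add: \<Delta>0_def D_def \<gamma>(2))
  have Ru: "M.unitary (R t)" for t unfolding R_def by (rule M.rot_unitary[OF J])
  have Rc: "R t \<in> carrier M" for t using Ru M.unitaryD(1) by blast
  define E where "E = D v \<oplus>\<^bsub>M\<^esub> D (opp v)"
  have E: "E = diag_pair A c c" unfolding E_def D_def M_simps diag_pair_add using sum
    by (simp add: c_def)
  have Ec: "E \<in> carrier M" unfolding E M_simps using cc by simp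
  \<comment> \<open>\<open>E\<close> is a scalar matrix over \<open>A\<close>, so it commutes with the rotations, whose entries are complex.\<close>
  have RE: "R t \<otimes>\<^bsub>M\<^esub> E = E \<otimes>\<^bsub>M\<^esub> R t" for t
  proof -
    have "quarter_turn 1 \<otimes>\<^bsub>M\<^esub> E = E \<otimes>\<^bsub>M\<^esub> quarter_turn 1" unfolding E M_simps
      by (rule quarter_turn_diag_pair[OF cc cc])
    then show ?thesis unfolding R_def M.rot_def using J(1) Ec
      by (simp add: M.l_distr M.r_distr M.sc_mult)
  qed
  have relH: "sphere_relations n M (H t)" for t
  proof -
    have relC: "sphere_relations n M (\<lambda>u. R t \<otimes>\<^bsub>M\<^esub> D u \<otimes>\<^bsub>M\<^esub> star M (R t))"
      by (rule cstar_morphism.sphere_relations[OF cstar_morphismI relD])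
         (rule M.unital_cstar_algebra_axioms M.conj_hom[OF Ru])+
    have "R t \<otimes>\<^bsub>M\<^esub> D v \<otimes>\<^bsub>M\<^esub> star M (R t) \<oplus>\<^bsub>M\<^esub> R t \<otimes>\<^bsub>M\<^esub> D (opp v) \<otimes>\<^bsub>M\<^esub> star M (R t) =
       R t \<otimes>\<^bsub>M\<^esub> E \<otimes>\<^bsub>M\<^esub> star M (R t)"
      unfolding E_def using Rc[of t] Dc v by (simp add: M.l_distr M.r_distr)
    also have "\<dots> = E"
      unfolding RE using Rc[of t] Ec M.unitaryD(3)[OF Ru] by (simp add: M.m_assoc)
    finally show ?thesis unfolding H_def
      by (intro M.replace_relations[OF relD relC v]) (simp add: E_def)
  qed
  have contH: "M.tends (at t within {0..1}) (\<lambda>s. H s u) (H t u)" if u: "u \<in> V" for t u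
  proof -
    have "M.tends (at t within {0..1}) R (R t)" unfolding R_def by (rule M.rot_tends[OF J(1)])
    then have "M.tends (at t within {0..1}) (\<lambda>s. R s \<otimes>\<^bsub>M\<^esub> D u \<otimes>\<^bsub>M\<^esub> star M (R s))
      (R t \<otimes>\<^bsub>M\<^esub> D u \<otimes>\<^bsub>M\<^esub> star M (R t))"
      by (intro M.tends_mult M.tends_star M.tends_const Dc[OF u])
    then show ?thesis
      using M.tends_const[OF Dc[OF u]] unfolding H_def by (cases "u \<in> {v, opp v}") simp_all
  qed
  have H0: "\<Delta>0 (h u) = H 0 u" if u: "u \<in> V" for u
  proof -
    have "R 0 = \<one>\<^bsub>M\<^esub>" unfolding R_def by (rule M.rot_0[OF J(1)])
    then have "H 0 u = D u" unfolding H_def using Dc[OF u] by simp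
    then show ?thesis using \<gamma>(2)[OF u] by (simp add: \<Delta>0_def D_def)
  qed
  have H1: "\<Delta>1 (h u) = H 1 u" if u: "u \<in> V" for u
  proof (cases "u \<in> {v, opp v}")
    case True
    have R_one: "R 1 = quarter_turn 1" unfolding R_def by (rule M.rot_1[OF J(1)])
    have sw: "diag_pair A (g u) (h u) \<in> carrier M" unfolding M_simps using gc u by simp
    have "R 1 \<otimes>\<^bsub>M\<^esub> D u = diag_pair A (g u) (h u) \<otimes>\<^bsub>M\<^esub> R 1"
      unfolding R_one D_def M_simps by (rule quarter_turn_diag_pair) (use gc u in auto)
    then have "H 1 u = diag_pair A (g u) (h u)"
      unfolding H_def using True sw Rc[of 1] M.unitaryD(3)[OF Ru, of 1] by (simp add: M.m_assoc)
    then show ?thesis using True \<phi>(2)[OF u] \<psi>(2)[OF u] by (simp add: \<Delta>1_def)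
  next
    case False
    then show ?thesis using \<phi>(2)[OF u] \<psi>(2)[OF u] by (simp add: \<Delta>1_def H_def D_def)
  qed
  show ?thesis
    using path_hom[OF M.unital_cstar_algebra_axioms i relH contH \<Delta>0 H0 \<Delta>1 H1]
    unfolding M_def \<Delta>0_def \<Delta>1_def .
qed

text \<open>
  In K-theory the exchange homotopy reads \<open>id + \<gamma> = \<phi> + \<psi>\<close>. If \<open>\<gamma>\<close>, \<open>\<phi>\<close> and \<open>\<psi>\<close> all agree with \<open>\<pi>\<close>
  there, then \<open>id + \<pi> = \<pi> + \<pi>\<close>, and \<open>\<pi>\<close> cancels.
\<close>

lemma K_equal_of_exchange:
  assumes \<Phi>: "hom_homotopy A (matalg A 2) \<Phi>" "\<Phi> 0 = (\<lambda>x. diag_pair A x (\<gamma> x))"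
      "\<Phi> (1::real) = (\<lambda>x. diag_pair A (\<phi> x) (\<psi> x))"
    and hom: "\<gamma> \<in> cstar_hom A A" "\<phi> \<in> cstar_hom A A" "\<psi> \<in> cstar_hom A A" "\<pi> \<in> cstar_hom A A"
    and K_equal: "K_equal \<gamma> \<pi>" "K_equal \<phi> \<pi>" "K_equal \<psi> \<pi>"
  shows "K_equal \<pi> (\<lambda>x. x)"
proof -
  note ax = unital_cstar_algebra_axioms
  have inv: "p \<in> projections A \<Longrightarrow>
      mvn (block_sum A p (sqmtx_map \<gamma> p)) (block_sum A (sqmtx_map \<phi> p) (sqmtx_map \<psi> p))"
      "p \<in> unitaries A \<Longrightarrow>
      homotopic (block_sum A p (sqmtx_map \<gamma> p)) (block_sum A (sqmtx_map \<phi> p) (sqmtx_map \<psi> p))" for p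
    using homotopy_invariance_amplify[OF ax ax \<Phi>(1) _ _ cstar_hom_ident hom(1-3), of p] \<Phi>(2,3)
    by (auto simp: sqmtx_map_ident)
  interpret P: cstar_morphism A A \<pi> by (rule cstar_morphismI[OF ax ax hom(4)])
  show ?thesis unfolding K_equal_def sqmtx_map_ident
  proof (intro conjI ballI)
    fix p assume p: "p \<in> projections A"
    let ?p = "sqmtx_map \<pi> p"
    have pp: "?p \<in> projections A" by (rule P.sqmtx_map_projections[OF p])
    have "K0.stably (block_sum A ?p ?p) (block_sum A (sqmtx_map \<phi> p) (sqmtx_map \<psi> p))"
      using K_equal(2,3) p unfolding K_equal_def by (intro S.R_cong S.R_sym[of _ ?p]) auto
    also have "K0.stably (block_sum A (sqmtx_map \<phi> p) (sqmtx_map \<psi> p))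
        (block_sum A p (sqmtx_map \<gamma> p))"
      by (rule S.R_sym[OF K0.R_imp_stably[OF inv(1)[OF p]]])
    also have "K0.stably (block_sum A p (sqmtx_map \<gamma> p)) (block_sum A p ?p)"
      using K_equal(1) p unfolding K_equal_def by (intro S.R_cong S.R_refl) auto
    finally show "K0.stably ?p p" by (rule K0.stably_cancel[OF pp p pp])
  next
    fix p assume p: "p \<in> unitaries A"
    let ?p = "sqmtx_map \<pi> p"
    have pp: "?p \<in> unitaries A" by (rule P.sqmtx_map_unitaries[OF p])
    have "stably_homotopic (block_sum A ?p ?p) (block_sum A (sqmtx_map \<phi> p) (sqmtx_map \<psi> p))"
      using K_equal(2,3) p unfolding K_equal_def
        by (intro K1.R_cong stably_homotopic_sym[of _ ?p]) auto
    moreover have "stably_homotopic (block_sum A (sqmtx_map \<phi> p) (sqmtx_map \<psi> p))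
        (block_sum A p (sqmtx_map \<gamma> p))"
      by (rule stably_homotopic_sym[OF homotopic_stably_homotopic[OF inv(2)[OF p]]])
    moreover have "stably_homotopic (block_sum A p (sqmtx_map \<gamma> p)) (block_sum A p ?p)"
      using K_equal(1) p unfolding K_equal_def by (intro K1.R_cong stably_homotopic_refl) auto
    ultimately have "stably_homotopic (block_sum A ?p ?p) (block_sum A p ?p)"
      using stably_homotopic_trans by blast
    then show "stably_homotopic ?p p" by (rule stably_homotopic_cancel[OF _ pp p pp])
  qed
qed

text \<open>
  Families supported on the edge from \<open>v\<close> to \<open>w\<close>, with barycentric coordinates \<open>c\<close> and \<open>1 - c\<close> in \<open>A\<close>.
\<close>

lemma segment_relations:
  assumes v: "v \<in> V" and w: "w \<in> V" "w \<noteq> v" "w \<noteq> opp v" and c: "pos c" "pos (\<one> \<ominus> c)"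
  shows "sphere_relations n A (\<lambda>u. (if v = u then c else \<zero>) \<oplus> (if w = u then \<one> \<ominus> c else \<zero>))"
    (is "sphere_relations n A ?g")
  unfolding sphere_relations_iff
proof (intro conjI ballI)
  have cc: "c \<in> carrier A" using c posD by blast
  have "finsum A ?g V = finsum A (\<lambda>u. if v = u then c else \<zero>) V
      \<oplus> finsum A (\<lambda>u. if w = u then \<one> \<ominus> c else \<zero>) V"
    using cc by (intro finsum_addf) auto
  also have "\<dots> = c \<oplus> (\<one> \<ominus> c)"
    using finsum_singleton[of v V "\<lambda>_. c"] finsum_singleton[of w V "\<lambda>_. \<one> \<ominus> c"] cc v w by simp
  also have "\<dots> = \<one>" using cc by algebra
  finally show "finsum A ?g V = \<one>" .
  fix u
  show "pos (?g u)" using c by (intro pos_add) auto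
  show "?g u \<otimes> ?g (opp u) = \<zero>"
  proof (cases "u = v \<or> u = w")
    case True
    have "opp w \<noteq> v" using w by auto
    then show ?thesis using True w cc by auto
  next
    case False then show ?thesis using cc w by auto
  qed
qed

text \<open>
  Apply the exchange at \<open>{v, opp v}\<close> to \<open>h\<close> and to the family \<open>g\<close> on the edge from \<open>v\<close> to \<open>w\<close> whose value
  at \<open>v\<close> is \<open>c = h v + h (opp v)\<close>. All families in sight but \<open>h\<close> vanish at some vertex, so they can
  be contracted to the opposite one.
\<close>

theorem K_equal_ident_point:
  assumes n: "1 \<le> n" and v: "v \<in> V"
    and \<pi>: "\<pi> \<in> cstar_hom A A" "\<And>u. u \<in> V \<Longrightarrow> \<pi> (h u) = (if u = v then \<one> else \<zero>)"
  shows "K_equal \<pi> (\<lambda>x. x)"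
proof -
  note ax = unital_cstar_algebra_axioms
  obtain \<iota> :: "'a \<Rightarrow> nat \<Rightarrow> complex" where i: "inj_on \<iota> (carrier A)" using carrier_injection by blast
  \<comment> \<open>Here \<open>n \<ge> 1\<close> enters: there is a vertex \<open>w\<close> outside the pair \<open>{v, opp v}\<close>.\<close>
  define w :: vertex where "w = (if fst v = 0 then 1 else 0, Plus)"
  have w: "w \<in> V" "w \<noteq> v" "w \<noteq> opp v" "opp w \<noteq> v" "opp w \<noteq> opp v"
    using n by (cases v rule: opp.cases; auto simp: w_def sphere_vertices_def)+
  have ov: "opp v \<in> V" using v by simp
  define c where "c = h v \<oplus> h (opp v)"
  have c: "pos c" unfolding c_def by (intro pos_add gen_pos v ov)
  have cc: "c \<in> carrier A" using c posD by blast
  have c1: "pos (\<one> \<ominus> c)"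
  proof -
    have r: "pos (finsum A h (V - {v, opp v}))" by (intro pos_finsum gen_pos) auto
    have "\<one> = c \<oplus> finsum A h (V - {v, opp v})"
      unfolding c_def gen_sum[symmetric] using v ov by (intro finsum_pair_split) auto
    then have "\<one> \<ominus> c = finsum A h (V - {v, opp v})"
      using cc posD(1)[OF r] by (metis a_comm add.inv_solve_right minus_eq one_closed)
    then show ?thesis using r by simp
  qed
  define g where "g u = (if v = u then c else \<zero>) \<oplus> (if w = u then \<one> \<ominus> c else \<zero>)" for u
  have g: "g v = c" "g (opp v) = \<zero>" "g w = \<one> \<ominus> c" "g (opp w) = \<zero>" using w cc by (auto simp: g_def)
  have relg: "sphere_relations n A g" unfolding g_def by (rule segment_relations[OF v w(1-3) c c1])
  have s: "g v \<oplus> g (opp v) = h v \<oplus> h (opp v)" using g cc by (simp add: c_def)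
  define k0 where "k0 u = (if u \<in> {v, opp v} then g u else h u)" for u
  define k1 where "k1 u = (if u \<in> {v, opp v} then h u else g u)" for u
  have rel0: "sphere_relations n A k0" unfolding k0_def by (rule replace_relations[OF rel relg v s])
  have rel1: "sphere_relations n A k1" unfolding k1_def
    by (rule replace_relations[OF relg rel v s[symmetric]])
  note relp = point_relations[OF w(1)]
  obtain \<gamma> where \<gamma>: "\<gamma> \<in> cstar_hom A A" "\<And>u. u \<in> V \<Longrightarrow> \<gamma> (h u) = g u"
    using hom_exists[OF ax i relg] by blast
  obtain \<phi> where \<phi>: "\<phi> \<in> cstar_hom A A" "\<And>u. u \<in> V \<Longrightarrow> \<phi> (h u) = k0 u"
    using hom_exists[OF ax i rel0] by blast
  obtain \<psi> where \<psi>: "\<psi> \<in> cstar_hom A A" "\<And>u. u \<in> V \<Longrightarrow> \<psi> (h u) = k1 u"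
    using hom_exists[OF ax i rel1] by blast
  obtain \<rho> where \<rho>: "\<rho> \<in> cstar_hom A A" "\<And>u. u \<in> V \<Longrightarrow> \<rho> (h u) = (if u = w then \<one> else \<zero>)"
    using hom_exists[OF ax i relp] by blast
  have q1: "K_equal \<gamma> \<pi>" by (rule K_equal_contraction[OF v g(2) relg \<gamma> \<pi>])
  have q2: "K_equal \<phi> \<pi>" by (rule K_equal_contraction[OF v _ rel0 \<phi> \<pi>]) (simp_all add: k0_def g)
  \<comment> \<open>\<open>\<psi>\<close> does not vanish on \<open>h (opp v)\<close>, so it is contracted to \<open>w\<close>; the edge from \<open>w\<close> to \<open>v\<close> does the rest.\<close>
  have "K_equal \<psi> \<rho>"
    by (rule K_equal_contraction[OF w(1) _ rel1 \<psi> \<rho>]) (use w g in \<open>simp_all add: k1_def\<close>)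
  moreover have "K_equal \<rho> \<pi>" by (rule K_equal_contraction[OF v _ relp \<rho> \<pi>]) (use w in auto)
  ultimately have q3: "K_equal \<psi> \<pi>" by (rule K_equal_trans)
  from exchange_homotopy[OF v relg s \<gamma> \<phi>[unfolded k0_def] \<psi>[unfolded k1_def]]
  obtain \<Phi> where \<Phi>: "hom_homotopy A (matalg A 2) \<Phi>" "\<Phi> 0 = (\<lambda>x. diag_pair A x (\<gamma> x))"
    "\<Phi> (1::real) = (\<lambda>x. diag_pair A (\<phi> x) (\<psi> x))" by blast
  show ?thesis by (rule K_equal_of_exchange[OF \<Phi> \<gamma>(1) \<phi>(1) \<psi>(1) \<pi>(1) q1 q2 q3])
qed

end

lemma (in unital_cstar_algebra) scalar_hom: "(\<lambda>c. c \<odot> \<one>) \<in> cstar_hom complex_cstar A"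
  unfolding cstar_hom_def
  by (auto intro!: ring_hom_memI simp: complex_cstar_def sc_add_l sc_mult sc_assoc star_smult
    mult.commute)

theorem proposition3p2:
  fixes n :: nat
    and A :: "'a cstar"
    and h :: "vertex \<Rightarrow> 'a"
    and v :: vertex
    and ev :: "'a \<Rightarrow> complex"
  assumes "1 \<le> n"
    and "universal_sphere_algebra n A h"
    and "v \<in> sphere_vertices n"
    and "is_evaluation n A h v ev"
  shows "K0_map complex_cstar ev \<in> iso (K0 A) (K0 complex_cstar)
       \<and> K1_map complex_cstar ev \<in> iso (K1 A) (K1 complex_cstar)"
proof -
  interpret S: sphere_algebra n A h by unfold_locales (rule assms(2))
  note ax = S.unital_cstar_algebra_axioms unital_cstar_algebra_complex
  have ev: "ev \<in> cstar_hom A complex_cstar"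
    and evh: "w \<in> sphere_vertices n \<Longrightarrow> ev (h w) = (if w = v then 1 else 0)" for w
    using assms(4) by (auto simp: is_evaluation_def)
  let ?\<psi> = "\<lambda>c. c \<odot>\<^bsub>A\<^esub> \<one>\<^bsub>A\<^esub>"
  let ?\<pi> = "\<lambda>x. ?\<psi> (ev x)"
  have F: "cstar_morphism A complex_cstar ev" and G: "cstar_morphism complex_cstar A ?\<psi>"
    using ax ev S.scalar_hom by (simp_all add: cstar_morphismI)
  have k: "S.K_equal ?\<pi> (\<lambda>x. x)"
    by (rule S.K_equal_ident_point[OF assms(1,3)])
       (use cstar_hom_compose[OF ev S.scalar_hom] evh in auto)
  have sect: "ev (?\<psi> c) = c" for c
    using cstar_morphism.smult[OF F S.one_closed, of c] cstar_morphism.one[OF F]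
      by (simp add: complex_cstar_def)
  show ?thesis
    using K0_map_iso[OF F G sect] K1_map_iso[OF F G sect] k unfolding S.K_equal_def sqmtx_map_ident
      by blast
qed

end
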